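(* There exists an unbounded sequence of quadratic polynomials $\{P_m\}_{m=1}^\infty$, where each $P_m$ is of the form $P_m(z)=z^2+c_m$ with $c_m\in\mathbb C$, for which the iterated Julia sets $\mathcal J_m$ ($m\ge 0$) are not uniformly perfect but also not hereditarily non uniformly perfect (HNUP). More precisely, for each $m\ge 0$ one can write $\mathcal J_m=\mathcal G_m\cup\mathcal H_m$, where: 1. for each $m \ge 0$, $\mathcal G_m$ and $\mathcal H_m$ are disjoint and non-empty, and each of the collections $\{\mathcal G_m, m\ge 0\}$ and $\{\mathcal H_m, m\ge 0\}$ is completely invariant; 2. for each $m \ge 0$, $\mathcal G_m$ is a dense relatively $\mathrm G_\delta$ subset of $\mathcal J_m$ and $\mathcal J_{m,\mathrm{thin}}=\mathcal G_m$, so that in particular $\mathcal G_m$ is pointwise thin; 3. for each $m \ge 0$, $\mathcal H_m$ is a dense $\mathrm F_\sigma$ subset of $\mathcal J_m$ and is a countable increasing union of closed sets each of which is uniformly perfect; 4. for each $m \ge 0$, $\overline{\mathcal H}_m=\mathcal J_m$ is not uniformly perfect; 5. for each $m \ge 0$, $\mathcal H_m$ consists of countably infinitely many connected components (in $\mathcal J_m$), each component of which bounds at least one bounded component of the Fatou set $\mathcal F_m$ and is uniformly perfect.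
   Context: Polynomial sequences. Let $\{P_m\}_{m=1}^\infty$ be a sequence of polynomials of degrees $d_m\ge 2$. For $0\le m\le n$ let $Q_{m,n}=P_n\circ\cdots\circ P_{m+2}\circ P_{m+1}$, with $Q_{m,m}=\mathrm{Id}$. For each $m\ge0$ the $m$th iterated Fatou set is $$\mathcal F_m=\{z\in\widehat{\mathbb C}:\{Q_{m,n}\}_{n=m}^\infty\text{ is normal on some neighbourhood of }z\},$$ where normality and neighbourhoods are with respect to the spherical metric/topology on $\widehat{\mathbb C}$; the $m$th iterated Julia set is $\mathcal J_m=\widehat{\mathbb C}\setminus\mathcal F_m$. Bounded sequences. A sequence $P_m(z)=a_{d_m,m}z^{d_m}+\cdots+a_{1,m}z+a_{0,m}$ is bounded if there are an integer $d\ge2$ and real numbers $M\ge0$, $K\ge1$ such that for all $m\ge1$: $2\le d_m\le d$, $1/K\le|a_{d_m,m}|\le K$, and $|a_{k,m}|\le M$ for $0\le k\le d_m-1$. It is unbounded if it is not bounded (for $P_m=z^2+c_m$ this means that $\{c_m\}$ is unbounded). Invariance. A collection of sets $\{X_m,m\ge0\}$ is forward invariant if $P_{m+1}(X_m)=X_{m+1}$ for each $m\ge0$, backward invariant if $P_{m+1}^{-1}(X_{m+1})=X_m$ for each $m\ge0$, and completely invariant if it is both. Annuli and uniform perfectness. A conformal annulus is a doubly connected domain $A\subset\mathbb C$ which can be mapped conformally onto a round annulus $\{w:r<|w-z|<R\}$ for some $0<r<R<\infty$; its modulus is $\operatorname{mod}A=\log(R/r)$. A conformal annulus $A$ separates a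 set $F\subset\mathbb C$ if $F\cap A=\emptyset$ and $F$ meets both components of $\mathbb C\setminus A$. A compact set $F\subset\mathbb C$ with two or more points is uniformly perfect if there is a uniform upper bound on the moduli of all conformal annuli which separate $F$. A compact set $E$ is hereditarily non uniformly perfect (HNUP) if no subset of $E$ is uniformly perfect. Pointwise thinness. A set $E\subset\mathbb C$ is pointwise thin at $z\in E$ if there is a sequence of conformal annuli $A_n$, each of which separates $E$ and has $z$ in the bounded component of its complement, such that $\operatorname{mod}A_n\to+\infty$ while the Euclidean diameter of $A_n$ tends to $0$. $E$ is pointwise thin if it is pointwise thin at each of its points. $\mathcal J_{m,\mathrm{thin}}$ denotes the set of points of $\mathcal J_m$ at which $\mathcal J_m$ is pointwise thin. In item 5, the connected components are those of $\mathcal H_m$ as a subspace of $\mathcal J_m$, and a component $K$ "bounds" a bounded component $U$ of $\mathcal F_m$ if $\partial U\subset K$. *)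

theory Defs
  imports "HOL-Complex_Analysis.Complex_Analysis"
begin

section \<open>The Riemann sphere with the spherical metric\<close>

datatype riemann_sphere = Pt complex | Infty

fun stereo :: "riemann_sphere \<Rightarrow> complex \<times> real" where
  "stereo (Pt z) = ((2 / ((cmod z)\<^sup>2 + 1)) *\<^sub>R z, ((cmod z)\<^sup>2 - 1) / ((cmod z)\<^sup>2 + 1))"
| "stereo Infty = (0, 1)"

lemma norm_stereo: "norm (stereo x) = 1"
proof (cases x)
  case (Pt z)
  have p: "(cmod z)\<^sup>2 + 1 > 0"
    by (simp add: add_nonneg_pos)
  have "(2 * cmod z / ((cmod z)\<^sup>2 + 1))\<^sup>2 + (((cmod z)\<^sup>2 - 1) / ((cmod z)\<^sup>2 + 1))\<^sup>2
      = ((2 * cmod z)\<^sup>2 + ((cmod z)\<^sup>2 - 1)\<^sup>2) / ((cmod z)\<^sup>2 + 1)\<^sup>2"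
    by (simp only: power_divide add_divide_distrib)
  also have "(2 * cmod z)\<^sup>2 + ((cmod z)\<^sup>2 - 1)\<^sup>2 = ((cmod z)\<^sup>2 + 1)\<^sup>2"
    by algebra
  finally show ?thesis
    using p Pt by (simp add: norm_Pair power_divide)
qed (simp add: norm_Pair)

lemma stereo_inject: "stereo x = stereo y \<Longrightarrow> x = y"
proof -
  assume eq: "stereo x = stereo y"
  have pos: "(cmod z)\<^sup>2 + 1 > 0" for z
    by (simp add: add_nonneg_pos)
  have ne: "snd (stereo (Pt z)) = 1 - 2 / ((cmod z)\<^sup>2 + 1)" for z
    using pos[of z] by (simp add: field_simps)
  have ne1: "snd (stereo (Pt z)) \<noteq> 1" for z
    unfolding ne using pos[of z] by simp
  show ?thesis
  proof (cases x)
    case x: (Pt z)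
    show ?thesis
    proof (cases y)
      case y: (Pt w)
      have "2 / ((cmod z)\<^sup>2 + 1) = 2 / ((cmod w)\<^sup>2 + 1)"
        using eq ne[of z] ne[of w] x y by (metis add_left_cancel diff_eq_eq diff_add_cancel)
      moreover have "2 / ((cmod z)\<^sup>2 + 1) \<noteq> 0"
        using pos[of z] by simp
      moreover have "(2 / ((cmod z)\<^sup>2 + 1)) *\<^sub>R z = (2 / ((cmod w)\<^sup>2 + 1)) *\<^sub>R w"
        using eq x y by simp
      ultimately show ?thesis using x y by (metis scaleR_cancel_left)
    next
      case Infty
      then show ?thesis using eq ne1[of z] x by (metis snd_conv stereo.simps(2))
    qed
  next
    case x: Infty
    then show ?thesis using eq ne1 by (cases y) (metis snd_conv stereo.simps(2), simp)
  qed
qed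

lemma arccos_inner_triangle:
  fixes u v w :: "'a::real_inner"
  assumes u: "norm u = 1" and v: "norm v = 1" and w: "norm w = 1"
  shows "arccos (u \<bullet> w) \<le> arccos (u \<bullet> v) + arccos (v \<bullet> w)"
proof -
  have bnd: "\<bar>a \<bullet> b\<bar> \<le> 1" if "norm a = 1" "norm b = 1" for a b :: 'a
    using Cauchy_Schwarz_ineq2[of a b] that by simp
  define x y where "x = u \<bullet> v" and "y = v \<bullet> w"
  have x: "\<bar>x\<bar> \<le> 1" and y: "\<bar>y\<bar> \<le> 1" and z: "\<bar>u \<bullet> w\<bar> \<le> 1"
    using bnd u v w by (auto simp: x_def y_def)
  have uu: "u \<bullet> u = 1" and vv: "v \<bullet> v = 1" and ww: "w \<bullet> w = 1"
    using u v w by (simp_all add: norm_eq_1)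
  have n1: "norm (u - x *\<^sub>R v) = sqrt (1 - x\<^sup>2)"
    by (simp add: norm_eq_sqrt_inner inner_diff inner_commute uu vv x_def power2_eq_square)
  have n2: "norm (w - y *\<^sub>R v) = sqrt (1 - y\<^sup>2)"
    by (simp add: norm_eq_sqrt_inner inner_diff inner_commute ww vv y_def power2_eq_square)
  have "(u - x *\<^sub>R v) \<bullet> (w - y *\<^sub>R v) = u \<bullet> w - x * y"
    by (simp add: inner_diff inner_commute vv x_def y_def)
  then have ge: "u \<bullet> w \<ge> x * y - sqrt (1 - x\<^sup>2) * sqrt (1 - y\<^sup>2)"
    using Cauchy_Schwarz_ineq2[of "u - x *\<^sub>R v" "w - y *\<^sub>R v"] n1 n2 by simp
  show ?thesis
  proof (cases "arccos x + arccos y \<le> pi")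
    case True
    have "cos (arccos x + arccos y) \<le> u \<bullet> w"
      using ge x y by (simp add: cos_add sin_arccos_abs)
    then have "arccos (u \<bullet> w) \<le> arccos (cos (arccos x + arccos y))"
      using z by (intro arccos_le_arccos) auto
    also have "\<dots> = arccos x + arccos y"
      using True x y by (intro arccos_cos) (auto intro!: add_nonneg_nonneg arccos_lbound simp: abs_le_iff)
    finally show ?thesis by (simp add: x_def y_def)
  next
    case False
    moreover have "arccos (u \<bullet> w) \<le> pi"
      using z by (intro arccos_ubound) auto
    ultimately show ?thesis by (simp add: x_def y_def)
  qed
qed

instantiation riemann_sphere :: metric_space
begin

text \<open>Great-circle distance on the unit sphere, i.e. the path metric of \<open>2|dz| / (1 + |z|\<^sup>2)\<close>.\<close>

definition dist_riemann_sphere :: "riemann_sphere \<Rightarrow> riemann_sphere \<Rightarrow> real" where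
  "dist x y = arccos (stereo x \<bullet> stereo y)"

definition uniformity_riemann_sphere_def:
  "(uniformity :: (riemann_sphere \<times> riemann_sphere) filter) = (INF e\<in>{0<..}. principal {(x, y). dist x y < e})"

definition open_riemann_sphere_def:
  "open (U :: riemann_sphere set) \<longleftrightarrow> (\<forall>x\<in>U. \<forall>\<^sub>F (x', y) in uniformity. x' = x \<longrightarrow> y \<in> U)"

instance
proof
  fix x y z :: riemann_sphere
  show "dist x y = 0 \<longleftrightarrow> x = y"
  proof
    assume "dist x y = 0"
    moreover have "\<bar>stereo x \<bullet> stereo y\<bar> \<le> 1"
      using Cauchy_Schwarz_ineq2[of "stereo x" "stereo y"] by (simp add: norm_stereo)
    ultimately have "stereo x \<bullet> stereo y = 1"
      unfolding dist_riemann_sphere_def by (metis cos_arccos_abs cos_zero)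
    moreover have "stereo x \<bullet> stereo x = 1" "stereo y \<bullet> stereo y = 1"
      using norm_stereo by (simp_all add: norm_eq_1 flip: power2_norm_eq_inner)
    ultimately have "(stereo x - stereo y) \<bullet> (stereo x - stereo y) = 0"
      by (simp add: inner_diff inner_commute)
    then show "x = y" by (intro stereo_inject) simp
  qed (simp add: dist_riemann_sphere_def norm_stereo flip: power2_norm_eq_inner)
  show "dist x y \<le> dist x z + dist y z"
    unfolding dist_riemann_sphere_def
    using arccos_inner_triangle[of "stereo x" "stereo z" "stereo y"] norm_stereo
    by (simp add: inner_commute)
qed (simp_all only: uniformity_riemann_sphere_def open_riemann_sphere_def)

end


section \<open>Polynomial sequences, iterated Fatou and Julia sets\<close>

text \<open>Sequences \<open>P\<^sub>1, P\<^sub>2, \<dots>\<close> are functions on \<^typ>\<open>nat\<close>; the value at \<open>0\<close> is never used.\<close>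

definition bounded_poly_seq :: "(nat \<Rightarrow> complex poly) \<Rightarrow> bool" where
  "bounded_poly_seq P \<longleftrightarrow>
     (\<exists>(d::nat) (M::real) (K::real). d \<ge> 2 \<and> M \<ge> 0 \<and> K \<ge> 1 \<and>
        (\<forall>m\<ge>1. 2 \<le> degree (P m) \<and> degree (P m) \<le> d \<and>
               1 / K \<le> cmod (lead_coeff (P m)) \<and> cmod (lead_coeff (P m)) \<le> K \<and>
               (\<forall>k<degree (P m). cmod (coeff (P m) k) \<le> M)))"

text \<open>The extension of a nonconstant polynomial to the sphere.\<close>

fun sphere_poly :: "complex poly \<Rightarrow> riemann_sphere \<Rightarrow> riemann_sphere" where
  "sphere_poly p (Pt z) = Pt (poly p z)"
| "sphere_poly p Infty = Infty"

text \<open>\<open>Q P m n\<close> is \<open>P\<^sub>n \<circ> \<dots> \<circ> P\<^bsub>m+1\<^esub>\<close> for \<open>m \<le> n\<close>.\<close>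

primrec Q :: "(nat \<Rightarrow> complex poly) \<Rightarrow> nat \<Rightarrow> nat \<Rightarrow> riemann_sphere \<Rightarrow> riemann_sphere" where
  "Q P m 0 = id"
| "Q P m (Suc n) = (if m \<le> n then sphere_poly (P (Suc n)) \<circ> Q P m n else id)"

definition normal_on :: "riemann_sphere set \<Rightarrow> (riemann_sphere \<Rightarrow> riemann_sphere) set \<Rightarrow> bool" where
  "normal_on U \<F> \<longleftrightarrow>
     (\<forall>f::nat \<Rightarrow> riemann_sphere \<Rightarrow> riemann_sphere. range f \<subseteq> \<F> \<longrightarrow>
        (\<exists>r g. strict_mono r \<and>
           (\<forall>C. compact C \<and> C \<subseteq> U \<longrightarrow> uniform_limit C (f \<circ> r) g sequentially)))"

definition fatou :: "(nat \<Rightarrow> complex poly) \<Rightarrow> nat \<Rightarrow> riemann_sphere set" where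
  "fatou P m = {z. \<exists>U. open U \<and> z \<in> U \<and> normal_on U {Q P m n | n. m \<le> n}}"

definition julia :: "(nat \<Rightarrow> complex poly) \<Rightarrow> nat \<Rightarrow> riemann_sphere set" where
  "julia P m = - fatou P m"

definition forward_invariant :: "(nat \<Rightarrow> complex poly) \<Rightarrow> (nat \<Rightarrow> complex set) \<Rightarrow> bool" where
  "forward_invariant P X \<longleftrightarrow> (\<forall>m. poly (P (Suc m)) ` X m = X (Suc m))"

definition backward_invariant :: "(nat \<Rightarrow> complex poly) \<Rightarrow> (nat \<Rightarrow> complex set) \<Rightarrow> bool" where
  "backward_invariant P X \<longleftrightarrow> (\<forall>m. poly (P (Suc m)) -` X (Suc m) = X m)"

definition completely_invariant :: "(nat \<Rightarrow> complex poly) \<Rightarrow> (nat \<Rightarrow> complex set) \<Rightarrow> bool" where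
  "completely_invariant P X \<longleftrightarrow> forward_invariant P X \<and> backward_invariant P X"


section \<open>Conformal annuli, uniform perfectness and thinness\<close>

text \<open>
  The modulus is given as a relation; by conformal invariance a domain has at most one modulus.
\<close>

definition has_modulus :: "complex set \<Rightarrow> real \<Rightarrow> bool" where
  "has_modulus A \<mu> \<longleftrightarrow>
     (\<exists>f z r R. 0 < r \<and> r < R \<and> f holomorphic_on A \<and> inj_on f A \<and>
        f ` A = {w. r < cmod (w - z) \<and> cmod (w - z) < R} \<and> \<mu> = ln (R / r))"

text \<open>
  Being doubly connected is read as: the complement in the plane has exactly two components,
  these being the two components referred to in the definition of separation.
\<close>

definition conformal_annulus :: "complex set \<Rightarrow> bool" where
  "conformal_annulus A \<longleftrightarrow>
     open A \<and> connected A \<and> card (components (- A)) = 2 \<and> (\<exists>\<mu>. has_modulus A \<mu>)"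

definition separates_set :: "complex set \<Rightarrow> complex set \<Rightarrow> bool" where
  "separates_set A F \<longleftrightarrow> F \<inter> A = {} \<and> (\<forall>B\<in>components (- A). F \<inter> B \<noteq> {})"

definition uniformly_perfect :: "complex set \<Rightarrow> bool" where
  "uniformly_perfect F \<longleftrightarrow> compact F \<and> (\<exists>x\<in>F. \<exists>y\<in>F. x \<noteq> y) \<and>
     (\<exists>M. \<forall>A \<mu>. conformal_annulus A \<and> separates_set A F \<and> has_modulus A \<mu> \<longrightarrow> \<mu> \<le> M)"

definition hnup :: "complex set \<Rightarrow> bool" where
  "hnup E \<longleftrightarrow> compact E \<and> (\<forall>F\<subseteq>E. \<not> uniformly_perfect F)"

text \<open>
  Boundedness of the annuli is part of their diameters being finite; it has to be demanded
  separately because \<^const>\<open>diameter\<close> has no meaningful value on unbounded sets.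
\<close>

definition pointwise_thin_at :: "complex set \<Rightarrow> complex \<Rightarrow> bool" where
  "pointwise_thin_at E z \<longleftrightarrow> z \<in> E \<and>
     (\<exists>(A::nat \<Rightarrow> complex set) \<mu>.
        (\<forall>n. conformal_annulus (A n) \<and> has_modulus (A n) (\<mu> n) \<and> separates_set (A n) E \<and>
             (\<exists>B\<in>components (- A n). bounded B \<and> z \<in> B) \<and> bounded (A n)) \<and>
        filterlim \<mu> at_top sequentially \<and> (\<lambda>n. diameter (A n)) \<longlonglongrightarrow> 0)"

definition pointwise_thin :: "complex set \<Rightarrow> bool" where
  "pointwise_thin E \<longleftrightarrow> (\<forall>z\<in>E. pointwise_thin_at E z)"

definition thin_part :: "complex set \<Rightarrow> complex set" where
  "thin_part E = {z \<in> E. pointwise_thin_at E z}"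

end

theory Submission
  imports Defs
begin

text \<open>
  At the sparse times \<open>t = 4\<^sup>k\<close> two successive maps \<open>z\<^sup>2 - 2t\<^sup>2\<close> and \<open>z\<^sup>2 - 4t\<^sup>4\<close> compose to
  \<open>z\<^sup>2(z\<^sup>2 - 4t\<^sup>2)\<close>; at all other times the map is \<open>z\<^sup>2\<close>. The points that such a double step sends
  to the disc of radius \<open>2\<close> form a main piece around \<open>0\<close> and two tiny pieces around \<open>2t\<close> and \<open>-2t\<close>.
  Critical orbits either follow one fixed orbit, which is \<open>0\<close> except halfway through a double step,
  or escape quickly.
  The set \<open>H\<close> consists of the Julia points that finally stay in the main pieces, and \<open>G\<close> of those
  that visit the tiny pieces infinitely often. At a point of \<open>G\<close> the thick round annuli around the
  tiny pieces pull back univalently. A point of \<open>H\<close> lies on the boundary of a component of the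
  non-escaping set that contains a domain on which the iterates tend to \<open>0\<close> along the times \<open>t\<close>.
  That finite unions of continua are uniformly perfect follows from Schottky's theorem: an
  injective image of a very thick annulus has a middle curve that is either tiny or far away, hence
  does not separate two large continua.
\<close>

section \<open>Annuli separating continua\<close>

text \<open>The two special parameters are tuned to the critical point: \<open>0\<close> goes to
  \<open>-2t^2\<close> and then to \<open>4t^4 - 4t^4 = 0\<close>. So the parameters are unbounded,
  yet \<open>0\<close> is back at \<open>0\<close> at every epoch and has a basin. The second
  obstacle is an escape radius that works for all times. Epochs grow by the factor 4, so the
  squarings between two double steps raise any modulus above 2 beyond \<open>8t^4\<close>, which
  dominates both parameters, and push any modulus below 1/2 under \<open>1/(8t^4)\<close>. Hence
  radius 2 is an escape radius and radius 1/2 a trapping radius, provided that orbits are inspected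
  at epochs only: halfway through a double step even attracted orbits are huge. As the maps change
  with time there are no periodic points to use for density. Instead, the image of any neighbourhood
  of a Julia point at late epochs covers the ring from 1/4 to 4, so each density claim needs just
  one suitable point in that ring per epoch. The pieces of \<open>H\<close> are finite unions
  because every component of the non-escaping set that stays in the main pieces from a given stage
  on contains a zero of one fixed polynomial.\<close>

abbreviation ann :: "complex \<Rightarrow> real \<Rightarrow> real \<Rightarrow> complex set" where
  "ann z r R \<equiv> {w. r < cmod (w - z) \<and> cmod (w - z) < R}"

lemma open_ann: "open (ann z r R)"
  by (intro open_Collect_conj open_Collect_less continuous_intros)

lemma not_simply_connected_ann:
  assumes "0 \<le> r" "r < R"
  shows "\<not> simply_connected (ann z r R)"
proof
  assume sc: "simply_connected (ann z r R)"
  define t where "t = (r + R) / 2"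
  have t: "r < t" "t < R" "0 < t" using assms by (auto simp: t_def)
  have "winding_number (circlepath z t) z = 0"
    by (rule simply_connected_imp_winding_number_zero [OF sc])
       (use t assms in \<open>auto simp: dist_norm norm_minus_commute\<close>)
  with winding_number_circlepath_centre [OF \<open>0 < t\<close>, of z] show False by simp
qed

text \<open>Lets an open map that is only known to take values in the closed round annulus avoid its
  boundary circles.\<close>

lemma open_subset_closed_ann:
  assumes "open V" "0 < r" "\<And>w. w \<in> V \<Longrightarrow> r \<le> cmod (w - z) \<and> cmod (w - z) \<le> R"
  shows "V \<subseteq> ann z r R"
proof -
  have "V \<subseteq> interior (cball z R)"
    using assms by (intro interior_maximal) (auto simp: dist_norm norm_minus_commute)
  moreover have "V \<subseteq> interior (- ball z r)"
    using assms by (intro interior_maximal) (force simp: dist_norm norm_minus_commute)+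
  ultimately show ?thesis
    using assms(2) by (auto simp: interior_complement dist_norm norm_minus_commute subset_iff)
qed

text \<open>The Schwarz lemma after rescaling. The difference is at most \<open>2 * M\<close>;
  dividing by \<open>3 * M\<close> supplies the strict bound below 1 that
  \<open>Schwarz_Lemma\<close> asks for.\<close>

lemma holomorphic_oscillation:
  assumes hol: "f holomorphic_on ball u0 R" and "0 < R" "0 < M"
    and bd: "\<And>u. u \<in> ball u0 R \<Longrightarrow> cmod (f u) \<le> M" and u: "u \<in> ball u0 R"
  shows "cmod (f u - f u0) \<le> 3 * M * cmod (u - u0) / R"
proof -
  define h where "h = (\<lambda>\<xi>. (f (u0 + of_real R * \<xi>) - f u0) / of_real (3 * M))"
  have in_ball: "u0 + of_real R * \<xi> \<in> ball u0 R" if "cmod \<xi> < 1" for \<xi>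
    using that \<open>0 < R\<close> by (simp add: dist_norm norm_mult)
  have "h holomorphic_on ball 0 1"
    unfolding h_def
    by (intro holomorphic_intros holomorphic_on_compose_gen [OF _ hol, unfolded o_def])
       (use in_ball \<open>0 < M\<close> in auto)
  moreover have "h 0 = 0" by (simp add: h_def)
  moreover have "cmod (h \<xi>) < 1" if "cmod \<xi> < 1" for \<xi>
  proof -
    have "cmod (f (u0 + of_real R * \<xi>) - f u0) \<le> 2 * M"
      using bd[OF in_ball[OF that]] bd[of u0] \<open>0 < R\<close>
        norm_triangle_ineq4[of "f (u0 + of_real R * \<xi>)" "f u0"] by auto
    then show ?thesis
      using \<open>0 < M\<close> by (simp add: h_def norm_divide field_simps)
  qed
  ultimately have S: "cmod (h \<xi>) \<le> cmod \<xi>" if "cmod \<xi> < 1" for \<xi>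
    using Schwarz_Lemma(1)[of h \<xi>] that by blast
  define \<xi> where "\<xi> = (u - u0) / of_real R"
  have "cmod \<xi> < 1"
    using u \<open>0 < R\<close> by (simp add: \<xi>_def norm_divide dist_norm norm_minus_commute)
  from S[OF this] have "cmod (f u - f u0) / (3 * M) \<le> cmod (u - u0) / R"
    using \<open>0 < R\<close> \<open>0 < M\<close> by (simp add: h_def \<xi>_def norm_divide)
  then show ?thesis
    using \<open>0 < R\<close> \<open>0 < M\<close> by (simp add: field_simps)
qed

text \<open>Otherwise infinity is an isolated puncture of \<open>A\<close>. Since \<open>f\<close>
  is bounded, \<open>f (inverse u)\<close> extends over \<open>u = 0\<close>, and by the open
  mapping theorem the new value lies in the open round annulus. So it is also taken at some
  \<open>x0\<close> in \<open>A\<close>, and nearby values are taken both near \<open>x0\<close> and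
  near infinity, against injectivity.\<close>

lemma unbounded_complement_conformal_annulus:
  assumes "open A" "0 < r" "f holomorphic_on A" "inj_on f A" "f ` A = ann z r R"
  shows "\<not> bounded (- A)"
proof
  assume "bounded (- A)"
  then obtain \<rho> where \<rho>: "\<rho> > 0" "- A \<subseteq> ball 0 \<rho>"
    using bounded_subset_ballD by blast
  define e where "e = 1 / \<rho>"
  have e: "e > 0" using \<rho> by (simp add: e_def)
  have invA: "inverse u \<in> A" if "u \<in> ball 0 e" "u \<noteq> 0" for u
  proof -
    have "cmod (inverse u) \<ge> \<rho>"
      using that \<rho> by (simp add: e_def norm_inverse inverse_eq_divide norm_divide field_simps)
    then show ?thesis using \<rho> by (metis ComplI mem_ball_0 not_less subsetD)
  qed
  define F where "F = (\<lambda>u. f (inverse u))"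
  have holF: "F holomorphic_on ball 0 e - {0}"
    unfolding F_def
  proof (rule holomorphic_on_compose_gen [OF _ assms(3), unfolded o_def])
    show "inverse ` (ball 0 e - {0}) \<subseteq> A" using invA by blast
  qed (auto intro!: holomorphic_intros)
  have bound: "r \<le> cmod (F u - z) \<and> cmod (F u - z) \<le> R" if "u \<in> ball 0 e" "u \<noteq> 0" for u
    using invA[OF that] assms(5) unfolding F_def by force
  have "\<forall>\<^sub>F u in at 0. cmod (F u) \<le> R + cmod z"
    unfolding eventually_at
  proof (intro exI conjI ballI impI)
    fix u :: complex assume "u \<noteq> 0 \<and> dist u 0 < e"
    then show "cmod (F u) \<le> R + cmod z"
      using bound[of u] norm_triangle_ineq2[of "F u" z] by (auto simp: dist_norm)
  qed (use e in auto)
  then obtain h where h: "h holomorphic_on ball 0 e" "\<And>u. u \<in> ball 0 e - {0} \<Longrightarrow> h u = F u"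
    using holomorphic_on_extend_bounded[OF holF, of ] e by (metis centre_in_ball interior_open open_ball)
  have F_inj: "u = v" if "F u = F v" "u \<in> ball 0 e - {0}" "v \<in> ball 0 e - {0}" for u v
    using that invA assms(4) unfolding F_def inj_on_def by (metis DiffE inverse_eq_iff_eq singletonI)
  have nonconst: "\<not> h constant_on ball 0 e"
  proof
    assume "h constant_on ball 0 e"
    then have "F (of_real (e/2)) = F (of_real (e/3))"
      using h(2)[of "of_real (e/2)"] h(2)[of "of_real (e/3)"] e unfolding constant_on_def by force
    then show False using F_inj[of "of_real (e/2)" "of_real (e/3)"] e by (force simp: dist_norm)
  qed
  have op: "open (h ` U)" if "open U" "U \<subseteq> ball 0 e" for U
    using open_mapping_thm[OF h(1) _ _ that nonconst] by auto
  have clos: "r \<le> cmod (h u - z) \<and> cmod (h u - z) \<le> R" if "u \<in> ball 0 e" for u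
  proof (cases "u = 0")
    case True
    have "isCont h 0"
      using h(1) e by (meson centre_in_ball continuous_on_eq_continuous_at holomorphic_on_imp_continuous_on open_ball)
    then have lim: "((\<lambda>u. cmod (h u - z)) \<longlongrightarrow> cmod (h 0 - z)) (at 0)"
      by (intro tendsto_intros) (simp add: isCont_def)
    have "\<forall>\<^sub>F u in at 0. r \<le> cmod (h u - z) \<and> cmod (h u - z) \<le> R"
      unfolding eventually_at using e bound h(2) by (intro exI[of _ e]) (auto simp: dist_norm)
    then show ?thesis
      unfolding True using tendsto_lowerbound[OF lim] tendsto_upperbound[OF lim]
      by (simp add: eventually_conj_iff)
  next
    case False
    then show ?thesis using bound[of u] h(2)[of u] that by auto
  qed
  have "h ` ball 0 e \<subseteq> ann z r R"
    using clos assms(2) by (intro open_subset_closed_ann op) auto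
  then obtain x0 where x0: "x0 \<in> A" "f x0 = h 0"
    using assms(5) e by (metis (no_types, lifting) centre_in_ball imageE image_subset_iff)
  define Nx where "Nx = A \<inter> ball x0 1"
  have Nx: "open Nx" "x0 \<in> Nx" using assms x0 by (auto simp: Nx_def)
  have "open (f ` Nx)"
    using assms Nx by (intro open_mapping_thm3) (auto simp: Nx_def intro: holomorphic_on_subset inj_on_subset)
  moreover have "continuous_on (ball 0 e) h" using h(1) holomorphic_on_imp_continuous_on by blast
  ultimately have "open (ball 0 e \<inter> h -` (f ` Nx))"
    using continuous_open_preimage by blast
  moreover have "0 \<in> ball 0 e \<inter> h -` (f ` Nx)" using e Nx(2) x0 by (auto simp flip: x0(2))
  ultimately obtain d where d: "d > 0" "ball 0 d \<subseteq> ball 0 e \<inter> h -` (f ` Nx)"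
    using open_contains_ball by blast
  \<comment> \<open>Small enough that \<open>1 / s\<close> lies outside \<open>ball x0 1\<close>,
    while \<open>h s\<close> is still a value of \<open>f\<close> on \<open>Nx\<close>.\<close>
  define s where "s = min (d/2) (1 / (cmod x0 + 2))"
  have s: "s > 0" "s < d" using d by (auto simp: s_def add_nonneg_pos)
  have sd: "of_real s \<in> ball (0::complex) d" using s by simp
  then have "h (of_real s) \<in> f ` Nx" using d(2) by blast
  then obtain y where y: "y \<in> Nx" "f y = h (of_real s)" by auto
  have sb: "of_real s \<in> ball (0::complex) e" using d(2) sd by blast
  then have "f y = f (inverse (of_real s))" using y(2) h(2)[of "of_real s"] s by (auto simp: F_def)
  then have "y = inverse (of_real s)"
    using assms(4) invA[OF sb] s y(1) by (auto simp: Nx_def inj_on_def)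
  then have "cmod y = 1 / s" using s by (simp add: norm_inverse inverse_eq_divide norm_divide)
  moreover have "1 / s \<ge> cmod x0 + 2"
  proof -
    have "s \<le> 1 / (cmod x0 + 2)" by (simp add: s_def)
    moreover have "cmod x0 + 2 > 0" by (simp add: add_nonneg_pos)
    ultimately show ?thesis using s by (simp add: field_simps)
  qed
  moreover have "cmod y < cmod x0 + 1"
    using y(1) norm_triangle_ineq2[of y x0] by (auto simp: Nx_def dist_norm norm_minus_commute)
  ultimately show False by linarith
qed

text \<open>The preimage of the middle circle is a Jordan curve, and neither side of it lies inside
  \<open>A\<close>: the inside is simply connected whereas both halves of \<open>A\<close> are not,
  and the outside is excluded because the complement of \<open>A\<close> is unbounded. So the curve
  has one of the two complementary components on each side.\<close>

lemma conformal_annulus_middle_curve_separates: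
  assumes opA: "open A" and r: "0 < r" "r < t" "t < R"
    and f: "f holomorphic_on A" "inj_on f A" "f ` A = ann z r R"
    and card: "card (components (- A)) = 2"
    and B: "B1 \<in> components (- A)" "B2 \<in> components (- A)" "B1 \<noteq> B2"
    and S: "connected S" "S \<inter> {x \<in> A. cmod (f x - z) = t} = {}" "S \<inter> B1 \<noteq> {}" "S \<inter> B2 \<noteq> {}"
  shows False
proof -
  obtain g where g: "g holomorphic_on (f ` A)" "\<And>x. x \<in> A \<Longrightarrow> g (f x) = x"
    using holomorphic_has_inverse[OF f(1) opA f(2)] by metis
  have g_in: "g w \<in> A" "f (g w) = w" if "w \<in> ann z r R" for w
  proof -
    have "w \<in> f ` A" using that by (simp add: f(3))
    then obtain x where "x \<in> A" "w = f x" by blast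
    then show "g w \<in> A" "f (g w) = w" using g(2) by auto
  qed
  have contg: "continuous_on (ann z r R) g"
    using g(1) f(3) holomorphic_on_imp_continuous_on by metis
  have injg: "inj_on g (ann z r R)"
    by (rule inj_on_inverseI[where g = f]) (rule g_in(2))
  define c where "c = g \<circ> circlepath z t"
  define \<gamma> where "\<gamma> = {x \<in> A. cmod (f x - z) = t}"
  have sph: "sphere z t \<subseteq> ann z r R" using r by (auto simp: dist_norm norm_minus_commute)
  have pim: "path_image c = \<gamma>"
  proof -
    have "path_image c = g ` sphere z t"
      using r by (simp add: c_def path_image_compose)
    also have "\<dots> = \<gamma>"
      unfolding \<gamma>_def
    proof safe
      fix w assume w: "w \<in> sphere z t"
      with sph have "w \<in> ann z r R" by blast
      then show "g w \<in> A" "cmod (f (g w) - z) = t"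
        using g_in w by (auto simp: dist_norm norm_minus_commute)
    next
      fix x assume "x \<in> A" "t = cmod (f x - z)"
      then show "x \<in> g ` sphere z (cmod (f x - z))"
        using g(2) by (metis (no_types) dist_commute dist_norm image_eqI mem_sphere)
    qed
    finally show ?thesis .
  qed
  have simple: "simple_path c"
    unfolding c_def
    by (rule simple_path_continuous_image)
       (use r sph in \<open>auto simp: simple_path_circlepath intro: continuous_on_subset[OF contg] inj_on_subset[OF injg]\<close>)
  have loop: "pathfinish c = pathstart c"
    by (simp add: c_def pathfinish_compose pathstart_compose)
  define I E where "I = inside \<gamma>" and "E = outside \<gamma>"
  have J: "I \<noteq> {}" "open I" "connected I" "E \<noteq> {}" "open E" "connected E" "bounded I" "\<not> bounded E"
    "I \<inter> E = {}" "I \<union> E = - \<gamma>" "frontier I = \<gamma>" "frontier E = \<gamma>"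
    using Jordan_inside_outside[OF simple loop] by (simp_all add: I_def E_def pim)
  have gimage: "g ` ann z a b = {x \<in> A. a < cmod (f x - z) \<and> cmod (f x - z) < b}"
    if "r \<le> a" "b \<le> R" for a b
  proof safe
    fix w assume w: "a < cmod (w - z)" "cmod (w - z) < b"
    then have "w \<in> ann z r R" using that by auto
    then show "g w \<in> A" "a < cmod (f (g w) - z)" "cmod (f (g w) - z) < b"
      using g_in w by auto
  next
    fix x assume "x \<in> A" "a < cmod (f x - z)" "cmod (f x - z) < b"
    then show "x \<in> g ` ann z a b" using g(2) by (metis (mono_tags, lifting) imageI mem_Collect_eq)
  qed
  have conn: "connected (g ` ann z a b)" if "r \<le> a" "b \<le> R" for a b
    using that
    by (intro connected_continuous_image continuous_on_subset[OF contg] connected_annulus) auto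
  have not_sc: "\<not> simply_connected (g ` ann z a b)" if "r \<le> a" "b \<le> R" "a < b" for a b
  proof -
    have sub: "ann z a b \<subseteq> ann z r R" using that by auto
    have "homeomorphism (ann z a b) (g ` ann z a b) g f"
    proof (rule homeomorphismI)
      have "g ` ann z a b \<subseteq> A" using sub g_in(1) by blast
      then show "continuous_on (g ` ann z a b) f"
        using f(1) continuous_on_subset holomorphic_on_imp_continuous_on by blast
      show "continuous_on (ann z a b) g" by (rule continuous_on_subset[OF contg sub])
      have fg: "f (g w) = w" if "w \<in> ann z a b" for w using g_in(2) sub that by blast
      then show "f ` g ` ann z a b \<subseteq> ann z a b" by auto
      show "f (g w) = w" if "w \<in> ann z a b" for w by (rule fg[OF that])
      show "g (f y) = y" if "y \<in> g ` ann z a b" for y using fg that by auto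
    qed simp
    then have "ann z a b homeomorphic (g ` ann z a b)"
      unfolding homeomorphic_def by blast
    then show ?thesis
      using not_simply_connected_ann[of a b z] that r homeomorphic_simply_connected_eq by fastforce
  qed
  define A1 A2 where "A1 = g ` ann z r t" and "A2 = g ` ann z t R"
  have A12: "A1 \<union> A2 \<union> \<gamma> = A" "A1 \<inter> \<gamma> = {}" "A2 \<inter> \<gamma> = {}"
    unfolding A1_def A2_def \<gamma>_def using r f(3) by (auto simp: gimage)
  have conn12: "connected A1" "connected A2"
    unfolding A1_def A2_def using r by (auto intro: conn)
  have side: "X \<subseteq> I \<or> X \<subseteq> E" if "connected X" "X \<inter> \<gamma> = {}" for X
    using connectedD[OF that(1) J(2) J(5)] J(9,10) that by blast
  have \<gamma>_ne: "\<gamma> \<noteq> {}" using pim by (metis path_image_nonempty)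
  have meets: "A \<inter> I \<noteq> {}" "A \<inter> E \<noteq> {}"
  proof -
    obtain x where x: "x \<in> \<gamma>" using \<gamma>_ne by blast
    then have "x \<in> A" "x \<in> closure I" "x \<in> closure E"
      using J(11,12) by (auto simp: \<gamma>_def frontier_def)
    then show "A \<inter> I \<noteq> {}" "A \<inter> E \<noteq> {}"
      using opA open_Int_closure_eq_empty by blast+
  qed
  have split: "(A1 \<subseteq> I \<and> A2 \<subseteq> E) \<or> (A1 \<subseteq> E \<and> A2 \<subseteq> I)"
    using side[OF conn12(1) A12(2)] side[OF conn12(2) A12(3)] meets A12(1) J(9,10) by blast
  have comp_side: "B \<subseteq> I \<or> B \<subseteq> E" if "B \<in> components (- A)" for B
    using that in_components_connected in_components_subset A12(1)
    by (intro side) fastforce+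
  have "\<not> I \<subseteq> A"
  proof
    assume "I \<subseteq> A"
    then have "I = A1 \<or> I = A2" using split A12 J(9,10) by blast
    moreover have "simply_connected I"
      unfolding I_def using simply_connected_inside_simple_path[OF simple] pim by simp
    ultimately show False
      using not_sc[of r t] not_sc[of t R] r unfolding A1_def A2_def by auto
  qed
  then obtain x where x: "x \<in> I" "x \<in> - A" by blast
  then obtain B where "B \<in> components (- A)" "x \<in> B" using Union_components by blast
  with x comp_side J(9) have Bi: "B \<in> components (- A)" "B \<subseteq> I" by blast+
  have "\<not> E \<subseteq> A"
  proof
    assume "E \<subseteq> A"
    then have "- A \<subseteq> I \<union> \<gamma>" using J(10) by blast
    moreover have "bounded \<gamma>" using pim bounded_simple_path_image[OF simple] by simp
    ultimately have "bounded (- A)" using J(7) by (meson bounded_Un bounded_subset)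
    then show False using unbounded_complement_conformal_annulus[OF opA r(1) f] by blast
  qed
  then obtain y where y: "y \<in> E" "y \<in> - A" by blast
  then obtain B' where "B' \<in> components (- A)" "y \<in> B'" using Union_components by blast
  with y comp_side J(9) have B': "B' \<in> components (- A)" "B' \<subseteq> E" by blast+
  have "B \<noteq> B'" using Bi B' J(9) in_components_nonempty by blast
  then have "{B, B'} = {B1, B2}"
    using card Bi(1) B'(1) assms(9-11) by (auto simp: card_2_iff)
  moreover have "S \<subseteq> I \<or> S \<subseteq> E" using side S(1,2) unfolding \<gamma>_def by blast
  ultimately show False using S(3,4) Bi B' J(9) by (auto simp: doubleton_eq_iff)
qed

text \<open>Normalise the inverse uniformisation by sending \<open>a\<close> to 0 and
  \<open>b\<close> to 1; it then omits 0 and 1, and the exponential pulls it back to a wide strip.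
  If it is large along the whole middle curve, that curve misses a disc joining \<open>a\<close> to
  \<open>e\<close>. If it is moderate at one point, Schottky's theorem bounds it nearby, a wide
  strip makes the curve smaller than \<open>\<delta>\<close>, and the complement of a small disc
  joins \<open>B1\<close> to \<open>B2\<close>.\<close>

lemma modulus_bound_separating_pairs:
  assumes "\<delta> > 0"
  obtains M where "\<And>A \<mu> B1 B2 a b e f. conformal_annulus A \<Longrightarrow> has_modulus A \<mu> \<Longrightarrow>
      B1 \<in> components (- A) \<Longrightarrow> B2 \<in> components (- A) \<Longrightarrow> B1 \<noteq> B2 \<Longrightarrow>
      {a, b} \<subseteq> B1 \<inter> cball 0 D \<Longrightarrow> {e, f} \<subseteq> B2 \<inter> cball 0 D \<Longrightarrow>
      dist a b \<ge> \<delta> \<Longrightarrow> dist e f \<ge> \<delta> \<Longrightarrow> \<mu> \<le> M"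
proof
  \<comment> \<open>\<open>C0 * \<delta>\<close> exceeds the distance of any two points of
    \<open>cball 0 D\<close>. \<open>K\<close> is Schottky's bound on the half disc for an initial
    value of modulus at most \<open>C0\<close>. In \<open>L\<close>, the 17 makes a full turn
    (length below 4) fit into \<open>ball u0 (L/2)\<close>, and the other term makes the curve
    smaller than \<open>\<delta>/2\<close>.\<close>
  define C0 where "C0 = (2 * \<bar>D\<bar> + 1) / \<delta> + 1"
  define K where "K = exp (pi * exp (pi * (2 + 2 * C0 + 12)))"
  define L where "L = max 17 (96 * K * (2 * \<bar>D\<bar> + 1) / \<delta> + 1)"
  have C0: "C0 > 0" using assms by (auto simp: C0_def add_nonneg_pos)
  have K: "K > 0" by (simp add: K_def)
  fix A \<mu> B1 B2 a b e f
  assume A: "conformal_annulus A" "has_modulus A \<mu>"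
    and B: "B1 \<in> components (- A)" "B2 \<in> components (- A)" "B1 \<noteq> B2"
    and ab: "{a, b} \<subseteq> B1 \<inter> cball 0 D" and ef: "{e, f} \<subseteq> B2 \<inter> cball 0 D"
    and dab: "dist a b \<ge> \<delta>" and def: "dist e f \<ge> \<delta>"
  show "\<mu> \<le> 2 * L"
  proof (rule ccontr)
    assume "\<not> \<mu> \<le> 2 * L"
    obtain F z r R where F: "0 < r" "r < R" "F holomorphic_on A" "inj_on F A" "F ` A = ann z r R"
      and \<mu>: "\<mu> = ln (R / r)"
      using A(2) unfolding has_modulus_def by blast
    have opA: "open A" and card: "card (components (- A)) = 2"
      using A(1) by (auto simp: conformal_annulus_def)
    obtain g where g: "g holomorphic_on ann z r R" "\<And>x. x \<in> A \<Longrightarrow> g (F x) = x"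
      using holomorphic_has_inverse[OF F(3) opA F(4)] F(5) by metis
    have g_in: "g w \<in> A" "F (g w) = w" if "w \<in> ann z r R" for w
    proof -
      have "w \<in> F ` A" using that by (simp add: F(5))
      then obtain x where "x \<in> A" "w = F x" by blast
      then show "g w \<in> A" "F (g w) = w" using g(2) by auto
    qed
    have D0: "D \<ge> 0" using ab by auto (meson norm_ge_zero order_trans)
    define t where "t = sqrt (r * R)"
    have t: "r < t" "t < R" "0 < t"
    proof -
      have "r * r < r * R" "r * R < R * R" using F(1,2) by auto
      then have "sqrt (r * r) < t" "t < sqrt (R * R)"
        unfolding t_def using real_sqrt_less_mono by blast+
      then show "r < t" "t < R" using F(1,2) by auto
      then show "0 < t" using F(1) by simp
    qed
    have lnt: "ln t = (ln r + ln R) / 2"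
      using F(1,2) by (simp add: t_def ln_sqrt ln_mult)
    have \<mu>2: "\<mu> = ln R - ln r" using F(1,2) by (simp add: \<mu> ln_div)
    have L: "ln R - ln t > L" "ln t - ln r > L"
      using \<open>\<not> \<mu> \<le> 2 * L\<close> lnt \<mu>2 by auto
    define \<gamma> where "\<gamma> = {x \<in> A. cmod (F x - z) = t}"
    have sep: False if "connected S" "S \<inter> \<gamma> = {}" "S \<inter> B1 \<noteq> {}" "S \<inter> B2 \<noteq> {}" for S
      using conformal_annulus_middle_curve_separates[OF opA F(1) t(1,2) F(3-5) card B] that
      unfolding \<gamma>_def by blast
    have ring: "z + of_real t * exp u \<in> ann z r R" if "\<bar>Re u\<bar> \<le> L" for u
    proof -
      have "cmod (of_real t * exp u) = exp (ln t + Re u)"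
        using t by (simp add: norm_mult exp_add)
      moreover have "exp (ln r) < exp (ln t + Re u)" "exp (ln t + Re u) < exp (ln R)"
        using that L by auto
      ultimately show ?thesis using F(1,2) by auto
    qed
    have ab_ne: "a \<noteq> b" using dab assms by auto
    \<comment> \<open>This is the normalised map in logarithmic coordinates; the middle curve is the
      image of the imaginary axis.\<close>
    define H where "H = (\<lambda>u. (g (z + of_real t * exp u) - a) / (b - a))"
    have H_eq: "g (z + of_real t * exp u) - a = H u * (b - a)" for u
      using ab_ne by (simp add: H_def)
    have notA: "a \<notin> A" "b \<notin> A" using ab B(1) in_components_subset by fastforce+
    have H01: "H u \<noteq> 0" "H u \<noteq> 1" if "\<bar>Re u\<bar> \<le> L" for u
      using g_in(1)[OF ring[OF that]] notA ab_ne by (auto simp: H_def)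
    \<comment> \<open>A logarithm of a unit number has imaginary part at most pi in modulus, so
      within distance 4 of any \<open>u0\<close> on the axis the whole curve is traversed.\<close>
    have \<gamma>_param: "\<exists>u. Re u = 0 \<and> cmod (u - u0) < 4 \<and> x = g (z + of_real t * exp u)"
      if "x \<in> \<gamma>" "Re u0 = 0" for x u0
    proof -
      define w where "w = (F x - z) / of_real t / exp u0"
      have w: "cmod w = 1" using that t by (auto simp: w_def \<gamma>_def norm_divide norm_mult)
      then have "w \<noteq> 0" by auto
      define v where "v = Ln w"
      have v: "exp v = w" "Re v = 0" "\<bar>Im v\<bar> \<le> pi"
        using \<open>w \<noteq> 0\<close> w Im_Ln_le_pi[of w] mpi_less_Im_Ln[of w] by (auto simp: v_def Re_Ln)
      have "cmod v < 4" using cmod_le[of v] v pi_less_4 by auto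
      moreover have "z + of_real t * exp (u0 + v) = F x"
        using t by (simp add: exp_add v w_def)
      ultimately show ?thesis
        using that v g(2) by (intro exI[of _ "u0 + v"]) (auto simp: \<gamma>_def)
    qed
    show False
    proof (cases "\<exists>u. Re u = 0 \<and> cmod (H u) \<le> C0")
      case False
      have "ball a (C0 * \<delta>) \<inter> \<gamma> = {}"
      proof -
        have "x \<notin> ball a (C0 * \<delta>)" if x: "x \<in> \<gamma>" for x
        proof -
          obtain u where u: "Re u = 0" "x = g (z + of_real t * exp u)"
            using \<gamma>_param[OF x, of 0] by auto
          have "dist x a = cmod (H u) * dist a b"
            using u H_eq by (simp add: dist_norm norm_mult norm_minus_commute)
          also have "\<dots> \<ge> C0 * \<delta>"
            using False u C0 dab assms by (intro mult_mono) (auto simp: not_le less_imp_le)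
          finally show ?thesis by (simp add: dist_commute)
        qed
        then show ?thesis by blast
      qed
      moreover have "a \<in> ball a (C0 * \<delta>)" using C0 assms by simp
      moreover have "e \<in> ball a (C0 * \<delta>)"
      proof -
        have "dist a e \<le> 2 * D" using ab ef norm_triangle_ineq4[of a e] by (auto simp: dist_norm)
        also have "\<dots> < C0 * \<delta>" using assms D0 by (simp add: C0_def field_simps add_pos_nonneg)
        finally show ?thesis by simp
      qed
      ultimately show False
        using ab ef by (intro sep[OF connected_ball, of a "C0 * \<delta>"]) blast+
    next
      case True
      then obtain u0 where u0: "Re u0 = 0" "cmod (H u0) \<le> C0" by blast
      have L17: "L \<ge> 17" by (simp add: L_def)
      have Re_bound: "\<bar>Re u\<bar> \<le> L" if "cmod (u - u0) \<le> L" for u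
        using abs_Re_le_cmod[of "u - u0"] u0 that by simp
      have holH: "H holomorphic_on cball u0 L"
        unfolding H_def
      proof (intro holomorphic_intros)
        show "(\<lambda>u. g (z + of_real t * exp u)) holomorphic_on cball u0 L"
        proof (rule holomorphic_on_compose_gen [OF _ g(1), unfolded o_def])
          show "(\<lambda>u. z + of_real t * exp u) ` cball u0 L \<subseteq> ann z r R"
            using ring Re_bound by (metis (no_types, lifting) dist_commute dist_norm image_subsetI mem_cball)
        qed (intro holomorphic_intros)
      qed (use ab_ne in auto)
      have HK: "cmod (H u) \<le> K" if "u \<in> ball u0 (L/2)" for u
      proof -
        define h where "h = (\<lambda>\<xi>. H (u0 + of_real L * \<xi>))"
        have dom: "u0 + of_real L * \<xi> \<in> cball u0 L" if "\<xi> \<in> cball 0 1" for \<xi>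
          using that L17 by (simp add: dist_norm norm_mult)
        have "cmod (h ((u - u0) / of_real L)) \<le> exp (pi * exp (pi * (2 + 2 * C0 + 12 * (1/2) / (1 - 1/2))))"
        proof (rule Schottky[where f = h and r = C0 and t = "1/2" and z = "(u - u0) / of_real L"])
          show "h holomorphic_on cball 0 1"
            unfolding h_def
            by (intro holomorphic_on_compose_gen [OF _ holH, unfolded o_def] holomorphic_intros)
               (use dom in auto)
          show "cmod (h 0) \<le> C0" using u0 by (simp add: h_def)
          show "\<not> (h \<xi> = 0 \<or> h \<xi> = 1)" if "\<xi> \<in> cball 0 1" for \<xi>
            using H01[OF Re_bound] dom[OF that] unfolding h_def
            by (metis dist_commute dist_norm mem_cball)
          show "cmod ((u - u0) / of_real L) \<le> 1/2"
            using \<open>u \<in> ball u0 (L/2)\<close> L17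
            by (simp add: norm_divide dist_norm norm_minus_commute field_simps)
        qed auto
        then show ?thesis using L17 by (simp add: h_def K_def)
      qed
      have osc: "cmod (H u - H u0) \<le> 24 * K / L" if "cmod (u - u0) < 4" for u
      proof -
        have "cmod (H u - H u0) \<le> 3 * K * cmod (u - u0) / (L/2)"
          by (rule holomorphic_oscillation)
             (use L17 K HK that in \<open>auto simp: dist_norm norm_minus_commute intro: holomorphic_on_subset[OF holH]\<close>)
        also have "\<dots> \<le> 3 * K * 4 / (L/2)"
          using that K L17 by (intro divide_right_mono mult_left_mono) auto
        finally show ?thesis by (simp add: field_simps)
      qed
      define x0 where "x0 = g (z + of_real t * exp u0)"
      have \<gamma>_small: "\<gamma> \<subseteq> ball x0 (\<delta>/2)"
      proof
        fix x assume "x \<in> \<gamma>"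
        then obtain u where u: "cmod (u - u0) < 4" "x = g (z + of_real t * exp u)"
          using \<gamma>_param u0 by blast
        have "x - x0 = (H u - H u0) * (b - a)"
          unfolding left_diff_distrib H_eq[symmetric] using u by (simp add: x0_def)
        then have "dist x x0 = cmod (H u - H u0) * dist a b"
          by (simp add: dist_norm norm_mult norm_minus_commute)
        also have "\<dots> \<le> (24 * K / L) * (2 * D)"
          using osc[OF u(1)] ab norm_triangle_ineq4[of a b] K L17
          by (intro mult_mono) (auto simp: dist_norm)
        also have "\<dots> < \<delta> / 2"
        proof -
          have "96 * K * (2 * D + 1) / \<delta> < L" using D0 by (simp add: L_def)
          then have "96 * K * (2 * D + 1) < L * \<delta>" using assms by (simp add: field_simps)
          moreover have "96 * K * (2 * D + 1) = 192 * (K * D) + 96 * K" by (simp add: algebra_simps)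
          moreover have "K * D \<ge> 0" using K D0 by simp
          ultimately have "96 * (K * D) < L * \<delta>" using K by linarith
          then show ?thesis using L17 by (simp add: field_simps)
        qed
        finally show "x \<in> ball x0 (\<delta>/2)" by (simp add: dist_commute)
      qed
      have out: "\<exists>y\<in>{p, q}. y \<notin> ball x0 (\<delta>/2)" if "dist p q \<ge> \<delta>" for p q
        using dist_triangle2[of p q x0] that by (auto simp: dist_commute)
      have "connected (- ball x0 (\<delta>/2))"
        by (rule connected_complement_bounded_convex) auto
      moreover have "- ball x0 (\<delta>/2) \<inter> B1 \<noteq> {}" "- ball x0 (\<delta>/2) \<inter> B2 \<noteq> {}"
        using out[OF dab] out[OF def] ab ef by auto
      ultimately show False using sep \<gamma>_small by blast
    qed
  qed
qed

text \<open>A continuum that avoids the annulus lies in one complementary component, so both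
  components contain a member of the family and hence its chosen pair of points. Finiteness keeps
  the least distance \<open>\<delta>\<close> of these pairs positive.\<close>

lemma uniformly_perfect_finite_Union_continua:
  assumes "finite \<C>" "\<C> \<noteq> {}"
    and C: "\<And>C. C \<in> \<C> \<Longrightarrow> compact C \<and> connected C \<and> (\<exists>x\<in>C. \<exists>y\<in>C. x \<noteq> y)"
  shows "uniformly_perfect (\<Union>\<C>)"
proof -
  have comp: "compact (\<Union>\<C>)" using assms by (auto intro: compact_Union)
  then obtain D where D: "\<Union>\<C> \<subseteq> cball 0 D"
    using compact_imp_bounded[OF comp] bounded_subset_ballD[of _ 0] ball_subset_cball by (meson order_trans)
  have "\<exists>p. fst p \<in> C \<and> snd p \<in> C \<and> fst p \<noteq> snd p" if "C \<in> \<C>" for C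
    using C[OF that] by auto
  then obtain p where p: "\<And>C. C \<in> \<C> \<Longrightarrow> fst (p C) \<in> C \<and> snd (p C) \<in> C \<and> fst (p C) \<noteq> snd (p C)"
    by metis
  define \<delta> where "\<delta> = Min ((\<lambda>C. dist (fst (p C)) (snd (p C))) ` \<C>)"
  have \<delta>0: "\<delta> > 0" unfolding \<delta>_def using assms p by (subst Min_gr_iff) auto
  have \<delta>: "\<delta> \<le> dist (fst (p C)) (snd (p C))" if "C \<in> \<C>" for C
    unfolding \<delta>_def using assms(1) that by (intro Min_le) auto
  obtain M where M: "\<And>A \<mu> B1 B2 a b e f. conformal_annulus A \<Longrightarrow> has_modulus A \<mu> \<Longrightarrow>
      B1 \<in> components (- A) \<Longrightarrow> B2 \<in> components (- A) \<Longrightarrow> B1 \<noteq> B2 \<Longrightarrow>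
      {a, b} \<subseteq> B1 \<inter> cball 0 D \<Longrightarrow> {e, f} \<subseteq> B2 \<inter> cball 0 D \<Longrightarrow>
      dist a b \<ge> \<delta> \<Longrightarrow> dist e f \<ge> \<delta> \<Longrightarrow> \<mu> \<le> M"
    using modulus_bound_separating_pairs[OF \<delta>0, of D] by blast
  have "\<mu> \<le> M" if A: "conformal_annulus A" "separates_set A (\<Union>\<C>)" "has_modulus A \<mu>" for A \<mu>
  proof -
    have "card (components (- A)) = 2" using A by (simp add: conformal_annulus_def)
    then obtain B1 B2 where B: "components (- A) = {B1, B2}" "B1 \<noteq> B2" by (auto simp: card_2_iff)
    have "\<exists>C\<in>\<C>. C \<subseteq> B" if "B \<in> components (- A)" for B
    proof -
      obtain C where Cm: "C \<in> \<C>" "C \<inter> B \<noteq> {}"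
        using A(2) \<open>B \<in> components (- A)\<close> unfolding separates_set_def by blast
      moreover have "C \<subseteq> - A" using A(2) Cm(1) by (auto simp: separates_set_def)
      ultimately show ?thesis using components_maximal[OF that] C[OF Cm(1)] by blast
    qed
    then obtain C1 C2 where C12: "C1 \<in> \<C>" "C1 \<subseteq> B1" "C2 \<in> \<C>" "C2 \<subseteq> B2" using B by (metis insertCI)
    show ?thesis
    proof (rule M[OF A(1,3)])
      show "{fst (p C1), snd (p C1)} \<subseteq> B1 \<inter> cball 0 D" "{fst (p C2), snd (p C2)} \<subseteq> B2 \<inter> cball 0 D"
        using p[OF C12(1)] p[OF C12(3)] C12 D by blast+
    qed (use B \<delta>[OF C12(1)] \<delta>[OF C12(3)] in auto)
  qed
  moreover have "\<exists>x\<in>\<Union>\<C>. \<exists>y\<in>\<Union>\<C>. x \<noteq> y" using assms(2) C by blast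
  ultimately show ?thesis
    unfolding uniformly_perfect_def using comp by blast
qed

section \<open>Topology of the plane and the sphere\<close>

text \<open>If \<open>L\<close> missed the fibre of some \<open>x\<close> in the component
  \<open>N'\<close>, Sura-Bura would give a compact, relatively open \<open>K\<close> that contains
  \<open>L\<close> and still misses this fibre. Its image is relatively open in \<open>N\<close>, as
  \<open>p\<close> is open, and closed, as \<open>K\<close> is compact, and so it would disconnect
  \<open>N'\<close>.\<close>

lemma component_of_preimage_onto:
  fixes p :: "'a::euclidean_space \<Rightarrow> 'b::euclidean_space"
  assumes cont: "continuous_on UNIV p" and op: "\<And>U. open U \<Longrightarrow> open (p ` U)"
    and cpt: "compact (p -` N)" and L: "L \<in> components (p -` N)"
  shows "p ` L \<in> components N"
proof -
  have Lsub: "L \<subseteq> p -` N" using L by (rule in_components_subset)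
  have conn: "connected (p ` L)"
    using in_components_connected[OF L] continuous_on_subset[OF cont subset_UNIV]
    by (intro connected_continuous_image)
  have ne: "p ` L \<noteq> {}" using in_components_nonempty[OF L] by simp
  have cL: "compact L" using compact_components[OF cpt L] .
  have "p ` L \<subseteq> N" using Lsub by blast
  then obtain N' where N': "N' \<in> components N" "p ` L \<subseteq> N'"
    using exists_component_superset[OF \<open>p ` L \<subseteq> N\<close> _ conn] ne \<open>p ` L \<subseteq> N\<close> by (metis subset_empty)
  have "N' \<subseteq> p ` L"
  proof (rule ccontr)
    assume "\<not> N' \<subseteq> p ` L"
    then obtain x where x: "x \<in> N'" "x \<notin> p ` L" by blast
    have "open (- (p -` {x}))"
      using continuous_closed_vimage[of "{x}" p] cont by (simp add: continuous_on_eq_continuous_at open_Compl)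
    moreover have "L \<subseteq> - (p -` {x})" using x by blast
    ultimately obtain K where K: "openin (top_of_set (p -` N)) K" "compact K" "L \<subseteq> K" "K \<subseteq> - (p -` {x})"
      using Sura_Bura_clopen_subset[OF closed_imp_locally_compact[OF compact_imp_closed[OF cpt]] L cL] by blast
    from K(1) obtain V where V: "open V" "K = p -` N \<inter> V" by (auto simp: openin_open)
    have "compact (p ` K)"
      using K(2) cont by (meson compact_continuous_image continuous_on_subset subset_UNIV)
    then have clo: "closed (p ` K)" by (rule compact_imp_closed)
    have eq: "p ` K = N \<inter> p ` V" using V(2) by auto
    have "N' \<subseteq> N" "connected N'" using N' in_components_subset in_components_connected by blast+
    moreover have "x \<in> (- p ` K) \<inter> N'" using K(4) x by auto
    moreover have "p ` L \<subseteq> p ` V \<inter> N'" using K(3) V(2) N'(2) by auto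
    moreover have "open (p ` V)" "open (- p ` K)" using op V clo by auto
    moreover have "p ` V \<inter> (- p ` K) \<inter> N' = {}" "N' \<subseteq> p ` V \<union> - p ` K"
      using eq \<open>N' \<subseteq> N\<close> by blast+
    ultimately show False
      using connectedD[of N' "p ` V" "- p ` K"] ne by (metis empty_iff subset_empty)
  qed
  then show ?thesis using N' by (metis order_antisym)
qed

lemma components_Un_disjoint_closed:
  fixes X Y :: "'a::topological_space set"
  assumes "closed X" "closed Y" "connected X" "connected Y" "X \<inter> Y = {}" "X \<noteq> {}" "Y \<noteq> {}"
  shows "components (X \<union> Y) = {X, Y}"
proof -
  have max: "X \<in> components (X \<union> Y)"
    if "closed X" "closed Y" "connected X" "X \<inter> Y = {}" "X \<noteq> {}" for X Y :: "'a set"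
    unfolding in_components_maximal
  proof (intro conjI allI impI)
    fix D assume D: "D \<noteq> {} \<and> X \<subseteq> D \<and> D \<subseteq> X \<union> Y \<and> connected D"
    then have "D \<inter> X = {} \<or> D \<inter> Y = {}"
      using connected_closedD[of D X Y] that by blast
    then show "D = X" using D that by blast
  qed (use that in auto)
  have "X \<in> components (X \<union> Y)" "Y \<in> components (X \<union> Y)"
    using max[of X Y] max[of Y X] assms by (auto simp: Un_commute)
  moreover have "C = X \<or> C = Y" if "C \<in> components (X \<union> Y)" for C
  proof -
    have "C \<subseteq> X \<union> Y" "C \<noteq> {}"
      using that in_components_subset in_components_nonempty by blast+
    then show ?thesis
      using components_nonoverlap[OF that] calculation by blast
  qed
  ultimately show ?thesis by blast
qed

lemma conformal_annulus_univalent_image: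
  assumes hol: "G holomorphic_on ball s R" and inj: "inj_on G (ball s R)"
    and r: "0 < r" "r < \<rho>" "\<rho> < R"
  shows "conformal_annulus (G ` ann s r \<rho>)" "has_modulus (G ` ann s r \<rho>) (ln (\<rho> / r))"
    "bounded (G ` ball s \<rho>)"
    "components (- (G ` ann s r \<rho>)) = {G ` cball s r, - G ` ball s \<rho>}"
proof -
  have sub: "ann s r \<rho> \<subseteq> ball s R" "cball s r \<subseteq> ball s R" "ball s \<rho> \<subseteq> ball s R" "cball s \<rho> \<subseteq> ball s R"
    using r by (auto simp: dist_norm norm_minus_commute)
  have contG: "continuous_on (ball s R) G" using hol holomorphic_on_imp_continuous_on by blast
  have op: "open (G ` U)" if "open U" "U \<subseteq> ball s R" for U
    using that hol inj by (intro open_mapping_thm3) (auto intro: holomorphic_on_subset inj_on_subset)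
  have opA: "open (G ` ann s r \<rho>)" "open (G ` ball s \<rho>)"
    using op sub open_ann by auto
  have connA: "connected (G ` ann s r \<rho>)"
    by (intro connected_continuous_image continuous_on_subset[OF contG] connected_annulus sub) auto
  have "compact (G ` cball s \<rho>)"
    by (intro compact_continuous_image continuous_on_subset[OF contG] sub) auto
  then show bd: "bounded (G ` ball s \<rho>)"
    by (meson ball_subset_cball bounded_subset compact_imp_bounded image_mono)
  obtain f where f: "f holomorphic_on (G ` ball s R)" "\<And>x. x \<in> ball s R \<Longrightarrow> f (G x) = x"
    using holomorphic_has_inverse[OF hol open_ball inj] by metis
  show modA: "has_modulus (G ` ann s r \<rho>) (ln (\<rho> / r))"
    unfolding has_modulus_def
  proof (intro exI conjI)
    show "f holomorphic_on (G ` ann s r \<rho>)" using f(1) sub(1) by (meson holomorphic_on_subset image_mono)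
    show "inj_on f (G ` ann s r \<rho>)" using f(2) sub(1) by (auto simp: inj_on_def subset_iff)
    show "f ` G ` ann s r \<rho> = ann s r \<rho>"
      unfolding image_image using f(2) sub(1) by (force simp: image_iff subset_iff)
  qed (use r in auto)
  have compl: "- (G ` ann s r \<rho>) = G ` cball s r \<union> - G ` ball s \<rho>"
  proof -
    have dj: "G ` ann s r \<rho> \<inter> G ` cball s r = {}"
      using inj_on_image_Int[OF inj sub(1,2)] by (auto simp: dist_norm norm_minus_commute)
    have "ball s \<rho> = ann s r \<rho> \<union> cball s r" using r by (auto simp: dist_norm norm_minus_commute)
    then have "G ` ball s \<rho> = G ` ann s r \<rho> \<union> G ` cball s r" by (metis image_Un)
    then show ?thesis using dj by blast
  qed
  show comps: "components (- (G ` ann s r \<rho>)) = {G ` cball s r, - G ` ball s \<rho>}"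
    unfolding compl
  proof (rule components_Un_disjoint_closed)
    have "compact (G ` cball s r)"
      by (intro compact_continuous_image continuous_on_subset[OF contG] sub) auto
    then show "closed (G ` cball s r)" by (rule compact_imp_closed)
    show "connected (G ` cball s r)"
      by (intro connected_continuous_image continuous_on_subset[OF contG] sub) auto
    show "closed (- G ` ball s \<rho>)" using opA by auto
    have "ball s \<rho> homeomorphic (G ` ball s \<rho>)"
      unfolding homeomorphic_def
    proof (intro exI homeomorphismI)
      show "continuous_on (ball s \<rho>) G" by (rule continuous_on_subset[OF contG sub(3)])
      show "continuous_on (G ` ball s \<rho>) f"
        using f(1) sub(3) by (meson continuous_on_subset holomorphic_on_imp_continuous_on image_mono)
    qed (use f(2) sub(3) in \<open>auto simp: subset_iff\<close>)
    then have "simply_connected (G ` ball s \<rho>)"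
      using homeomorphic_simply_connected_eq convex_imp_simply_connected by blast
    then have "\<forall>C \<in> components (- G ` ball s \<rho>). \<not> bounded C"
      using simply_connected_eq_unbounded_complement_components[OF opA(2)] by blast
    then show "connected (- G ` ball s \<rho>)"
      using cobounded_unique_unbounded_components[of "- G ` ball s \<rho>"] bd
      by (metis DIM_complex connected_eq_connected_components_eq double_complement order_refl)
    show "G ` cball s r \<inter> - G ` ball s \<rho> = {}" using r by (auto simp: dist_norm norm_minus_commute)
    show "G ` cball s r \<noteq> {}" using r by auto
    show "- G ` ball s \<rho> \<noteq> {}" using bd not_bounded_UNIV by (metis Compl_eq_Diff_UNIV Diff_eq_empty_iff bounded_subset)
  qed
  have "s \<in> cball s r" "s \<in> ball s \<rho>" using r by auto
  then have "G ` cball s r \<noteq> - G ` ball s \<rho>" by blast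
  then show "conformal_annulus (G ` ann s r \<rho>)"
    unfolding conformal_annulus_def comps using opA connA modA by auto
qed

text \<open>A bounded component of the complement lies in the convex hull of \<open>A\<close>, and
  passing to the hull does not increase the diameter.\<close>

lemma dist_le_diameter_bounded_component:
  fixes A :: "complex set"
  assumes "bounded A" and B: "B \<in> components (- A)" "bounded B" and xy: "x \<in> B" "y \<in> B"
  shows "dist x y \<le> diameter A"
proof -
  have "B \<subseteq> inside A"
    using B by (auto simp: inside_def components_def connected_component_eq_eq)
       (metis ComplD connected_component_eq connected_component_in mem_Collect_eq)+
  moreover have "inside A \<subseteq> convex hull A"
    using outside_convex[OF convex_convex_hull] outside_mono[OF hull_subset[of A convex]]
      inside_Un_outside inside_Int_outside by blast
  ultimately have hull: "x \<in> convex hull A" "y \<in> convex hull A" using xy by auto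
  have "convex hull A \<subseteq> cball a (diameter A)" if "a \<in> A" for a
    using diameter_bounded_bound[OF assms(1) that] by (intro hull_minimal) auto
  then have "A \<subseteq> cball x (diameter A)" using hull by (force simp: dist_commute)
  then have "convex hull A \<subseteq> cball x (diameter A)" by (intro hull_minimal) auto
  then show ?thesis using hull by auto
qed

section \<open>Planar coordinates on the sphere and criteria for normality\<close>

lemma stereo_inner_bounds: "\<bar>stereo x \<bullet> stereo y\<bar> \<le> 1"
  using Cauchy_Schwarz_ineq2[of "stereo x" "stereo y"] by (simp add: norm_stereo)

lemma continuous_on_Pt: "continuous_on S Pt"
proof -
  have pos: "(cmod z)\<^sup>2 + 1 \<noteq> 0" for z by (smt (verit) zero_le_power2)
  have "isCont Pt z" for z
    unfolding isCont_def tendsto_dist_iff[of Pt]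
  proof -
    have "continuous_on UNIV (\<lambda>w. stereo (Pt w))"
      by (simp, intro continuous_intros) (use pos in auto)
    then have "continuous_on UNIV (\<lambda>w. arccos (stereo (Pt w) \<bullet> stereo (Pt z)))"
      using stereo_inner_bounds
      by (intro continuous_on_arccos continuous_intros) (auto simp: abs_le_iff minus_le_iff simp del: stereo.simps)
    then have "isCont (\<lambda>w. dist (Pt w) (Pt z)) z"
      unfolding dist_riemann_sphere_def by (simp add: continuous_on_eq_continuous_at)
    then show "((\<lambda>w. dist (Pt w) (Pt z)) \<longlongrightarrow> 0) (at z)" by (simp add: isCont_def)
  qed
  then show ?thesis by (simp add: continuous_at_imp_continuous_on)
qed

lemma dist_Pt_Infty: "dist (Pt z) Infty = arccos (1 - 2 / ((cmod z)\<^sup>2 + 1))"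
proof -
  have "(cmod z)\<^sup>2 + 1 \<noteq> 0" by (smt (verit) zero_le_power2)
  then show ?thesis by (simp add: dist_riemann_sphere_def field_simps)
qed

lemma dist_Pt_Infty_le_iff: "dist (Pt z) Infty \<le> dist (Pt w) Infty \<longleftrightarrow> cmod w \<le> cmod z"
proof -
  have p: "(cmod z)\<^sup>2 + 1 > 0" for z by (smt (verit) zero_le_power2)
  have b: "\<bar>1 - 2 / ((cmod z)\<^sup>2 + 1)\<bar> \<le> 1" for z
    using p[of z] by (simp add: field_simps abs_le_iff)
  have "dist (Pt z) Infty \<le> dist (Pt w) Infty \<longleftrightarrow> 1 - 2 / ((cmod w)\<^sup>2 + 1) \<le> 1 - 2 / ((cmod z)\<^sup>2 + 1)"
    unfolding dist_Pt_Infty using arccos_le_mono b by blast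
  also have "\<dots> \<longleftrightarrow> (cmod w)\<^sup>2 \<le> (cmod z)\<^sup>2"
    using p[of z] p[of w] by (simp add: field_simps)
  finally show ?thesis by (simp add: power2_le_iff_abs_le)
qed

lemma Pt_near_Infty:
  assumes "e > 0"
  obtains R where "\<And>z. cmod z \<ge> R \<Longrightarrow> dist (Pt z) Infty < e"
proof
  \<comment> \<open>The cap at 1 keeps the angle below pi, so that
    \<open>arccos (cos d) = d\<close>.\<close>
  define d where "d = min e 1"
  have d: "d > 0" "d \<le> 1" "d \<le> e" using assms by (auto simp: d_def)
  have c: "cos d < 1" using cos_monotone_0_pi[of 0 d] d pi_gt3 by simp
  define R where "R = 2 / (1 - cos d) + 1"
  fix z assume z: "cmod z \<ge> R"
  have R1: "R \<ge> 1" using c by (simp add: R_def)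
  then have "R * 1 \<le> cmod z * cmod z" using z by (intro mult_mono) auto
  then have "2 / (1 - cos d) < (cmod z)\<^sup>2 + 1" by (simp add: R_def power2_eq_square)
  moreover have p: "(cmod z)\<^sup>2 + 1 > 0" by (smt (verit) zero_le_power2)
  ultimately have *: "cos d < 1 - 2 / ((cmod z)\<^sup>2 + 1)" using c by (simp add: field_simps)
  have "2 / ((cmod z)\<^sup>2 + 1) \<ge> 0" by simp
  then have "arccos (1 - 2 / ((cmod z)\<^sup>2 + 1)) < arccos (cos d)"
    by (intro arccos_less_arccos *) (auto simp: cos_ge_minus_one)
  also have "\<dots> = d" using d pi_gt3 by (intro arccos_cos) auto
  finally show "dist (Pt z) Infty < e" using d by (simp add: dist_Pt_Infty)
qed

lemma compact_Pt_image: "compact K \<Longrightarrow> compact (Pt ` K)"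
  by (intro compact_continuous_image continuous_on_Pt)

text \<open>Inside a disc, the complement of the image is a closed spherical cap around
  \<open>Infty\<close> together with the image of a compact set.\<close>

lemma open_Pt_image:
  assumes "open V"
  shows "open (Pt ` V)"
  unfolding open_subopen[of "Pt ` V"]
proof
  fix x assume "x \<in> Pt ` V"
  then obtain z where z: "z \<in> V" "x = Pt z" by blast
  define R where "R = cmod z + 1"
  define W where "W = V \<inter> ball 0 R"
  have R: "R > 0" by (simp add: R_def add_nonneg_pos)
  have "{y. dist y Infty \<le> dist (Pt (of_real R)) Infty} = insert Infty (Pt ` (- ball 0 R))"
  proof (rule set_eqI)
    fix y show "y \<in> {y. dist y Infty \<le> dist (Pt (of_real R)) Infty} \<longleftrightarrow> y \<in> insert Infty (Pt ` (- ball 0 R))"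
      using R by (cases y) (auto simp: dist_Pt_Infty_le_iff image_iff)
  qed
  moreover have "closed {y. dist y Infty \<le> dist (Pt (of_real R)) Infty}"
    by (intro closed_Collect_le continuous_intros)
  ultimately have cl: "closed (insert Infty (Pt ` (- ball 0 R)))" by simp
  have "compact (cball 0 R - W)" using assms by (intro compact_diff) (auto simp: W_def)
  then have "closed (Pt ` (cball 0 R - W))" by (intro compact_imp_closed compact_Pt_image)
  moreover have "- Pt ` W = insert Infty (Pt ` (- ball 0 R)) \<union> Pt ` (cball 0 R - W)"
  proof (rule set_eqI)
    fix y show "y \<in> - Pt ` W \<longleftrightarrow> y \<in> insert Infty (Pt ` (- ball 0 R)) \<union> Pt ` (cball 0 R - W)"
      by (cases y) (auto simp: W_def image_iff)
  qed
  ultimately have "open (Pt ` W)" using cl by (metis closed_Un open_closed)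
  then show "\<exists>T. open T \<and> x \<in> T \<and> T \<subseteq> Pt ` V"
    using z by (intro exI[of _ "Pt ` W"]) (auto simp: W_def R_def)
qed

lemma continuous_on_Pt_inverse:
  "continuous_on (range Pt) (case_riemann_sphere (\<lambda>z. z) 0)"
  unfolding continuous_on_open_invariant
proof (intro allI impI)
  fix B :: "complex set" assume "open B"
  then show "\<exists>A. open A \<and> A \<inter> range Pt = case_riemann_sphere (\<lambda>z. z) 0 -` B \<inter> range Pt"
    by (intro exI[of _ "Pt ` B"]) (auto intro: open_Pt_image)
qed

text \<open>The Fatou set will be such a disjoint union of two open sets, \<open>V\<close> being the
  attracted points and \<open>E\<close> the escaping ones together with \<open>Infty\<close>; planar
  components of \<open>V\<close> are thereby Fatou components.\<close>

lemma Pt_image_component: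
  assumes "open V" "U \<in> components V" "open E" "Pt ` V \<inter> E = {}"
  shows "Pt ` U \<in> components (Pt ` V \<union> E)"
  unfolding in_components_maximal
proof (intro conjI allI impI)
  have U: "U \<noteq> {}" "U \<subseteq> V" "connected U"
    using assms(2) in_components_nonempty in_components_subset in_components_connected by blast+
  show "Pt ` U \<noteq> {}" "Pt ` U \<subseteq> Pt ` V \<union> E" "connected (Pt ` U)"
    using U by (auto intro: connected_continuous_image continuous_on_Pt)
  fix D assume D: "D \<noteq> {} \<and> Pt ` U \<subseteq> D \<and> D \<subseteq> Pt ` V \<union> E \<and> connected D"
  have "Pt ` V \<inter> D \<noteq> {}" using D U by blast
  then have "E \<inter> D = {}"
    using connectedD[of D "Pt ` V" E] D open_Pt_image[OF assms(1)] assms(3,4) by blast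
  then have DV: "D \<subseteq> Pt ` V" using D by blast
  define D' where "D' = case_riemann_sphere (\<lambda>z. z) 0 ` D"
  have "D = Pt ` D'" using DV by (force simp: D'_def image_iff subset_iff)
  moreover have "connected D'" unfolding D'_def
    using D DV by (intro connected_continuous_image continuous_on_subset[OF continuous_on_Pt_inverse]) auto
  moreover have "D' \<subseteq> V" "U \<subseteq> D'" using \<open>D = Pt ` D'\<close> DV D by auto
  ultimately show "D = Pt ` U"
    using assms(2) U unfolding in_components_maximal by (metis subset_empty)
qed

text \<open>A sequence from the family either repeats one map infinitely often or has a subsequence
  whose indices increase and stay in \<open>S\<close> or stay outside \<open>S\<close>. Two limits
  are needed since attracted orbits are near \<open>0\<close> except halfway through the double
  steps, where they are near \<open>Infty\<close>.\<close>

lemma normal_on_two_limits: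
  fixes q :: "nat \<Rightarrow> riemann_sphere \<Rightarrow> riemann_sphere"
  assumes "\<And>e. e > 0 \<Longrightarrow> \<exists>n0. \<forall>n\<ge>n0. \<forall>x\<in>U. dist (q n x) (if n \<in> S then a else b) < e"
  shows "normal_on U {q n | n. (m::nat) \<le> n}"
  unfolding normal_on_def
proof (intro allI impI)
  fix f :: "nat \<Rightarrow> riemann_sphere \<Rightarrow> riemann_sphere"
  assume "range f \<subseteq> {q n | n. m \<le> n}"
  then have "\<forall>i. \<exists>n::nat. f i = q n" by blast
  then obtain \<nu> where \<nu>: "\<And>i. f i = q (\<nu> i)" by metis
  show "\<exists>r g. strict_mono r \<and> (\<forall>C. compact C \<and> C \<subseteq> U \<longrightarrow> uniform_limit C (f \<circ> r) g sequentially)"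
  proof (cases "finite (range \<nu>)")
    case True
    then obtain k where k: "infinite {i. \<nu> i = \<nu> k}"
      using pigeonhole_infinite[of UNIV \<nu>] by auto
    then obtain r :: "nat \<Rightarrow> nat" where r: "strict_mono r" "\<And>n. r n \<in> {i. \<nu> i = \<nu> k}"
      using infinite_enumerate[OF k] by blast
    then have "f \<circ> r = (\<lambda>_. f k)" using \<nu> by (auto simp: fun_eq_iff)
    then show ?thesis using r(1) by (auto simp: uniform_limit_const intro!: exI[of _ r] exI[of _ "f k"])
  next
    case False
    have "\<exists>T\<in>{S, - S}. infinite (range \<nu> \<inter> T)"
      using False by (metis Compl_partition Int_Un_distrib finite_Un inf_top.right_neutral insertCI)
    then obtain T where T: "T = S \<or> T = - S" "infinite (range \<nu> \<inter> T)" by blast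
    have ex: "\<exists>i>j. \<nu> i > \<nu> j \<and> \<nu> i \<in> T" for j
    proof -
      have "infinite (range \<nu> \<inter> T - {..Max (\<nu> ` {..j})})" using T(2) by simp
      then obtain x where "x \<in> range \<nu> \<inter> T - {..Max (\<nu> ` {..j})}" by (metis ex_in_conv infinite_imp_nonempty)
      then obtain i where i: "\<nu> i \<in> T" "\<forall>i'\<le>j. \<nu> i' < \<nu> i" by (auto simp: not_le)
      then show ?thesis by (metis less_irrefl not_le order_refl)
    qed
    then obtain nx where nx: "\<And>j. nx j > j \<and> \<nu> (nx j) > \<nu> j \<and> \<nu> (nx j) \<in> T" by metis
    define r where "r = (\<lambda>n. (nx ^^ Suc n) 0)"
    have r1: "strict_mono r" unfolding strict_mono_Suc_iff r_def using nx by simp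
    have r2: "strict_mono (\<nu> \<circ> r)" unfolding strict_mono_Suc_iff r_def using nx by simp
    have r3: "\<nu> (r n) \<in> T" for n unfolding r_def using nx by simp
    define c where "c = (if T = S then a else b)"
    have c: "(if \<nu> (r n) \<in> S then a else b) = c" for n
      using r3[of n] T(1) unfolding c_def by auto
    have "uniform_limit U (f \<circ> r) (\<lambda>_. c) sequentially"
      unfolding uniform_limit_iff
    proof (intro allI impI)
      fix e :: real assume "e > 0"
      then obtain n0 where n0: "\<forall>n\<ge>n0. \<forall>x\<in>U. dist (q n x) (if n \<in> S then a else b) < e" using assms by blast
      show "\<forall>\<^sub>F n in sequentially. \<forall>x\<in>U. dist ((f \<circ> r) n x) c < e"
        unfolding eventually_sequentially
      proof (intro exI[of _ n0] allI impI ballI)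
        fix n x assume "n \<ge> n0" "x \<in> U"
        moreover have "\<nu> (r n) \<ge> n" using seq_suble[OF r2] by simp
        ultimately have "dist (q (\<nu> (r n)) x) (if \<nu> (r n) \<in> S then a else b) < e"
          using n0 by (meson order_trans)
        then show "dist ((f \<circ> r) n x) c < e" using c \<nu> by simp
      qed
    qed
    then show ?thesis using r1 uniform_limit_on_subset by blast
  qed
qed

text \<open>A limit function is continuous and equals \<open>Infty\<close> at escaping points, hence
  at \<open>z\<close> too; but the bounded orbit of \<open>z\<close> forces a finite value
  there.\<close>

lemma not_normal_on_escape_boundary:
  assumes "normal_on U \<F>" "open U" "Pt z \<in> U" "\<And>n. f n \<in> \<F>"
    and f: "\<And>n y. f n (Pt y) = Pt (q n y)" and cont: "\<And>n. continuous_on UNIV (q n)"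
    and bd: "\<And>n::nat. cmod (q n z) \<le> M"
    and esc: "z \<in> closure {y. filterlim (\<lambda>n. cmod (q n y)) at_top sequentially}"
  shows False
proof -
  have "open (Pt -` U)"
    using continuous_on_Pt[of UNIV] assms(2) by (simp add: continuous_on_open_vimage)
  then obtain \<epsilon> where \<epsilon>: "\<epsilon> > 0" "cball z \<epsilon> \<subseteq> Pt -` U"
    using assms(3) open_contains_cball by (metis vimageI)
  have "range f \<subseteq> \<F>" using assms(4) by blast
  then obtain r g where r: "strict_mono r"
    and g: "\<And>C. compact C \<Longrightarrow> C \<subseteq> U \<Longrightarrow> uniform_limit C (f \<circ> r) g sequentially"
    using assms(1) unfolding normal_on_def by metis
  have "uniform_limit (Pt ` cball z \<epsilon>) (f \<circ> r) g sequentially"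
    using \<epsilon> by (intro g compact_Pt_image) auto
  then have ul: "uniform_limit (cball z \<epsilon>) (\<lambda>n y. Pt (q (r n) y)) (g \<circ> Pt) sequentially"
    by (simp add: uniform_limit_iff f)
  have "continuous_on (cball z \<epsilon>) (g \<circ> Pt)"
    by (rule uniform_limit_theorem[OF _ ul])
       (auto intro!: always_eventually continuous_on_compose2[OF continuous_on_Pt[of UNIV]] continuous_on_subset[OF cont])
  then have clo: "closed (cball z \<epsilon> \<inter> (g \<circ> Pt) -` {Infty})"
    by (intro continuous_closed_preimage) auto
  have lim: "(\<lambda>n. Pt (q (r n) y)) \<longlonglongrightarrow> g (Pt y)" if "y \<in> cball z \<epsilon>" for y
    using tendsto_uniform_limitI[OF ul that] by simp
  have inf: "g (Pt y) = Infty" if "y \<in> cball z \<epsilon>" "filterlim (\<lambda>n. cmod (q n y)) at_top sequentially" for y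
  proof -
    have fl: "filterlim (\<lambda>n. cmod (q (r n) y)) at_top sequentially"
      using filterlim_compose[OF that(2) filterlim_subseq[OF r]] .
    have "(\<lambda>n. Pt (q (r n) y)) \<longlonglongrightarrow> Infty"
      unfolding tendsto_iff
    proof (intro allI impI)
      fix e :: real assume "e > 0"
      then obtain R where R: "\<And>z. cmod z \<ge> R \<Longrightarrow> dist (Pt z) Infty < e" using Pt_near_Infty by blast
      have "\<forall>\<^sub>F n in sequentially. cmod (q (r n) y) \<ge> R" using fl by (simp add: filterlim_at_top)
      then show "\<forall>\<^sub>F n in sequentially. dist (Pt (q (r n) y)) Infty < e"
        by eventually_elim (use R in auto)
    qed
    then show ?thesis using lim[OF that(1)] LIMSEQ_unique by blast
  qed
  have "z \<in> closure (ball z \<epsilon> \<inter> {y. filterlim (\<lambda>n. cmod (q n y)) at_top sequentially})"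
    using esc \<epsilon>(1) by (meson IntI centre_in_ball open_Int_closure_subset open_ball subsetD)
  also have "\<dots> \<subseteq> cball z \<epsilon> \<inter> (g \<circ> Pt) -` {Infty}"
    using inf by (intro closure_minimal clo) (auto simp: less_imp_le)
  finally have "g (Pt z) = Infty" by simp
  moreover have "closed (Pt ` cball 0 M)" by (intro compact_imp_closed compact_Pt_image) auto
  then have "g (Pt z) \<in> Pt ` cball 0 M"
    by (rule closed_sequentially[OF _ _ lim]) (use bd \<epsilon> in auto)
  ultimately show False by auto
qed

section \<open>The polynomial sequence\<close>

primrec orb :: "(nat \<Rightarrow> complex) \<Rightarrow> nat \<Rightarrow> nat \<Rightarrow> complex \<Rightarrow> complex" where
  "orb c m 0 z = z"
| "orb c m (Suc n) z = (if m \<le> n then (orb c m n z)\<^sup>2 + c (Suc n) else z)"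

lemma orb_le [simp]: "n \<le> m \<Longrightarrow> orb c m n z = z"
  by (cases n) auto

lemma orb_Suc: "m \<le> n \<Longrightarrow> orb c m (Suc n) z = (orb c m n z)\<^sup>2 + c (Suc n)"
  by simp

declare orb.simps(2) [simp del]

lemma orb_trans: "m \<le> k \<Longrightarrow> k \<le> n \<Longrightarrow> orb c k n (orb c m k z) = orb c m n z"
  by (rotate_tac, induction n rule: dec_induct) (auto simp: orb_Suc)

lemma Q_quadratic: "Q (\<lambda>m. [:c m, 0, 1:]) m n (Pt z) = Pt (orb c m n z)"
  by (induction n) (auto simp: orb.simps(2) power2_eq_square algebra_simps)

lemma Q_quadratic_Infty: "Q (\<lambda>m. [:c m, 0, 1:]) m n Infty = Infty"
  by (induction n) auto

lemma holomorphic_orb: "orb c m n holomorphic_on S"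
proof (induction n)
  case (Suc n)
  have "orb c m (Suc n) = (if m \<le> n then (\<lambda>z. (orb c m n z)\<^sup>2 + c (Suc n)) else (\<lambda>z. z))"
    by (auto simp: fun_eq_iff orb.simps(2))
  then show ?case using Suc by (auto intro!: holomorphic_intros)
qed (simp add: holomorphic_on_ident)

lemma continuous_on_orb: "continuous_on S (orb c m n)"
  using holomorphic_orb holomorphic_on_imp_continuous_on by blast

lemma surj_orb: "\<exists>z. orb c m n z = w"
proof (induction n arbitrary: w)
  case (Suc n)
  show ?case
  proof (cases "m \<le> n")
    case True
    obtain z where "orb c m n z = csqrt (w - c (Suc n))" using Suc by blast
    then show ?thesis using True by (intro exI[of _ z]) (simp add: orb_Suc)
  qed auto
qed auto

lemma open_orb_image:
  assumes "open U"
  shows "open (orb c m n ` U)"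
proof (induction n)
  case (Suc n)
  show ?case
  proof (cases "m \<le> n")
    case True
    let ?p = "\<lambda>z. z\<^sup>2 + c (Suc n)"
    have "?p 0 \<noteq> ?p 1" by simp
    then have "\<not> ?p constant_on UNIV" unfolding constant_on_def by (metis UNIV_I)
    then have "open (?p ` orb c m n ` U)"
      by (intro open_mapping_thm[of ?p UNIV] holomorphic_intros Suc) auto
    then show ?thesis using True by (simp add: image_image orb_Suc)
  qed (use assms in simp)
qed (use assms in simp)

lemma orb_bounded_preimage: "\<exists>B. \<forall>z. cmod (orb c m n z) \<le> R \<longrightarrow> cmod z \<le> B"
proof (induction n arbitrary: R)
  case (Suc n)
  show ?case
  proof (cases "m \<le> n")
    case True
    \<comment> \<open>The summand 1 makes the radius at least 1 and therefore at most its own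
      square.\<close>
    obtain B where B: "\<And>z. cmod (orb c m n z) \<le> \<bar>R\<bar> + cmod (c (Suc n)) + 1 \<Longrightarrow> cmod z \<le> B"
      using Suc by blast
    have "cmod z \<le> B" if "cmod (orb c m (Suc n) z) \<le> R" for z
    proof (rule B)
      let ?v = "orb c m n z" and ?r = "\<bar>R\<bar> + cmod (c (Suc n)) + 1"
      have "(cmod ?v)\<^sup>2 \<le> cmod (?v\<^sup>2 + c (Suc n)) + cmod (c (Suc n))"
        using norm_triangle_ineq4[of "?v\<^sup>2 + c (Suc n)" "c (Suc n)"] by (simp add: norm_power)
      also have "\<dots> \<le> ?r" using that True by (simp add: orb_Suc)
      also have "?r * 1 \<le> ?r * ?r" by (intro mult_left_mono) auto
      finally have "(cmod ?v)\<^sup>2 \<le> ?r\<^sup>2" by (simp add: power2_eq_square)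
      then show "cmod ?v \<le> ?r" by (rule power2_le_imp_le) auto
    qed
    then show ?thesis by blast
  qed auto
qed auto

lemma compact_orb_vimage:
  assumes "compact N"
  shows "compact (orb c m n -` N)"
proof -
  obtain R where "\<And>w. w \<in> N \<Longrightarrow> cmod w \<le> R"
    using compact_imp_bounded[OF assms] by (auto simp: bounded_iff)
  moreover obtain B where "\<And>z. cmod (orb c m n z) \<le> R \<Longrightarrow> cmod z \<le> B"
    using orb_bounded_preimage by blast
  ultimately have "bounded (orb c m n -` N)" by (auto simp: bounded_iff)
  moreover have "closed (orb c m n -` N)"
    using continuous_on_orb[of UNIV] assms compact_imp_closed
    by (intro continuous_closed_vimage) (auto simp: continuous_on_eq_continuous_at)
  ultimately show ?thesis by (simp add: compact_eq_bounded_closed)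
qed

lemma finite_orb_vimage: "finite (orb c m n -` {w})"
proof (induction n arbitrary: w)
  case (Suc n)
  show ?case
  proof (cases "m \<le> n")
    case True
    let ?s = "csqrt (w - c (Suc n))"
    have "orb c m (Suc n) -` {w} \<subseteq> orb c m n -` {?s} \<union> orb c m n -` {- ?s}"
    proof
      fix z assume "z \<in> orb c m (Suc n) -` {w}"
      then have "(orb c m n z)\<^sup>2 = ?s\<^sup>2" using True by (simp add: orb_Suc eq_diff_eq)
      then have "orb c m n z = ?s \<or> orb c m n z = - ?s" by (simp only: power2_eq_iff)
      then show "z \<in> orb c m n -` {?s} \<union> orb c m n -` {- ?s}" by auto
    qed
    then show ?thesis using Suc finite_subset by blast
  next
    case False
    then have "orb c m (Suc n) -` {w} = {w}" by auto
    then show ?thesis by simp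
  qed
next
  case 0
  have "orb c m 0 -` {w} = {w}" by auto
  then show ?case by simp
qed

lemma orb_lift:
  assumes "m \<le> n" "contractible \<Omega>" "h holomorphic_on \<Omega>" "u0 \<in> \<Omega>" "orb c m n z = h u0"
    and "\<And>i. m < i \<Longrightarrow> i \<le> n \<Longrightarrow> orb c i n (c i) \<notin> h ` \<Omega>"
  shows "\<exists>G. G holomorphic_on \<Omega> \<and> G u0 = z \<and> (\<forall>u\<in>\<Omega>. orb c m n (G u) = h u)"
  using assms(1,5,6)
proof (induction m arbitrary: z rule: inc_induct)
  case base
  then show ?case using assms(3) by (intro exI[of _ h]) auto
next
  case (step m)
  let ?z' = "z\<^sup>2 + c (Suc m)"
  have orb1: "orb c m n y = orb c (Suc m) n (y\<^sup>2 + c (Suc m))" for y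
    using orb_trans[of m "Suc m" n c y] step.hyps by (simp add: orb_Suc)
  obtain G' where G': "G' holomorphic_on \<Omega>" "G' u0 = ?z'" "\<forall>u\<in>\<Omega>. orb c (Suc m) n (G' u) = h u"
    using step.IH[of ?z'] step.prems orb1 by auto
  have "G' u - c (Suc m) \<noteq> 0" if "u \<in> \<Omega>" for u
    using step.prems(2)[of "Suc m"] G'(3) that step.hyps by (auto simp: image_iff)
  then obtain g where g: "g holomorphic_on \<Omega>" "\<And>u. u \<in> \<Omega> \<Longrightarrow> G' u - c (Suc m) = (g u)\<^sup>2"
    using contractible_imp_holomorphic_sqrt[of "\<lambda>u. G' u - c (Suc m)" \<Omega>]
      holomorphic_on_diff[OF G'(1) holomorphic_on_const] assms(2) by blast
  have "(g u0)\<^sup>2 = z\<^sup>2" using g(2)[OF assms(4)] G'(2) by simp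
  then have "g u0 = z \<or> g u0 = - z" by (simp add: power2_eq_iff)
  \<comment> \<open>The root is determined up to sign; \<open>\<sigma>\<close> selects the branch
    that starts at \<open>z\<close>.\<close>
  then obtain \<sigma> :: complex where \<sigma>: "\<sigma> * g u0 = z" "\<sigma>\<^sup>2 = 1"
    using that[of 1] that[of "-1"] by auto
  show ?case
  proof (intro exI conjI ballI)
    show "(\<lambda>u. \<sigma> * g u) holomorphic_on \<Omega>" by (intro holomorphic_intros g)
    fix u assume "u \<in> \<Omega>"
    then have "(\<sigma> * g u)\<^sup>2 + c (Suc m) = G' u" using g(2) \<sigma>(2) by (simp add: power_mult_distrib flip: g(2))
    then show "orb c m n (\<sigma> * g u) = h u"
      using G'(3) \<open>u \<in> \<Omega>\<close> by (simp add: orb1)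
  qed (rule \<sigma>(1))
qed

section \<open>The special times and the parameters\<close>

text \<open>The exponent \<open>Suc k\<close> makes every epoch divisible by 4, so the neighbours of
  an epoch are not epochs and double steps do not overlap.\<close>

definition epoch :: "nat \<Rightarrow> nat" where "epoch k = 4 ^ Suc k"

definition param :: "nat \<Rightarrow> complex" where
  "param n = (if n \<in> range epoch then - 4 * of_nat n ^ 4
           else if Suc n \<in> range epoch then - 2 * (of_nat (Suc n))\<^sup>2 else 0)"

definition center :: "nat \<Rightarrow> complex" where
  "center n = (if Suc n \<in> range epoch then - 2 * (of_nat (Suc n))\<^sup>2 else 0)"

text \<open>The last time before the double step that ends at \<open>epoch (Suc k)\<close>; main and
  tiny pieces are told apart at this time.\<close>

definition exit_time :: "nat \<Rightarrow> nat" where "exit_time k = epoch (Suc k) - 2"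

text \<open>The \<open>t\<close> of the double step as a real number: the tiny pieces sit around
  \<open>2t\<close> and \<open>-2t\<close>, and modulus \<open>t\<close> serves as the border of the
  main piece.\<close>

definition offset :: "nat \<Rightarrow> real" where "offset k = real (epoch (Suc k))"

lemma epoch_Suc: "epoch (Suc k) = 4 * epoch k"
  by (simp add: epoch_def)

lemma epoch_ge: "epoch k \<ge> 4" "epoch k > k"
  unfolding epoch_def by (induction k) auto

lemma epoch_mono: "j \<le> k \<Longrightarrow> epoch j \<le> epoch k"
  by (simp add: epoch_def power_increasing)

lemma epoch_less_iff: "epoch j < epoch k \<longleftrightarrow> j < k"
  by (simp add: epoch_def)

lemma offset_ge: "offset k \<ge> 16"
  using epoch_ge(1)[of k] by (simp add: epoch_Suc offset_def)

lemma epoch_exit_time: "epoch k \<le> exit_time k" "Suc (Suc (exit_time k)) = epoch (Suc k)" "exit_time k \<le> epoch (Suc k)"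
  using epoch_ge(1)[of k] by (auto simp: exit_time_def epoch_Suc)

lemma Suc_epoch_notin_range: "Suc (epoch k) \<notin> range epoch" "Suc n = epoch k \<Longrightarrow> n \<notin> range epoch"
proof -
  have dvd: "4 dvd epoch j" for j by (simp add: epoch_def)
  have "\<not> 4 dvd Suc (epoch k)" using dvd[of k] by presburger
  then show "Suc (epoch k) \<notin> range epoch" using dvd by (metis rangeE)
  assume "Suc n = epoch k"
  then have "\<not> 4 dvd n" using dvd[of k] by presburger
  then show "n \<notin> range epoch" using dvd by (metis rangeE)
qed

lemma between_epoch_notin_range: "epoch k < n \<Longrightarrow> n < epoch (Suc k) \<Longrightarrow> n \<notin> range epoch"
  by (auto simp: epoch_less_iff)

lemma center_Suc: "(center n)\<^sup>2 + param (Suc n) = center (Suc n)"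
proof (cases "Suc n \<in> range epoch")
  case True
  then obtain k where "Suc n = epoch k" by blast
  then have "Suc (Suc n) \<notin> range epoch" using Suc_epoch_notin_range(1)[of k] by simp
  then show ?thesis using True by (simp add: center_def param_def power_mult_distrib flip: power_mult)
qed (auto simp: center_def param_def)

lemma orb_center: "m \<le> n \<Longrightarrow> orb param m n (center m) = center n"
  by (induction n rule: dec_induct) (auto simp: orb_Suc center_Suc)

lemma center_epoch: "center (epoch k) = 0" "center (exit_time k) = 0"
  using Suc_epoch_notin_range(1)[of k] Suc_epoch_notin_range(2)[of "Suc (exit_time k)" "Suc k"] epoch_exit_time(2)[of k]
  by (auto simp: center_def)

text \<open>Outside the epochs a critical value lies on the orbit of \<open>0\<close>; only the
  second half of a double step produces an escaping one.\<close>

lemma param_center: "i \<notin> range epoch \<Longrightarrow> param i = center i"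
  by (simp add: param_def center_def)

lemma orb_power: "epoch k \<le> n \<Longrightarrow> n \<le> exit_time k \<Longrightarrow> orb param (epoch k) n z = z ^ (2 ^ (n - epoch k))"
proof (induction n rule: dec_induct)
  case (step n)
  have "Suc n \<notin> range epoch" "Suc (Suc n) \<notin> range epoch"
    using between_epoch_notin_range[of k "Suc n"] between_epoch_notin_range[of k "Suc (Suc n)"] step epoch_exit_time[of k] by auto
  then have "param (Suc n) = 0" by (simp add: param_def)
  then show ?case using step by (simp add: orb_Suc Suc_diff_le flip: power_mult) (simp add: mult.commute)
qed auto

lemma orb_special:
  assumes "m \<le> exit_time k"
  shows "orb param m (Suc (exit_time k)) z = (orb param m (exit_time k) z)\<^sup>2 - of_real (2 * (offset k)\<^sup>2)"
    "orb param m (epoch (Suc k)) z = (orb param m (exit_time k) z)\<^sup>2 * ((orb param m (exit_time k) z)\<^sup>2 - of_real (4 * (offset k)\<^sup>2))"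
proof -
  have "Suc (exit_time k) \<notin> range epoch" using Suc_epoch_notin_range(2) epoch_exit_time(2) by blast
  moreover have "Suc (Suc (exit_time k)) \<in> range epoch" using epoch_exit_time(2) by auto
  ultimately have c: "param (Suc (exit_time k)) = - of_real (2 * (offset k)\<^sup>2)" "param (Suc (Suc (exit_time k))) = - of_real (4 * (offset k) ^ 4)"
    using epoch_exit_time(2)[of k] by (auto simp: param_def offset_def)
  show 1: "orb param m (Suc (exit_time k)) z = (orb param m (exit_time k) z)\<^sup>2 - of_real (2 * (offset k)\<^sup>2)"
    using assms c by (simp add: orb_Suc)
  have "orb param m (Suc (Suc (exit_time k))) z = (orb param m (Suc (exit_time k)) z)\<^sup>2 - of_real (4 * (offset k) ^ 4)"
    using assms c by (simp add: orb_Suc)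
  then show "orb param m (epoch (Suc k)) z = (orb param m (exit_time k) z)\<^sup>2 * ((orb param m (exit_time k) z)\<^sup>2 - of_real (4 * (offset k)\<^sup>2))"
    unfolding 1 epoch_exit_time(2) by (simp add: power2_eq_square power4_eq_xxxx algebra_simps)
qed

text \<open>With \<open>x = epoch k\<close> there are \<open>3x - 2\<close> squarings before the
  double step, and the left side is \<open>8 * (4x)^4\<close>, at most \<open>2^(11 + 4x)\<close>.
  This bound is the source of the escape radius 2 and of the trapping radius 1/2.\<close>

lemma offset_growth: "8 * offset k ^ 4 \<le> 2 ^ (2 ^ (exit_time k - epoch k))"
proof -
  define x where "x = epoch k"
  have x: "x \<ge> 4" using epoch_ge by (simp add: x_def)
  have e: "11 + 4 * x \<le> 2 ^ (3 * x - 2)" using x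
  proof (induction x rule: dec_induct)
    case (step n)
    have "(2::nat) ^ (3 * Suc n - 2) = 8 * 2 ^ (3 * n - 2)"
    proof -
      have "3 * Suc n - 2 = 3 + (3 * n - 2)" using step by simp
      then have "(2::nat) ^ (3 * Suc n - 2) = 2 ^ (3 + (3 * n - 2))" by (rule arg_cong)
      also have "\<dots> = 8 * 2 ^ (3 * n - 2)" unfolding power_add by simp
      finally show ?thesis .
    qed
    then show ?case using step by simp
  qed simp
  have "8 * offset k ^ 4 = 2 ^ 11 * real x ^ 4" by (simp add: epoch_Suc offset_def x_def power_mult_distrib)
  also have "real x ^ 4 \<le> (2 ^ x) ^ 4" by (intro power_mono) (auto intro: less_imp_le of_nat_less_two_power)
  then have "2 ^ 11 * real x ^ 4 \<le> 2 ^ 11 * (2 ^ x) ^ 4" by (intro mult_left_mono) auto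
  also have "\<dots> = 2 ^ (11 + 4 * x)" by (simp add: power_add power_mult mult.commute)
  also have "\<dots> \<le> 2 ^ (2 ^ (3 * x - 2))" using e by (intro power_increasing) auto
  also have "3 * x - 2 = exit_time k - epoch k" by (simp add: exit_time_def epoch_Suc x_def)
  finally show ?thesis .
qed

lemma offset_powers: "offset k \<le> (offset k)\<^sup>2" "16 * (offset k)\<^sup>2 \<le> offset k ^ 3" "16 * offset k ^ 3 \<le> offset k ^ 4"
proof -
  have "1 * offset k \<le> offset k * offset k" "16 * (offset k)\<^sup>2 \<le> offset k * (offset k)\<^sup>2" "16 * offset k ^ 3 \<le> offset k * offset k ^ 3"
    using offset_ge[of k] by (intro mult_right_mono; simp)+
  then show "offset k \<le> (offset k)\<^sup>2" "16 * (offset k)\<^sup>2 \<le> offset k ^ 3"  "16 * offset k ^ 3 \<le> offset k ^ 4"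
    by (simp_all add: power2_eq_square power3_eq_cube power4_eq_xxxx)
qed

section \<open>Escape, attraction and the gap between the pieces over one block\<close>

text \<open>The squarings bring the modulus to at least \<open>8t^4\<close>, where the quadratic
  terms outweigh the subtracted constants \<open>2t^2\<close> and \<open>4t^4\<close>.\<close>

lemma escape_step:
  assumes z: "cmod z > 2"
  shows "cmod (orb param (epoch k) (exit_time k) z) \<ge> 8 * offset k ^ 4"
    "cmod (orb param (epoch k) (epoch (Suc k)) z) \<ge> 8 * offset k ^ 4"
    "cmod (orb param (epoch k) (epoch (Suc k)) z) \<ge> 2 * cmod z"
    "epoch k \<le> n \<Longrightarrow> n \<le> epoch (Suc k) \<Longrightarrow> cmod (orb param (epoch k) n z) \<ge> cmod z"
proof -
  define w where "w = orb param (epoch k) (exit_time k) z"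
  define v where "v = orb param (epoch k) (Suc (exit_time k)) z"
  define y where "y = orb param (epoch k) (epoch (Suc k)) z"
  have early: "cmod (orb param (epoch k) n z) \<ge> cmod z" if "epoch k \<le> n" "n \<le> exit_time k" for n
    using that z by (simp add: orb_power norm_power self_le_power)
  have w_z: "cmod w \<ge> cmod z" unfolding w_def using early epoch_exit_time by simp
  have "cmod w = cmod z ^ (2 ^ (exit_time k - epoch k))" by (simp add: w_def orb_power epoch_exit_time norm_power)
  also have "\<dots> \<ge> 2 ^ (2 ^ (exit_time k - epoch k))" using z by (intro power_mono) auto
  finally have w: "cmod w \<ge> 8 * offset k ^ 4" using offset_growth[of k] by linarith
  have t2: "16 * (offset k)\<^sup>2 \<le> cmod w" "4 * offset k ^ 4 \<le> cmod w" "cmod w \<ge> 3"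
    using offset_powers[of k] w offset_ge[of k] by linarith+
  have "v = w\<^sup>2 - of_real (2 * (offset k)\<^sup>2)" using orb_special(1)[OF epoch_exit_time(1)] by (simp add: v_def w_def)
  then have "cmod v \<ge> (cmod w)\<^sup>2 - 2 * (offset k)\<^sup>2"
    using norm_triangle_ineq2[of "w\<^sup>2" "of_real (2 * (offset k)\<^sup>2)"] by (simp add: norm_power norm_mult)
  moreover have "3 * cmod w \<le> (cmod w)\<^sup>2" using t2 by (auto simp: power2_eq_square intro: mult_right_mono)
  ultimately have v: "cmod v \<ge> 2 * cmod w" using t2 w by linarith
  have "y = v\<^sup>2 - of_real (4 * offset k ^ 4)"
    unfolding y_def v_def orb_special[OF epoch_exit_time(1)] by (simp add: power2_eq_square power4_eq_xxxx algebra_simps)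
  then have "cmod y \<ge> (cmod v)\<^sup>2 - 4 * offset k ^ 4"
    using norm_triangle_ineq2[of "v\<^sup>2" "of_real (4 * offset k ^ 4)"] by (simp add: norm_power norm_mult)
  moreover have "3 * cmod v \<le> (cmod v)\<^sup>2" using t2 v by (auto simp: power2_eq_square intro: mult_right_mono)
  ultimately have y: "cmod y \<ge> cmod v" using t2 v by linarith
  show "cmod (orb param (epoch k) (exit_time k) z) \<ge> 8 * offset k ^ 4"
    "cmod (orb param (epoch k) (epoch (Suc k)) z) \<ge> 8 * offset k ^ 4"
    "cmod (orb param (epoch k) (epoch (Suc k)) z) \<ge> 2 * cmod z"
    using w v y w_z z by (auto simp: w_def[symmetric] y_def[symmetric])
  assume n: "epoch k \<le> n" "n \<le> epoch (Suc k)"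
  consider "n \<le> exit_time k" | "n = Suc (exit_time k)" | "n = epoch (Suc k)" using n(2) epoch_exit_time(2)[of k] by linarith
  then show "cmod (orb param (epoch k) n z) \<ge> cmod z"
  proof cases
    case 1 then show ?thesis using early n by simp
  next
    case 2 then show ?thesis using v w_z z by (simp add: v_def[symmetric])
  next
    case 3 then show ?thesis using y v w_z z by (simp add: y_def[symmetric])
  qed
qed

text \<open>The squarings bring the modulus down to at most \<open>1/(8t^4)\<close>, and one such
  factor pays for the factor \<open>w^2 - 4t^2\<close> of the double step. The third bound is the
  origin of the limit \<open>Infty\<close> halfway through the double steps.\<close>

lemma decay_step:
  assumes z: "cmod z < 1/2"
  shows "cmod (orb param (epoch k) (epoch (Suc k)) z) \<le> 1 / offset k"
    "epoch k \<le> n \<Longrightarrow> n \<le> exit_time k \<Longrightarrow> cmod (orb param (epoch k) n z) \<le> cmod z"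
    "cmod (orb param (epoch k) (Suc (exit_time k)) z) \<ge> offset k"
proof -
  define w where "w = orb param (epoch k) (exit_time k) z"
  show "cmod (orb param (epoch k) n z) \<le> cmod z" if "epoch k \<le> n" "n \<le> exit_time k" for n
    using that z power_decreasing[of 1 "2 ^ (n - epoch k)" "cmod z"] by (simp add: orb_power norm_power)
  have "cmod w = cmod z ^ (2 ^ (exit_time k - epoch k))" by (simp add: w_def orb_power epoch_exit_time norm_power)
  also have "\<dots> \<le> (1/2) ^ (2 ^ (exit_time k - epoch k))" using z by (intro power_mono) auto
  also have "\<dots> = 1 / 2 ^ (2 ^ (exit_time k - epoch k))" by (simp add: power_one_over)
  also have "\<dots> \<le> 1 / (8 * offset k ^ 4)" using offset_growth[of k] offset_ge[of k] by (intro divide_left_mono) auto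
  finally have w: "cmod w \<le> 1 / (8 * offset k ^ 4)" .
  have p: "offset k > 0" "offset k \<ge> 16" using offset_ge[of k] by auto
  have "1 / (8 * offset k ^ 4) \<le> 1 / offset k"
  proof (intro divide_left_mono)
    show "offset k \<le> 8 * offset k ^ 4" using p offset_powers[of k] by linarith
  qed (use p in auto)
  moreover have "1 / offset k \<le> 1 / 16" using p by (intro divide_left_mono) auto
  ultimately have w1: "cmod w \<le> 1 / offset k" "cmod w \<le> 1" using w by linarith+
  have w2: "cmod w ^ 2 \<le> 1" using w1 by (simp add: power_le_one)
  have "cmod (w\<^sup>2 - of_real (2 * (offset k)\<^sup>2)) \<ge> 2 * (offset k)\<^sup>2 - (cmod w)\<^sup>2"
    using norm_triangle_ineq3[of "of_real (2 * (offset k)\<^sup>2)" "w\<^sup>2"] by (simp add: norm_power norm_mult norm_minus_commute)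
  then show "cmod (orb param (epoch k) (Suc (exit_time k)) z) \<ge> offset k"
    using orb_special(1)[OF epoch_exit_time(1), of k z] w2 offset_powers(1)[of k] p by (simp add: w_def[symmetric])
  have ww: "cmod (w\<^sup>2) \<le> cmod w * (1 / (8 * offset k ^ 4))"
    unfolding power2_eq_square norm_mult using w by (intro mult_left_mono) auto
  have "cmod (w\<^sup>2 - of_real (4 * (offset k)\<^sup>2)) \<le> 1 + 4 * (offset k)\<^sup>2"
    using norm_triangle_ineq4[of "w\<^sup>2" "of_real (4 * (offset k)\<^sup>2)"] w2 by (simp add: norm_power norm_mult)
  also have "\<dots> \<le> 8 * offset k ^ 4" using offset_powers[of k] p by linarith
  finally have "cmod (w\<^sup>2) * cmod (w\<^sup>2 - of_real (4 * (offset k)\<^sup>2)) \<le> (cmod w * (1 / (8 * offset k ^ 4))) * (8 * offset k ^ 4)"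
    by (intro mult_mono ww) auto
  also have "\<dots> = cmod w" using p by simp
  finally show "cmod (orb param (epoch k) (epoch (Suc k)) z) \<le> 1 / offset k"
    using orb_special(2)[OF epoch_exit_time(1), of k z] w1 by (simp add: w_def[symmetric] norm_mult)
qed

text \<open>For modulus at most \<open>t\<close>, the factor \<open>w^2 - 4t^2\<close> is at least 2
  in modulus, which leaves \<open>cmod w \<le> 1\<close>. Otherwise \<open>w - 2t\<close> and
  \<open>w + 2t\<close> have a product of modulus at most \<open>2/t^2\<close>, and one of them has
  modulus at least \<open>2t\<close>. The empty range between 1 and \<open>t\<close> separates the
  pieces; the radius \<open>1/t^3\<close> gives the thick annuli.\<close>

lemma small_value_pieces:
  assumes "cmod (w\<^sup>2 * (w\<^sup>2 - of_real (4 * (offset k)\<^sup>2))) \<le> 2"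
  shows "cmod w \<le> offset k \<Longrightarrow> cmod w \<le> 1"
    "cmod w > offset k \<Longrightarrow> cmod (w - of_real (2 * offset k)) \<le> 1 / offset k ^ 3 \<or> cmod (w + of_real (2 * offset k)) \<le> 1 / offset k ^ 3"
proof -
  have p: "offset k > 0" "offset k \<ge> 16" using offset_ge[of k] by auto
  have F: "(cmod w)\<^sup>2 * cmod (w\<^sup>2 - of_real (4 * (offset k)\<^sup>2)) \<le> 2" using assms by (simp add: norm_mult norm_power)
  { assume "cmod w \<le> offset k"
    then have "(cmod w)\<^sup>2 \<le> (offset k)\<^sup>2" by (intro power_mono) auto
    moreover have "cmod (w\<^sup>2 - of_real (4 * (offset k)\<^sup>2)) \<ge> 4 * (offset k)\<^sup>2 - (cmod w)\<^sup>2"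
      using norm_triangle_ineq3[of "of_real (4 * (offset k)\<^sup>2)" "w\<^sup>2"] by (simp add: norm_power norm_mult norm_minus_commute)
    ultimately have "cmod (w\<^sup>2 - of_real (4 * (offset k)\<^sup>2)) \<ge> 2" using offset_powers(1)[of k] p by linarith
    then have "(cmod w)\<^sup>2 * 2 \<le> (cmod w)\<^sup>2 * cmod (w\<^sup>2 - of_real (4 * (offset k)\<^sup>2))" by (intro mult_left_mono) auto
    then have "(cmod w)\<^sup>2 \<le> 1" using F by linarith
    then show "cmod w \<le> 1" by (simp add: power2_le_iff_abs_le power_le_one_iff) }
  assume big: "cmod w > offset k"
  have eq: "w\<^sup>2 - of_real (4 * (offset k)\<^sup>2) = (w - of_real (2 * offset k)) * (w + of_real (2 * offset k))"
    by (simp add: power2_eq_square algebra_simps)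
  have sq: "(offset k)\<^sup>2 \<le> (cmod w)\<^sup>2" using big p by (intro power_mono) auto
  have "(offset k)\<^sup>2 * (cmod (w - of_real (2 * offset k)) * cmod (w + of_real (2 * offset k))) \<le> 2"
    using F mult_right_mono[OF sq, of "cmod (w - of_real (2 * offset k)) * cmod (w + of_real (2 * offset k))"]
    unfolding eq norm_mult by auto
  then have prod: "cmod (w - of_real (2 * offset k)) * cmod (w + of_real (2 * offset k)) \<le> 2 / (offset k)\<^sup>2"
    using p by (simp add: field_simps)
  have conc: "a \<le> 1 / offset k ^ 3" if "a * b \<le> 2 / (offset k)\<^sup>2" "b \<ge> 2 * offset k" "a \<ge> 0" for a b :: real
  proof -
    have "a * (2 * offset k) \<le> a * b" using that by (intro mult_left_mono) auto
    then have "a * (2 * offset k) \<le> 2 / (offset k)\<^sup>2" using that by linarith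
    then show ?thesis using p by (simp add: field_simps power2_eq_square power3_eq_cube)
  qed
  show "cmod (w - of_real (2 * offset k)) \<le> 1 / offset k ^ 3 \<or> cmod (w + of_real (2 * offset k)) \<le> 1 / offset k ^ 3"
  proof (cases "Re w \<ge> 0")
    case True
    then have "cmod (w + of_real (2 * offset k)) \<ge> 2 * offset k" using complex_Re_le_cmod[of "w + of_real (2 * offset k)"] by simp
    then show ?thesis using conc prod by auto
  next
    case False
    then have "cmod (w - of_real (2 * offset k)) \<ge> 2 * offset k"
      using abs_Re_le_cmod[of "w - of_real (2 * offset k)"] p by simp
    then show ?thesis using conc[of "cmod (w + of_real (2 * offset k))"] prod by (simp add: mult.commute)
  qed
qed

lemma escape_persists:
  assumes "m \<le> epoch k" "cmod (orb param m (epoch k) z) > 2" "k \<le> j"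
  shows "cmod (orb param m (epoch j) z) \<ge> 2 ^ (j - k) * 2" "cmod (orb param m (epoch j) z) > 2"
    "epoch j \<le> n \<Longrightarrow> n \<le> epoch (Suc j) \<Longrightarrow> cmod (orb param m n z) \<ge> 2 ^ (j - k)"
    "cmod (orb param m (epoch (Suc j)) z) \<ge> 8 * offset j ^ 4"
proof -
  have mj: "m \<le> epoch j" if "k \<le> j" for j using assms(1) epoch_mono[OF that] by simp
  have *: "cmod (orb param m (epoch j) z) \<ge> 2 ^ (j - k) * 2 \<and> cmod (orb param m (epoch j) z) > 2"
    using assms(3)
  proof (induction j rule: dec_induct)
    case (step j)
    have "orb param m (epoch (Suc j)) z = orb param (epoch j) (epoch (Suc j)) (orb param m (epoch j) z)"
      using mj[of j] step epoch_exit_time[of j] by (simp add: orb_trans)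
    then show ?case
      using escape_step(3)[of "orb param m (epoch j) z" j] step by (simp add: Suc_diff_le)
  qed (use assms in simp)
  then show "cmod (orb param m (epoch j) z) \<ge> 2 ^ (j - k) * 2" "cmod (orb param m (epoch j) z) > 2" by auto
  have tr: "orb param m n z = orb param (epoch j) n (orb param m (epoch j) z)" if "epoch j \<le> n" for n
    using mj[OF assms(3)] that by (simp add: orb_trans)
  show "cmod (orb param m n z) \<ge> 2 ^ (j - k)" if "epoch j \<le> n" "n \<le> epoch (Suc j)"
  proof -
    have "(2::real) ^ (j - k) \<le> 2 ^ (j - k) * 2" by simp
    also have "\<dots> \<le> cmod (orb param m (epoch j) z)" using * by simp
    also have "\<dots> \<le> cmod (orb param m n z)"
      unfolding tr[OF that(1)] using * that by (intro escape_step(4)) auto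
    finally show ?thesis .
  qed
  show "cmod (orb param m (epoch (Suc j)) z) \<ge> 8 * offset j ^ 4"
    using escape_step(2)[of "orb param m (epoch j) z" j] * tr[of "epoch (Suc j)"] epoch_exit_time[of j] by simp
qed

lemma decay_persists:
  assumes "m \<le> epoch k" "cmod (orb param m (epoch k) z) < 1/2" "k \<le> j"
  shows "cmod (orb param m (epoch j) z) < 1/2" "k < j \<Longrightarrow> cmod (orb param m (epoch j) z) \<le> 1 / epoch j"
proof -
  have mj: "m \<le> epoch j" if "k \<le> j" for j using assms(1) epoch_mono[OF that] by simp
  have st: "cmod (orb param m (epoch (Suc j)) z) \<le> 1 / epoch (Suc j)"
    if "k \<le> j" "cmod (orb param m (epoch j) z) < 1/2" for j
  proof -
    have "orb param m (epoch (Suc j)) z = orb param (epoch j) (epoch (Suc j)) (orb param m (epoch j) z)"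
      using mj[of j] that epoch_exit_time[of j] by (simp add: orb_trans)
    then show ?thesis using decay_step(1)[of "orb param m (epoch j) z" j] that by (simp add: offset_def)
  qed
  have half: "cmod (orb param m (epoch j) z) < 1/2" if "k \<le> j" for j
    using that
  proof (induction j rule: dec_induct)
    case (step j)
    have "1 / real (epoch (Suc j)) \<le> 1 / 16" using offset_ge[of j] unfolding offset_def by (intro divide_left_mono) auto
    then show ?case using st[of j] step by simp
  qed (use assms in simp)
  then show "cmod (orb param m (epoch j) z) < 1/2" using assms(3) .
  show "cmod (orb param m (epoch j) z) \<le> 1 / epoch j" if "k < j"
    using that half st by (cases j) auto
qed

section \<open>The non-escaping, attracted and Julia points and their invariance\<close>

text \<open>Orbits are sampled at epochs only, because even attracted orbits are unbounded along the
  times halfway through the double steps.\<close>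

definition Filled :: "nat \<Rightarrow> complex set" where
  "Filled m = {z. \<forall>k. m \<le> epoch k \<longrightarrow> cmod (orb param m (epoch k) z) \<le> 2}"

definition Attracted :: "nat \<Rightarrow> complex set" where
  "Attracted m = {z. \<exists>k. m \<le> epoch k \<and> cmod (orb param m (epoch k) z) < 1/2}"

definition julia_plane :: "nat \<Rightarrow> complex set" where
  "julia_plane m = Filled m - Attracted m"

text \<open>The threshold lies in the gap of \<open>small_value_pieces\<close>, which makes this a
  locally constant condition on points that stay bounded.\<close>

definition main :: "nat \<Rightarrow> nat \<Rightarrow> complex \<Rightarrow> bool" where
  "main m k z \<longleftrightarrow> cmod (orb param m (exit_time k) z) \<le> offset k"

definition H_part :: "nat \<Rightarrow> complex set" where
  "H_part m = {z \<in> julia_plane m. \<exists>k0. \<forall>k\<ge>k0. main m k z}"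

definition G_part :: "nat \<Rightarrow> complex set" where
  "G_part m = {z \<in> julia_plane m. \<forall>k0. \<exists>k\<ge>k0. \<not> main m k z}"

lemma epoch_ge_self: "m \<le> epoch m"
  using epoch_ge(2)[of m] by simp

lemma julia_plane_iff: "z \<in> julia_plane m \<longleftrightarrow> (\<forall>k. m \<le> epoch k \<longrightarrow> 1/2 \<le> cmod (orb param m (epoch k) z) \<and> cmod (orb param m (epoch k) z) \<le> 2)"
  by (auto simp: julia_plane_def Filled_def Attracted_def not_less)

lemma G_part_Un_H_part: "julia_plane m = G_part m \<union> H_part m" "G_part m \<inter> H_part m = {}"
  by (auto simp: G_part_def H_part_def)

lemma G_part_eq: "G_part m = julia_plane m - H_part m"
  by (auto simp: G_part_def H_part_def)

text \<open>For the direction from \<open>n\<close> back to \<open>m\<close>: an escape seen at an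
  epoch before \<open>n\<close> persists to an epoch after \<open>n\<close>.\<close>

lemma Filled_invariant:
  assumes "m \<le> n"
  shows "orb param m n z \<in> Filled n \<longleftrightarrow> z \<in> Filled m"
proof
  assume L: "orb param m n z \<in> Filled n"
  show "z \<in> Filled m"
    unfolding Filled_def
  proof (clarify, rule ccontr)
    fix k assume k: "m \<le> epoch k" "\<not> cmod (orb param m (epoch k) z) \<le> 2"
    define j where "j = max k n"
    have "n \<le> epoch j" using epoch_ge_self[of n] epoch_mono[of n j] by (simp add: j_def)
    then have "cmod (orb param m (epoch j) z) \<le> 2" using L assms by (auto simp: Filled_def orb_trans)
    moreover have "cmod (orb param m (epoch j) z) > 2"
      by (rule escape_persists(2)[of m k]) (use k in \<open>auto simp: j_def\<close>)
    ultimately show False by simp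
  qed
qed (use assms in \<open>auto simp: Filled_def orb_trans\<close>)

lemma Attracted_invariant:
  assumes "m \<le> n"
  shows "orb param m n z \<in> Attracted n \<longleftrightarrow> z \<in> Attracted m"
proof
  assume "z \<in> Attracted m"
  then obtain k where k: "m \<le> epoch k" "cmod (orb param m (epoch k) z) < 1/2" by (auto simp: Attracted_def)
  define j where "j = max k n"
  have "n \<le> epoch j" using epoch_ge_self[of n] epoch_mono[of n j] by (simp add: j_def)
  then show "orb param m n z \<in> Attracted n"
    using decay_persists(1)[OF k, of j] assms by (auto simp: Attracted_def orb_trans j_def intro!: exI[of _ j])
next
  assume "orb param m n z \<in> Attracted n"
  then obtain k where "n \<le> epoch k" "cmod (orb param m (epoch k) z) < 1/2" using assms by (auto simp: Attracted_def orb_trans)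
  then show "z \<in> Attracted m" using assms le_trans unfolding Attracted_def by blast
qed

lemma julia_plane_invariant: "m \<le> n \<Longrightarrow> orb param m n z \<in> julia_plane n \<longleftrightarrow> z \<in> julia_plane m"
  by (simp add: julia_plane_def Filled_invariant Attracted_invariant)

lemma main_orb: "m \<le> n \<Longrightarrow> n \<le> exit_time k \<Longrightarrow> main n k (orb param m n z) \<longleftrightarrow> main m k z"
  by (simp add: main_def orb_trans)

lemma exit_time_ge: "k \<ge> n \<Longrightarrow> n \<le> exit_time k"
  using epoch_ge_self[of n] epoch_mono[of n k] epoch_exit_time(1)[of k] by simp

lemma H_part_invariant:
  assumes "m \<le> n"
  shows "orb param m n z \<in> H_part n \<longleftrightarrow> z \<in> H_part m"
proof -
  have "(\<exists>k0. \<forall>k\<ge>k0. main n k (orb param m n z)) \<longleftrightarrow> (\<exists>k0. \<forall>k\<ge>k0. main m k z)"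
  proof safe
    fix k0 assume "\<forall>k\<ge>k0. main n k (orb param m n z)"
    then have "\<forall>k\<ge>max k0 n. main m k z" using main_orb[OF assms] exit_time_ge by auto
    then show "\<exists>k0. \<forall>k\<ge>k0. main m k z" by blast
  next
    fix k0 assume "\<forall>k\<ge>k0. main m k z"
    then have "\<forall>k\<ge>max k0 n. main n k (orb param m n z)" using main_orb[OF assms] exit_time_ge by auto
    then show "\<exists>k0. \<forall>k\<ge>k0. main n k (orb param m n z)" by blast
  qed
  then show ?thesis using julia_plane_invariant[OF assms] by (auto simp: H_part_def)
qed

lemma G_part_invariant: "m \<le> n \<Longrightarrow> orb param m n z \<in> G_part n \<longleftrightarrow> z \<in> G_part m"
  by (simp add: G_part_eq H_part_invariant julia_plane_invariant)

lemma Attracted_subset_Filled: "Attracted m \<subseteq> Filled m"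
proof
  fix z assume "z \<in> Attracted m"
  then obtain k where k: "m \<le> epoch k" "cmod (orb param m (epoch k) z) < 1/2" by (auto simp: Attracted_def)
  show "z \<in> Filled m"
    unfolding Filled_def
  proof (clarify, rule ccontr)
    fix l assume l: "m \<le> epoch l" "\<not> cmod (orb param m (epoch l) z) \<le> 2"
    show False
      using escape_persists(2)[of m l z "max k l"] decay_persists(1)[OF k, of "max k l"] l by simp
  qed
qed

lemma open_Attracted: "open (Attracted m)"
proof -
  have "Attracted m = (\<Union>k\<in>{k. m \<le> epoch k}. {z. cmod (orb param m (epoch k) z) < 1/2})" by (auto simp: Attracted_def)
  then show ?thesis
    by (auto intro!: open_Collect_less continuous_intros continuous_on_orb)
qed

lemma closed_Filled: "closed (Filled m)"
proof -
  have "Filled m = (\<Inter>k\<in>{k. m \<le> epoch k}. {z. cmod (orb param m (epoch k) z) \<le> 2})" by (auto simp: Filled_def)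
  then show ?thesis
    by (auto intro!: closed_Collect_le continuous_intros continuous_on_orb)
qed

lemma compact_Filled: "compact (Filled m)"
proof -
  obtain B where B: "\<And>z. cmod (orb param m (epoch m) z) \<le> 2 \<Longrightarrow> cmod z \<le> B"
    using orb_bounded_preimage by blast
  have "Filled m \<subseteq> cball 0 B" using epoch_ge_self[of m] B by (auto simp: Filled_def)
  then have "bounded (Filled m)" using bounded_cball bounded_subset by blast
  then show ?thesis using closed_Filled by (simp add: compact_eq_bounded_closed)
qed

lemma compact_julia_plane: "compact (julia_plane m)"
  unfolding julia_plane_def by (intro compact_diff compact_Filled open_Attracted)

section \<open>Critical values, coverings and density\<close>

text \<open>A critical value either lies on the orbit of \<open>0\<close> or arises at an epoch as
  \<open>-4t^4\<close>, outside the escape radius. So at epoch \<open>j\<close> the region between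
  \<open>0\<close> and modulus \<open>4 * epoch j ^ 4\<close> is free for lifting.\<close>

lemma critical_values:
  assumes "0 < i" "i \<le> epoch j"
  shows "orb param i (epoch j) (param i) = 0 \<or> cmod (orb param i (epoch j) (param i)) \<ge> 4 * real (epoch j) ^ 4"
proof (cases "i \<in> range epoch")
  case False
  then show ?thesis using orb_center[OF assms(2)] by (simp add: param_center center_epoch)
next
  case True
  then obtain l where l: "i = epoch l" by blast
  then have "l \<le> j" using assms(2) epoch_less_iff[of j l] by simp
  have c: "cmod (param (epoch l)) = 4 * real (epoch l) ^ 4" by (simp add: param_def norm_mult norm_power)
  show ?thesis
  proof (cases "l = j")
    case True
    then show ?thesis using l c by simp
  next
    case False
    then obtain i' where i': "j = Suc i'" "l \<le> i'"
      using \<open>l \<le> j\<close> by (metis le_SucE not0_implies_Suc le_zero_eq)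
    have "real (epoch l) ^ 4 \<ge> 1" using epoch_ge(1)[of l] by (intro one_le_power) simp
    then have "cmod (orb param i (epoch l) (param i)) > 2" using l c by simp
    then have "cmod (orb param i (epoch (Suc i')) (param i)) \<ge> 8 * offset i' ^ 4"
      using l i' by (intro escape_persists(4)) auto
    moreover have "offset i' ^ 4 \<ge> 0" by simp
    ultimately have "cmod (orb param i (epoch (Suc i')) (param i)) \<ge> 4 * offset i' ^ 4" by linarith
    then show ?thesis using i' by (simp add: offset_def)
  qed
qed

text \<open>One radius serves all \<open>k\<close>, since an escape at epoch \<open>m\<close> would
  persist. It bounds the lifts uniformly, as the Schwarz estimates require.\<close>

lemma small_orbit_bound:
  obtains R where "R > 0"
    "\<And>k x. m \<le> k \<Longrightarrow> cmod (orb param m (epoch k) x) \<le> 2 \<Longrightarrow> cmod x \<le> R"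
proof -
  obtain B where B: "\<And>z. cmod (orb param m (epoch m) z) \<le> 2 \<Longrightarrow> cmod z \<le> B"
    using orb_bounded_preimage by blast
  have "cmod x \<le> max B 1" if "m \<le> k" "cmod (orb param m (epoch k) x) \<le> 2" for k x
    using B[of x] escape_persists(2)[OF epoch_ge_self _ that(1), of x] that(2) by force
  then show ?thesis using that[of "max B 1"] by simp
qed

text \<open>Away from \<open>0\<close> and from a disc of growing radius there are no critical values, so the
  exponential function lifts through the iterates to large discs, and the Schwarz lemma applies.\<close>

lemma ring_covering:
  assumes z: "z \<in> julia_plane m" and V: "open V" "z \<in> V"
  obtains j0 where "\<And>j. j \<ge> j0 \<Longrightarrow> {\<zeta>. 1/4 \<le> cmod \<zeta> \<and> cmod \<zeta> \<le> 4} \<subseteq> orb param m (epoch j) ` V"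
proof -
  obtain R where R: "R > 0" "\<And>k x. m \<le> k \<Longrightarrow> cmod (orb param m (epoch k) x) \<le> 2 \<Longrightarrow> cmod x \<le> R"
    using small_orbit_bound by blast
  obtain \<epsilon> where \<epsilon>: "\<epsilon> > 0" "ball z \<epsilon> \<subseteq> V" using V open_contains_ball by blast
  \<comment> \<open>21 is the 3 of \<open>holomorphic_oscillation\<close> times 7, a bound for the
    logarithm of \<open>\<zeta> / \<zeta>0\<close>: real part at most 3, as the modulus lies between
    1/8 and 8, and imaginary part below 4.\<close>
  obtain j1 :: nat where j1: "real j1 > 21 * R / \<epsilon>" using reals_Archimedean2 by blast
  have "{\<zeta>. 1/4 \<le> cmod \<zeta> \<and> cmod \<zeta> \<le> 4} \<subseteq> orb param m (epoch j) ` V" if j: "j \<ge> max (max j1 8) (Suc m)" for j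
  proof
    fix \<zeta> :: complex assume "\<zeta> \<in> {\<zeta>. 1/4 \<le> cmod \<zeta> \<and> cmod \<zeta> \<le> 4}"
    then have \<zeta>: "1/4 \<le> cmod \<zeta>" "cmod \<zeta> \<le> 4" by auto
    obtain i where i: "j = Suc i" "m \<le> i" using j by (metis Suc_le_D Suc_le_mono max.bounded_iff)
    have m_le: "m \<le> epoch j" using epoch_ge_self[of m] epoch_mono[of m j] j by simp
    define \<zeta>0 where "\<zeta>0 = orb param m (epoch j) z"
    have \<zeta>0: "1/2 \<le> cmod \<zeta>0" "cmod \<zeta>0 \<le> 2" using z m_le by (auto simp: \<zeta>0_def julia_plane_iff)
    then have "\<zeta>0 \<noteq> 0" by auto
    define u0 where "u0 = Ln \<zeta>0"
    have u0: "exp u0 = \<zeta>0" "Re u0 < 1"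
    proof -
      have "Re u0 = ln (cmod \<zeta>0)" using \<open>\<zeta>0 \<noteq> 0\<close> by (simp add: u0_def)
      also have "\<dots> \<le> ln 2" using \<zeta>0 \<open>\<zeta>0 \<noteq> 0\<close> by (subst ln_le_cancel_iff) auto
      finally show "Re u0 < 1" using ln_2_less_1 by simp
    qed (use \<open>\<zeta>0 \<noteq> 0\<close> in \<open>simp add: u0_def\<close>)
    \<comment> \<open>The moduli are at most \<open>e^(j+1)\<close>, below
      \<open>4^(j+1) = epoch j\<close>; hence the disc may grow with \<open>j\<close>.\<close>
    have small: "cmod (exp u) < 4 * real (epoch j) ^ 4" if "u \<in> ball u0 (real j)" for u
    proof -
      have "Re u \<le> real (Suc j)"
        using abs_Re_le_cmod[of "u - u0"] that u0 by (auto simp: dist_norm norm_minus_commute)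
      then have "cmod (exp u) \<le> exp (real (Suc j) * 1)" by simp
      also have "\<dots> = exp 1 ^ Suc j" by (rule exp_of_nat_mult)
      also have "\<dots> \<le> 3 ^ Suc j" using exp_le by (intro power_mono) auto
      also have "\<dots> < 4 ^ Suc j" by (intro power_strict_mono) auto
      also have "\<dots> = real (epoch j) ^ 1" by (simp add: epoch_def)
      also have "\<dots> \<le> real (epoch j) ^ 4" using epoch_ge(1)[of j] by (intro power_increasing) auto
      also have "\<dots> \<le> 4 * real (epoch j) ^ 4" by simp
      finally show ?thesis .
    qed
    have avoid: "orb param i (epoch j) (param i) \<notin> exp ` ball u0 (real j)" if "m < i" "i \<le> epoch j" for i
    proof
      assume "orb param i (epoch j) (param i) \<in> exp ` ball u0 (real j)"
      then obtain u where u: "u \<in> ball u0 (real j)" "orb param i (epoch j) (param i) = exp u" by blast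
      then show False using critical_values[of i j] that small[OF u(1)] by auto
    qed
    have "u0 \<in> ball u0 (real j)" using j by simp
    then obtain G where G: "G holomorphic_on ball u0 (real j)" "G u0 = z"
      "\<And>u. u \<in> ball u0 (real j) \<Longrightarrow> orb param m (epoch j) (G u) = exp u"
      using orb_lift[OF m_le convex_imp_contractible[OF convex_ball] holomorphic_on_exp, of u0 u0 "real j" param z]
        avoid u0(1) \<zeta>0_def by auto
    \<comment> \<open>Boundedness is tested one epoch earlier, because \<open>exp u\<close> itself
      may exceed 2. An escape at epoch \<open>i\<close> would make the value at epoch
      \<open>j\<close> larger than \<open>small\<close> permits.\<close>
    have GR: "cmod (G u) \<le> R" if "u \<in> ball u0 (real j)" for u
    proof (rule R(2)[OF i(2)], rule ccontr)
      assume "\<not> cmod (orb param m (epoch i) (G u)) \<le> 2"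
      then have "cmod (orb param m (epoch (Suc i)) (G u)) \<ge> 8 * offset i ^ 4"
        using i epoch_ge_self[of m] epoch_mono[of m i] by (intro escape_persists(4)[of m i]) auto
      then have "cmod (exp u) \<ge> 8 * real (epoch j) ^ 4" using G(3)[OF that] i by (simp add: offset_def)
      moreover have "real (epoch j) ^ 4 \<ge> 0" by simp
      ultimately show False using small[OF that] by linarith
    qed
    define v where "v = Ln (\<zeta> / \<zeta>0)"
    have ne: "\<zeta> / \<zeta>0 \<noteq> 0" using \<zeta> \<open>\<zeta>0 \<noteq> 0\<close> by auto
    have v: "exp (u0 + v) = \<zeta>" using ne u0(1) by (simp add: v_def exp_add)
    have "cmod v \<le> \<bar>Re v\<bar> + \<bar>Im v\<bar>" by (rule cmod_le)
    also have "\<bar>Im v\<bar> \<le> pi" using Im_Ln_le_pi[OF ne] mpi_less_Im_Ln[OF ne] by (simp add: v_def)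
    also have "\<bar>Re v\<bar> \<le> 3"
    proof -
      have q: "cmod (\<zeta> / \<zeta>0) \<le> 8" "1/8 \<le> cmod (\<zeta> / \<zeta>0)"
        using \<zeta> \<zeta>0 \<open>\<zeta>0 \<noteq> 0\<close> by (auto simp: norm_divide field_simps)
      have "(2::real) ^ 3 \<le> exp 1 ^ 3" using exp_ge_add_one_self[of 1] by (intro power_mono) auto
      then have e8: "(8::real) \<le> exp 3" by (simp flip: exp_of_nat_mult)
      have "ln (cmod (\<zeta> / \<zeta>0)) \<le> ln (exp 3)" using q e8 ne by (subst ln_le_cancel_iff) auto
      moreover have "ln (exp (-3)) \<le> ln (cmod (\<zeta> / \<zeta>0))"
      proof (subst ln_le_cancel_iff)
        have "exp (-3) \<le> (1/8::real)" using e8 by (simp add: exp_minus field_simps)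
        then show "exp (-3) \<le> cmod (\<zeta> / \<zeta>0)" using q by linarith
      qed (use ne in auto)
      ultimately show ?thesis using ne by (simp add: v_def Re_Ln abs_le_iff)
    qed
    finally have "cmod v \<le> 7" using pi_less_4 by linarith
    then have uin: "u0 + v \<in> ball u0 (real j)" using j by (simp add: dist_norm)
    have "cmod (G (u0 + v) - G u0) \<le> 3 * R * cmod (u0 + v - u0) / real j"
      using GR G(1) R(1) uin j by (intro holomorphic_oscillation) auto
    also have "\<dots> \<le> 3 * R * 7 / real j"
      using \<open>cmod v \<le> 7\<close> R(1) by (intro divide_right_mono mult_left_mono) auto
    also have "\<dots> < \<epsilon>"
    proof -
      have "21 * R / \<epsilon> < real j" using j1 j by (simp add: less_le_trans)
      then show ?thesis using \<epsilon>(1) j by (simp add: field_simps)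
    qed
    finally have "G (u0 + v) \<in> V" using \<epsilon>(2) G(2) by (auto simp: dist_norm norm_minus_commute subset_iff)
    then show "\<zeta> \<in> orb param m (epoch j) ` V" using G(3)[OF uin] v by (metis image_eqI)
  qed
  then show ?thesis using that by blast
qed

text \<open>Turns \<open>ring_covering\<close> into the tool for all density claims: by invariance,
  a single point of the ring with the right future at each late epoch suffices.\<close>

lemma julia_plane_subset_closure_preimages:
  assumes "\<And>j. j1 \<le> j \<Longrightarrow> m \<le> epoch j \<Longrightarrow>
    \<exists>\<zeta>. 1/4 \<le> cmod \<zeta> \<and> cmod \<zeta> \<le> 4 \<and> orb param m (epoch j) -` {\<zeta>} \<subseteq> X"
  shows "julia_plane m \<subseteq> closure X"
proof
  fix z assume z: "z \<in> julia_plane m"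
  have "X \<inter> V \<noteq> {}" if V: "open V" "z \<in> V" for V
  proof -
    obtain j0 where j0: "\<And>j. j \<ge> j0 \<Longrightarrow> {\<zeta>. 1/4 \<le> cmod \<zeta> \<and> cmod \<zeta> \<le> 4} \<subseteq> orb param m (epoch j) ` V"
      using ring_covering[OF z V] by blast
    define j where "j = max (max j0 m) j1"
    have "m \<le> j" "j0 \<le> j" "j1 \<le> j" by (auto simp: j_def)
    then have "m \<le> epoch j" using epoch_ge_self[of m] epoch_mono[of m j] by simp
    then obtain \<zeta> where \<zeta>: "1/4 \<le> cmod \<zeta>" "cmod \<zeta> \<le> 4" "orb param m (epoch j) -` {\<zeta>} \<subseteq> X"
      using assms[OF \<open>j1 \<le> j\<close>] by blast
    moreover have "\<zeta> \<in> orb param m (epoch j) ` V" using j0[OF \<open>j0 \<le> j\<close>] \<zeta>(1,2) by blast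
    ultimately show ?thesis by blast
  qed
  then show "z \<in> closure X" by (auto simp: closure_iff_nhds_not_empty)
qed

lemma escape_filterlim:
  assumes "m \<le> epoch k" "cmod (orb param m (epoch k) z) > 2"
  shows "filterlim (\<lambda>n. cmod (orb param m (epoch (m + n)) z)) at_top sequentially"
proof (rule filterlim_at_top_mono)
  show "filterlim (\<lambda>n. real n - real k) at_top sequentially" by real_asymp
  show "\<forall>\<^sub>F n in sequentially. real n - real k \<le> cmod (orb param m (epoch (m + n)) z)"
    using eventually_ge_at_top[of k]
  proof eventually_elim
    case (elim n)
    have "real n - real k \<le> real (m + n - k)" using elim by simp
    also have "\<dots> \<le> 2 ^ (m + n - k)" by (simp add: of_nat_less_two_power less_imp_le)
    also have "\<dots> \<le> 2 ^ (m + n - k) * (2::real)" by simp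
    also have "\<dots> \<le> cmod (orb param m (epoch (m + n)) z)"
      using elim by (intro escape_persists(1)[OF assms]) simp
    finally show ?case .
  qed
qed

lemma julia_plane_subset_closure_escaping:
  "julia_plane m \<subseteq> closure {y. filterlim (\<lambda>n. cmod (orb param m (epoch (m + n)) y)) at_top sequentially}"
proof (rule julia_plane_subset_closure_preimages[of 0])
  fix j assume "m \<le> epoch j"
  then show "\<exists>\<zeta>. 1/4 \<le> cmod \<zeta> \<and> cmod \<zeta> \<le> 4 \<and> orb param m (epoch j) -` {\<zeta>} \<subseteq>
      {y. filterlim (\<lambda>n. cmod (orb param m (epoch (m + n)) y)) at_top sequentially}"
    by (intro exI[of _ 3]) (auto intro!: escape_filterlim)
qed

lemma julia_plane_subset_closure_compl_Filled: "julia_plane m \<subseteq> closure (- Filled m)"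
proof (rule julia_plane_subset_closure_preimages[of 0])
  fix j assume "m \<le> epoch j"
  then show "\<exists>\<zeta>. 1/4 \<le> cmod \<zeta> \<and> cmod \<zeta> \<le> 4 \<and> orb param m (epoch j) -` {\<zeta>} \<subseteq> - Filled m"
    by (intro exI[of _ 3]) (auto simp: Filled_def)
qed

section \<open>Identification of the Fatou and Julia sets\<close>

abbreviation poly_seq :: "nat \<Rightarrow> complex poly" where "poly_seq \<equiv> \<lambda>m. [:param m, 0, 1:]"

lemma epoch_interval:
  assumes "epoch j0 \<le> n"
  obtains j where "j0 \<le> j" "epoch j \<le> n" "n < epoch (Suc j)"
proof -
  define l where "l = (LEAST l. n < epoch l)"
  have l: "n < epoch l" unfolding l_def by (rule LeastI[of _ n]) (rule epoch_ge(2))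
  have "j0 < l" using epoch_less_iff assms l by (metis le_less_trans)
  then obtain j where j: "l = Suc j" "j0 \<le> j" by (metis less_Suc_eq_le less_imp_Suc_add)
  have "\<not> n < epoch j" using not_less_Least[of j "\<lambda>l. n < epoch l"] j by (auto simp: l_def)
  then show ?thesis using that j l by auto
qed

text \<open>The index set \<open>S\<close> consists of the times halfway through the double steps.
  The bounds of \<open>decay_step\<close> depend on the epoch alone, so both limits are uniform on
  \<open>V\<close>.\<close>

lemma Attracted_subset_fatou: "z \<in> Attracted m \<Longrightarrow> Pt z \<in> fatou poly_seq m"
proof -
  assume "z \<in> Attracted m"
  then obtain k where k: "m \<le> epoch k" "cmod (orb param m (epoch k) z) < 1/2" by (auto simp: Attracted_def)
  define V where "V = {y. cmod (orb param m (epoch k) y) < 1/2}"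
  have "open V" unfolding V_def by (intro open_Collect_less continuous_intros continuous_on_orb)
  have "normal_on (Pt ` V) {Q poly_seq m n | n. m \<le> n}"
  proof (rule normal_on_two_limits[where S = "{n. Suc n \<in> range epoch}" and a = Infty and b = "Pt 0"])
    fix e :: real assume e: "e > 0"
    obtain R where R: "\<And>z. cmod z \<ge> R \<Longrightarrow> dist (Pt z) Infty < e" using Pt_near_Infty[OF e] by blast
    obtain \<delta> where \<delta>: "\<delta> > 0" "\<And>z. dist z 0 < \<delta> \<Longrightarrow> dist (Pt z) (Pt 0) < e"
      using continuous_on_Pt[of UNIV] e unfolding continuous_on_iff by blast
    obtain j1 :: nat where j1: "real j1 > max R (1 / \<delta>)" using reals_Archimedean2 by blast
    define j0 where "j0 = max j1 (Suc k)"
    show "\<exists>n0. \<forall>n\<ge>n0. \<forall>x\<in>Pt ` V. dist (Q poly_seq m n x) (if n \<in> {n. Suc n \<in> range epoch} then Infty else Pt 0) < e"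
    proof (intro exI[of _ "epoch j0"] allI impI ballI)
      fix n x assume n: "epoch j0 \<le> n" and "x \<in> Pt ` V"
      then obtain y where y: "x = Pt y" "cmod (orb param m (epoch k) y) < 1/2" by (auto simp: V_def)
      obtain j where j: "j0 \<le> j" "epoch j \<le> n" "n < epoch (Suc j)" using epoch_interval[OF n] by blast
      have kj: "k \<le> j" "k < j" using j by (auto simp: j0_def)
      have mj: "m \<le> epoch j" using k(1) epoch_mono[OF kj(1)] by simp
      have Tj: "real (epoch j) > max R (1 / \<delta>)" using j1 j epoch_ge(2)[of j] by (auto simp: j0_def)
      define y' where "y' = orb param m (epoch j) y"
      have y': "cmod y' < 1/2" "cmod y' \<le> 1 / epoch j"
        using decay_persists[OF k(1) y(2)] kj by (auto simp: y'_def)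
      have tr: "orb param m n y = orb param (epoch j) n y'" using mj j by (simp add: y'_def orb_trans)
      show "dist (Q poly_seq m n x) (if n \<in> {n. Suc n \<in> range epoch} then Infty else Pt 0) < e"
      proof (cases "n \<le> exit_time j")
        case True
        then have "Suc n \<notin> range epoch" using between_epoch_notin_range[of j "Suc n"] j epoch_exit_time[of j] by auto
        moreover have "cmod (orb param m n y) < \<delta>"
        proof -
          have "cmod (orb param m n y) \<le> 1 / epoch j"
            using decay_step(2)[OF y'(1) j(2) True] y'(2) tr by simp
          also have "\<dots> < \<delta>" using Tj \<delta>(1) epoch_ge(1)[of j] by (simp add: field_simps)
          finally show ?thesis .
        qed
        ultimately show ?thesis using \<delta>(2) y(1) by (simp add: Q_quadratic dist_norm)
      next
        case False
        then have n: "n = Suc (exit_time j)" using j epoch_exit_time[of j] by simp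
        then have "Suc n \<in> range epoch" using epoch_exit_time(2) by auto
        moreover have "cmod (orb param m n y) \<ge> R"
        proof -
          have "offset j \<ge> R" using Tj by (simp add: offset_def epoch_Suc)
          then show ?thesis using decay_step(3)[OF y'(1), of j] tr n by simp
        qed
        ultimately show ?thesis using R y(1) by (simp add: Q_quadratic)
      qed
    qed
  qed
  then show ?thesis
    unfolding fatou_def using open_Pt_image[OF \<open>open V\<close>] k(2) by (auto simp: V_def intro!: exI[of _ "Pt ` V"])
qed

text \<open>The points not exceeding 2 at epoch \<open>k\<close> form a compact set, so one open set
  contains all the escaped points and \<open>Infty\<close>, and the iterates tend to
  \<open>Infty\<close> uniformly on it.\<close>

lemma escape_subset_fatou:
  assumes "m \<le> epoch k" and x: "x = Infty \<or> (\<exists>y. x = Pt y \<and> cmod (orb param m (epoch k) y) > 2)"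
  shows "x \<in> fatou poly_seq m"
proof -
  define U where "U = - Pt ` (orb param m (epoch k) -` cball 0 2)"
  have "open U" unfolding U_def
    by (intro open_Compl compact_imp_closed compact_Pt_image compact_orb_vimage) auto
  have UI: "y = Infty \<or> (\<exists>w. y = Pt w \<and> cmod (orb param m (epoch k) w) > 2)" if "y \<in> U" for y
    using that by (cases y) (auto simp: U_def)
  have "normal_on U {Q poly_seq m n | n. m \<le> n}"
  proof (rule normal_on_two_limits[where S = "{}" and a = Infty and b = Infty])
    fix e :: real assume e: "e > 0"
    obtain R where R: "\<And>z. cmod z \<ge> R \<Longrightarrow> dist (Pt z) Infty < e" using Pt_near_Infty[OF e] by blast
    obtain j1 :: nat where j1: "real j1 > R" using reals_Archimedean2 by blast
    show "\<exists>n0. \<forall>n\<ge>n0. \<forall>x\<in>U. dist (Q poly_seq m n x) (if n \<in> {} then Infty else Infty) < e"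
    proof (intro exI[of _ "epoch (j1 + k)"] allI impI ballI)
      fix n x assume n: "epoch (j1 + k) \<le> n" and "x \<in> U"
      from UI[OF this(2)] show "dist (Q poly_seq m n x) (if n \<in> {} then Infty else Infty) < e"
      proof
        assume "\<exists>w. x = Pt w \<and> cmod (orb param m (epoch k) w) > 2"
        then obtain w where w: "x = Pt w" "cmod (orb param m (epoch k) w) > 2" by blast
        obtain j where j: "j1 + k \<le> j" "epoch j \<le> n" "n < epoch (Suc j)" using epoch_interval[OF n] by blast
        have "R \<le> real (j - k)" using j1 j by simp
        also have "\<dots> \<le> 2 ^ (j - k)" by (simp add: of_nat_less_two_power less_imp_le)
        also have "\<dots> \<le> cmod (orb param m n w)"
          using escape_persists(3)[OF assms(1) w(2), of j n] j by simp
        finally show ?thesis using R w by (simp add: Q_quadratic)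
      qed (use e in \<open>simp add: Q_quadratic_Infty\<close>)
    qed
  qed
  moreover have "x \<in> U" using x by (auto simp: U_def)
  ultimately show ?thesis unfolding fatou_def using \<open>open U\<close> by blast
qed

lemma julia_plane_not_fatou:
  assumes "z \<in> julia_plane m"
  shows "Pt z \<notin> fatou poly_seq m"
proof
  assume "Pt z \<in> fatou poly_seq m"
  then obtain U where U: "open U" "Pt z \<in> U" "normal_on U {Q poly_seq m n | n. m \<le> n}"
    by (auto simp: fatou_def)
  have ge: "m \<le> epoch (m + n)" for n using epoch_ge_self[of m] epoch_mono[of m "m + n"] by simp
  show False
  proof (rule not_normal_on_escape_boundary[OF U(3,1,2)])
    show "Q poly_seq m (epoch (m + n)) \<in> {Q poly_seq m n | n. m \<le> n}" for n using ge by blast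
    show "cmod (orb param m (epoch (m + n)) z) \<le> 2" for n using assms ge by (auto simp: julia_plane_iff)
    show "z \<in> closure {y. filterlim (\<lambda>n. cmod (orb param m (epoch (m + n)) y)) at_top sequentially}"
      using julia_plane_subset_closure_escaping assms by blast
  qed (auto simp: Q_quadratic continuous_on_orb)
qed

lemma fatou_eq: "fatou poly_seq m = Pt ` Attracted m \<union> - Pt ` Filled m"
proof (intro equalityI subsetI)
  fix x assume x: "x \<in> fatou poly_seq m"
  show "x \<in> Pt ` Attracted m \<union> - Pt ` Filled m"
  proof (rule ccontr)
    assume "x \<notin> Pt ` Attracted m \<union> - Pt ` Filled m"
    then have "\<exists>z\<in>julia_plane m. x = Pt z" by (auto simp: julia_plane_def)
    then show False using x julia_plane_not_fatou by blast
  qed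
next
  fix x assume "x \<in> Pt ` Attracted m \<union> - Pt ` Filled m"
  then consider z where "x = Pt z" "z \<in> Attracted m" | "x = Infty" | z where "x = Pt z" "z \<notin> Filled m"
    by (cases x) auto
  then show "x \<in> fatou poly_seq m"
  proof cases
    case 2 then show ?thesis using escape_subset_fatou[OF epoch_ge_self] by blast
  next
    case 3
    then obtain k where "m \<le> epoch k" "cmod (orb param m (epoch k) z) > 2" by (auto simp: Filled_def not_le)
    then show ?thesis using escape_subset_fatou 3(1) by blast
  qed (use Attracted_subset_fatou in blast)
qed

lemma julia_eq: "julia poly_seq m = Pt ` julia_plane m"
  unfolding julia_def fatou_eq julia_plane_def by auto

section \<open>Components of the non-escaping set\<close>

lemma main_gap:
  assumes "m \<le> exit_time k" "cmod (orb param m (epoch (Suc k)) z) \<le> 2"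
  shows "main m k z \<Longrightarrow> cmod (orb param m (exit_time k) z) \<le> 1"
    "\<not> main m k z \<Longrightarrow> cmod (orb param m (exit_time k) z - of_real (2 * offset k)) \<le> 1 / offset k ^ 3 \<or>
       cmod (orb param m (exit_time k) z + of_real (2 * offset k)) \<le> 1 / offset k ^ 3"
proof -
  have F: "cmod ((orb param m (exit_time k) z)\<^sup>2 * ((orb param m (exit_time k) z)\<^sup>2 - of_real (4 * (offset k)\<^sup>2))) \<le> 2"
    using orb_special(2)[OF assms(1)] assms(2) by simp
  show "main m k z \<Longrightarrow> cmod (orb param m (exit_time k) z) \<le> 1"
    using small_value_pieces(1)[OF F] by (simp add: main_def)
  show "\<not> main m k z \<Longrightarrow> cmod (orb param m (exit_time k) z - of_real (2 * offset k)) \<le> 1 / offset k ^ 3 \<or>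
       cmod (orb param m (exit_time k) z + of_real (2 * offset k)) \<le> 1 / offset k ^ 3"
    using small_value_pieces(2)[OF F] by (simp add: main_def)
qed

text \<open>The modulus 2 lies in the gap between 1 and \<open>offset k\<close>, so no connected set
  of points with bounded value can cross it.\<close>

lemma main_const:
  assumes "connected C" "m \<le> exit_time k" "\<And>z. z \<in> C \<Longrightarrow> cmod (orb param m (epoch (Suc k)) z) \<le> 2"
    and "x \<in> C" "y \<in> C" "main m k x"
  shows "main m k y"
proof (rule ccontr)
  assume ny: "\<not> main m k y"
  let ?w = "\<lambda>z. cmod (orb param m (exit_time k) z)"
  have op: "open {z. ?w z < 2}" "open {z. 2 < ?w z}"
    by (intro open_Collect_less continuous_intros continuous_on_orb)+
  have alt: "?w z < 2 \<or> 2 < ?w z" if "z \<in> C" for z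
    using main_gap(1)[OF assms(2) assms(3)[OF that]] offset_ge[of k] by (force simp: main_def)
  have "x \<in> {z. ?w z < 2} \<inter> C" using main_gap(1)[OF assms(2) assms(3)[OF assms(4)]] assms by force
  moreover have "y \<in> {z. 2 < ?w z} \<inter> C" using ny assms offset_ge[of k] by (auto simp: main_def)
  moreover have "C \<subseteq> {z. ?w z < 2} \<union> {z. 2 < ?w z}" using alt by blast
  moreover have "{z. ?w z < 2} \<inter> {z. 2 < ?w z} \<inter> C = {}" by auto
  ultimately show False
    using connectedD[OF assms(1) op] by (metis empty_iff)
qed

lemma main_const_Filled:
  assumes "connected C" "C \<subseteq> Filled m" "m \<le> exit_time k" "x \<in> C" "y \<in> C" "main m k x"
  shows "main m k y"
proof (rule main_const[OF assms(1,3) _ assms(4-6)])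
  fix z assume "z \<in> C"
  moreover have "m \<le> epoch (Suc k)" using assms(3) epoch_exit_time(3)[of k] by simp
  ultimately show "cmod (orb param m (epoch (Suc k)) z) \<le> 2" using assms(2) by (auto simp: Filled_def)
qed

lemma epoch_le_of_le: "m \<le> n \<Longrightarrow> m \<le> epoch n"
  using epoch_ge_self[of m] epoch_mono[of m n] by simp

text \<open>On the frontier of a bounded complementary component every epoch iterate is at most 2 in
  modulus, and the maximum principle forbids escape inside.\<close>

lemma connected_compl_Filled: "connected (- Filled m)"
proof (rule ccontr)
  assume "\<not> connected (- Filled m)"
  then obtain W where W: "W \<in> components (- Filled m)" "bounded W"
    using cobounded_has_bounded_component[of "- Filled m"] compact_imp_bounded[OF compact_Filled] by auto
  have fr: "frontier W \<subseteq> Filled m"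
    using frontier_of_components_closed_complement[OF closed_Filled W(1)] .
  obtain x where x: "x \<in> W" "x \<notin> Filled m"
    using in_components_nonempty[OF W(1)] in_components_subset[OF W(1)] by blast
  then obtain k where k: "m \<le> epoch k" "cmod (orb param m (epoch k) x) > 2" by (auto simp: Filled_def not_le)
  have "cmod (orb param m (epoch k) x) \<le> 2"
    by (rule maximum_modulus_frontier[OF holomorphic_orb continuous_on_orb W(2) _ x(1)])
       (use fr k(1) in \<open>auto simp: Filled_def\<close>)
  then show False using k(2) by simp
qed

text \<open>Since the complement of \<open>Filled m\<close> is connected, each component has
  connected frontier. Attracted points are interior to their component, and Julia points are limits
  of escaping points; this identifies the frontier.\<close>

lemma component_Filled:
  assumes L: "L \<in> components (Filled m)"
  shows "compact L" "connected L" "L \<subseteq> Filled m" "connected (frontier L)" "frontier L = L \<inter> julia_plane m"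
proof -
  show cL: "compact L" using compact_components[OF compact_Filled L] .
  show "connected L" and sub: "L \<subseteq> Filled m"
    using in_components_connected[OF L] in_components_subset[OF L] .
  show "connected (frontier L)"
    using connected_frontier_component_complement[OF connected_compl_Filled, of L m] L by simp
  have "frontier L \<subseteq> L" using cL by (simp add: compact_imp_closed frontier_subset_closed)
  moreover have "x \<notin> frontier L" if x: "x \<in> L" "x \<in> Attracted m" for x
  proof -
    obtain e where e: "e > 0" "ball x e \<subseteq> Attracted m" using open_Attracted x(2) open_contains_ball by blast
    have "x \<in> L \<inter> ball x e" using e(1) x(1) by simp
    then have "ball x e \<subseteq> L"
      using components_maximal[OF L connected_ball, of x e] e(2) Attracted_subset_Filled[of m] by blast
    then have "x \<in> interior L" using e(1) by (meson centre_in_ball interior_maximal open_ball subsetD)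
    then show ?thesis by (simp add: frontier_def)
  qed
  moreover have "x \<in> frontier L" if "x \<in> L" "x \<in> julia_plane m" for x
  proof -
    have "x \<in> closure (- L)"
      using julia_plane_subset_closure_compl_Filled[of m] that(2) closure_mono[of "- Filled m" "- L"] sub by blast
    then show ?thesis using that(1) closure_subset by (auto simp: frontier_closures)
  qed
  ultimately show "frontier L = L \<inter> julia_plane m" using sub by (auto simp: julia_plane_def)
qed

lemma H_part_const:
  assumes L: "L \<in> components (Filled m)" and "x \<in> L" "x \<in> H_part m" "y \<in> L" "y \<in> julia_plane m"
  shows "y \<in> H_part m"
proof -
  obtain k0 where k0: "\<And>k. k \<ge> k0 \<Longrightarrow> main m k x" using assms by (auto simp: H_part_def)
  have "main m k y" if "k \<ge> max k0 m" for k
    using main_const_Filled[OF component_Filled(2,3)[OF L] exit_time_ge[of m k] assms(2,4)] k0 that by simp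
  then show ?thesis using assms(5) unfolding H_part_def by blast
qed

lemma H_part_subset: "H_part m \<subseteq> julia_plane m" "H_part m \<subseteq> Filled m"
  by (auto simp: H_part_def julia_plane_def)

text \<open>Membership in \<open>H_part\<close> is constant along the Julia points of one component
  \<open>L\<close>, and any connected subset of \<open>H_part\<close> stays in one \<open>L\<close>;
  so the connected sets \<open>frontier L\<close> are exactly the components.\<close>

lemma components_H_part:
  "components (H_part m) = frontier ` {L \<in> components (Filled m). L \<inter> H_part m \<noteq> {}}"
proof -
  have fr_H_part: "frontier L \<subseteq> H_part m" if "L \<in> components (Filled m)" "L \<inter> H_part m \<noteq> {}" for L
    using component_Filled(5)[OF that(1)] H_part_const[OF that(1)] that(2) by blast
  show ?thesis
  proof (intro equalityI subsetI)
    fix K assume K: "K \<in> components (H_part m)"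
    have Kp: "K \<noteq> {}" "K \<subseteq> H_part m" "connected K"
      using in_components_nonempty[OF K] in_components_subset[OF K] in_components_connected[OF K] .
    then have "K \<subseteq> Filled m" using H_part_subset(2) by blast
    then obtain L where L: "L \<in> components (Filled m)" "K \<subseteq> L"
      using exists_component_superset[of K "Filled m"] Kp by auto
    have "L \<inter> H_part m \<noteq> {}" using L Kp by blast
    moreover have "K \<subseteq> frontier L" using component_Filled(5)[OF L(1)] L(2) Kp(2) H_part_subset(1)[of m] by blast
    then have "frontier L \<subseteq> K"
      using components_maximal[OF K component_Filled(4)[OF L(1)] fr_H_part[OF L(1)]] Kp(1) calculation by blast
    ultimately show "K \<in> frontier ` {L \<in> components (Filled m). L \<inter> H_part m \<noteq> {}}"
      using L(1) \<open>K \<subseteq> frontier L\<close> by blast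
  next
    fix K assume "K \<in> frontier ` {L \<in> components (Filled m). L \<inter> H_part m \<noteq> {}}"
    then obtain L where L: "K = frontier L" "L \<in> components (Filled m)" "L \<inter> H_part m \<noteq> {}" by blast
    have eq: "frontier L = L \<inter> julia_plane m" using component_Filled(5)[OF L(2)] .
    show "K \<in> components (H_part m)"
      unfolding in_components_maximal L(1)
    proof (intro conjI allI impI)
      show "frontier L \<noteq> {}" using eq L(3) H_part_subset(1)[of m] by blast
      show "frontier L \<subseteq> H_part m" by (rule fr_H_part[OF L(2,3)])
      show "connected (frontier L)" by (rule component_Filled(4)[OF L(2)])
      fix D assume D: "D \<noteq> {} \<and> frontier L \<subseteq> D \<and> D \<subseteq> H_part m \<and> connected D"
      have "L \<inter> D \<noteq> {}" using D eq \<open>frontier L \<noteq> {}\<close> by blast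
      then have "D \<subseteq> L" using components_maximal[OF L(2)] D H_part_subset(2)[of m] by blast
      then show "D = frontier L" using eq D H_part_subset(1)[of m] by blast
    qed
  qed
qed

text \<open>Every component of the preimage of a connected set under a block covers that set, and the
  only preimage of \<open>0\<close> in the main piece is \<open>0\<close>; so the main pieces are connected.\<close>

lemma connected_main_piece:
  assumes "n \<le> j"
  shows "connected {y. cmod (orb param (epoch n) (epoch j) y) \<le> 2 \<and> (\<forall>k\<in>{n..<j}. main (epoch n) k y)}"
  using assms
proof (induction n rule: inc_induct)
  case base
  have "{y. cmod (orb param (epoch j) (epoch j) y) \<le> 2 \<and> (\<forall>k\<in>{j..<j}. main (epoch j) k y)} = cball 0 2" by auto
  then show ?case by (metis connected_cball)
next
  case (step n)
  let ?p = "orb param (epoch n) (epoch (Suc n))"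
  define M where "M = {y. cmod (orb param (epoch (Suc n)) (epoch j) y) \<le> 2 \<and> (\<forall>k\<in>{Suc n..<j}. main (epoch (Suc n)) k y)}"
  define R where "R = {y. cmod (orb param (epoch n) (epoch j) y) \<le> 2 \<and> (\<forall>k\<in>{n..<j}. main (epoch n) k y)}"
  have epoch_le: "epoch n \<le> epoch (Suc n)" "epoch (Suc n) \<le> epoch j" using step.hyps epoch_mono by auto
  have main_p: "main (epoch (Suc n)) k (?p y) \<longleftrightarrow> main (epoch n) k y" if "k \<ge> Suc n" for k y
    using main_orb[OF epoch_le(1), of k y] epoch_mono[OF that] epoch_exit_time(1)[of k] by simp
  have R_eq: "R = {y \<in> ?p -` M. main (epoch n) n y}"
  proof -
    have "{n..<j} = insert n {Suc n..<j}" using step.hyps by auto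
    then show ?thesis unfolding R_def M_def using main_p orb_trans[OF epoch_le] by auto
  qed
  have M_le: "cmod y \<le> 2" if "y \<in> M" for y
    using escape_persists(2)[of "epoch (Suc n)" "Suc n" y j] that step.hyps by (force simp: M_def)
  have "M = {y. cmod (orb param (epoch (Suc n)) (epoch j) y) \<le> 2} \<inter> (\<Inter>k\<in>{Suc n..<j}. {y. main (epoch (Suc n)) k y})"
    by (auto simp: M_def)
  then have "closed M"
    unfolding main_def
    by (auto intro!: closed_Int closed_INT closed_Collect_le continuous_intros continuous_on_orb)
  moreover have "bounded M" using M_le by (auto simp: bounded_iff)
  ultimately have "compact M" by (simp add: compact_eq_bounded_closed)
  then have cpt: "compact (?p -` M)" by (rule compact_orb_vimage)
  have zero: "0 \<in> M"
  proof -
    have "orb param (epoch (Suc n)) (epoch j) 0 = 0"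
      using orb_center[OF epoch_le(2)] by (simp add: center_epoch)
    moreover have "main (epoch (Suc n)) k 0" if "k \<ge> Suc n" for k
      using orb_center[of "epoch (Suc n)" "exit_time k"] epoch_mono[OF that] epoch_exit_time(1)[of k] offset_ge[of k]
      by (simp add: main_def center_epoch)
    ultimately show ?thesis by (auto simp: M_def)
  qed
  have "components M = {M}"
    using step.IH zero by (metis M_def components_eq_sing_iff empty_iff)
  have conn0: "\<exists>C. connected C \<and> C \<subseteq> R \<and> y \<in> C \<and> 0 \<in> C" if "y \<in> R" for y
  proof -
    have "y \<in> ?p -` M" using that R_eq by blast
    then obtain C where C: "C \<in> components (?p -` M)" "y \<in> C" using Union_components by blast
    have Cp: "connected C" "C \<subseteq> ?p -` M" using in_components_connected[OF C(1)] in_components_subset[OF C(1)] .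
    have "?p ` C \<in> components M"
      by (rule component_of_preimage_onto[OF continuous_on_orb open_orb_image cpt C(1)])
    then have "?p ` C = M" using \<open>components M = {M}\<close> by simp
    then obtain y0 where y0: "y0 \<in> C" "?p y0 = 0" using zero by (metis imageE)
    have mainC: "main (epoch n) n y'" if "y' \<in> C" for y'
    proof (rule main_const[OF Cp(1) epoch_exit_time(1) _ C(2) that])
      show "cmod (orb param (epoch n) (epoch (Suc n)) z) \<le> 2" if "z \<in> C" for z using Cp(2) that M_le by blast
      show "main (epoch n) n y" using \<open>y \<in> R\<close> R_eq by blast
    qed
    let ?w = "orb param (epoch n) (exit_time n) y0"
    \<comment> \<open>The other zeros of the double step, \<open>2t\<close> and \<open>-2t\<close>,
      violate \<open>main\<close>.\<close>
    have "?w = 0"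
    proof (rule ccontr)
      assume "?w \<noteq> 0"
      then have "?w\<^sup>2 = of_real (4 * (offset n)\<^sup>2)"
        using y0(2) orb_special(2)[OF epoch_exit_time(1)[of n], of y0] by simp
      then have "(cmod ?w)\<^sup>2 = 4 * (offset n)\<^sup>2" by (metis norm_of_real norm_power abs_of_nonneg mult_nonneg_nonneg zero_le_numeral zero_le_power2)
      moreover have "(cmod ?w)\<^sup>2 \<le> (offset n)\<^sup>2"
        using mainC[OF y0(1)] by (intro power_mono) (auto simp: main_def)
      moreover have "(offset n)\<^sup>2 > 0" using offset_ge[of n] by simp
      ultimately show False by linarith
    qed
    then have "y0 = 0" by (simp add: orb_power epoch_exit_time)
    then show ?thesis using Cp C(2) y0(1) mainC R_eq by (intro exI[of _ C]) blast
  qed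
  have "connected R"
    unfolding connected_iff_connected_component
    using conn0 by (metis connected_component_def connected_component_sym connected_component_trans)
  then show ?case by (simp add: R_def)
qed

text \<open>The sets \<open>S i\<close> of points following the main pieces up to stage
  \<open>n + i\<close> are nested continua that contain both \<open>z\<close> and \<open>0\<close>;
  their intersection is connected and consists of non-escaping points.\<close>

lemma main_component_contains_0:
  assumes L: "L \<in> components (Filled (epoch n))" "z \<in> L" and z: "\<And>k. k \<ge> n \<Longrightarrow> main (epoch n) k z"
  shows "0 \<in> L"
proof -
  define S where "S i = {y. cmod (orb param (epoch n) (epoch (n + i)) y) \<le> 2 \<and> (\<forall>k\<in>{n..<n + i}. main (epoch n) k y)}" for i
  have escape: "cmod (orb param (epoch n) (epoch i) y) \<le> 2" if "n \<le> i" "i \<le> j" "cmod (orb param (epoch n) (epoch j) y) \<le> 2" for i j y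
    using escape_persists(2)[of "epoch n" i y j] epoch_mono[OF that(1)] that by force
  have "connected (\<Inter>(range S))"
  proof (rule connected_nest)
    show "connected (S i)" for i unfolding S_def by (rule connected_main_piece) simp
    show "S j \<subseteq> S i" if "i \<le> j" for i j
      using that escape[of "n + i" "n + j"] by (auto simp: S_def)
    show "compact (S i)" for i
    proof -
      have "S i = {y. cmod (orb param (epoch n) (epoch (n + i)) y) \<le> 2} \<inter> (\<Inter>k\<in>{n..<n + i}. {y. main (epoch n) k y})"
        by (auto simp: S_def)
      then have "closed (S i)"
        unfolding main_def
        by (auto intro!: closed_Int closed_INT closed_Collect_le continuous_intros continuous_on_orb)
      moreover have "S i \<subseteq> cball 0 2" using escape[of n "n + i"] by (auto simp: S_def)
      then have "bounded (S i)" using bounded_cball bounded_subset by blast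
      ultimately show ?thesis by (simp add: compact_eq_bounded_closed)
    qed
  qed
  moreover have "\<Inter>(range S) \<subseteq> Filled (epoch n)"
    unfolding Filled_def
  proof (clarify)
    fix y k assume "y \<in> \<Inter>(range S)" "epoch n \<le> epoch k"
    moreover have "n \<le> k" using \<open>epoch n \<le> epoch k\<close> epoch_less_iff[of k n] by simp
    ultimately have "y \<in> S (k - n)" by blast
    then show "cmod (orb param (epoch n) (epoch k) y) \<le> 2" using \<open>n \<le> k\<close> by (simp add: S_def)
  qed
  moreover have "z \<in> \<Inter>(range S)"
  proof -
    have "z \<in> Filled (epoch n)" using L in_components_subset by blast
    then have "cmod (orb param (epoch n) (epoch (n + i)) z) \<le> 2" for i
      using epoch_mono[of n "n + i"] by (simp add: Filled_def)
    then show ?thesis using z by (auto simp: S_def)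
  qed
  moreover have "0 \<in> \<Inter>(range S)"
  proof -
    have "orb param (epoch n) (epoch (n + i)) 0 = 0" for i
      using orb_center[OF epoch_mono[of n "n + i"]] by (simp add: center_epoch)
    moreover have "main (epoch n) k 0" if "k \<ge> n" for k
      using orb_center[of "epoch n" "exit_time k"] epoch_mono[OF that] epoch_exit_time(1)[of k] offset_ge[of k]
      by (simp add: main_def center_epoch)
    ultimately show ?thesis by (auto simp: S_def)
  qed
  ultimately show ?thesis using components_maximal[OF L(1), of "\<Inter>(range S)"] L(2) by blast
qed

text \<open>The component maps onto a whole component at epoch \<open>n\<close>, and that one
  contains \<open>0\<close>. This yields attracted points in the component and, as a polynomial has
  finitely many zeros, finiteness at each stage.\<close>

lemma component_contains_preimage_0:
  assumes L: "L \<in> components (Filled m)" "z \<in> L" and "m \<le> epoch n" and z: "\<And>k. k \<ge> n \<Longrightarrow> main m k z"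
  shows "\<exists>y\<in>L. orb param m (epoch n) y = 0"
proof -
  let ?p = "orb param m (epoch n)"
  have eq: "?p -` Filled (epoch n) = Filled m" using Filled_invariant[OF assms(3)] by blast
  have "?p ` L \<in> components (Filled (epoch n))"
    by (rule component_of_preimage_onto[OF continuous_on_orb open_orb_image])
       (use L(1) compact_Filled eq in simp_all)
  moreover have "main (epoch n) k (?p z)" if "k \<ge> n" for k
    using main_orb[OF assms(3), of k z] epoch_mono[OF that] epoch_exit_time(1)[of k] z[OF that] by simp
  ultimately have "0 \<in> ?p ` L" using main_component_contains_0[of "?p ` L" n "?p z"] L(2) by blast
  then show ?thesis by force
qed

lemma H_part_component_meets_Attracted:
  assumes L: "L \<in> components (Filled m)" "L \<inter> H_part m \<noteq> {}"
  shows "L \<inter> Attracted m \<noteq> {}"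
proof -
  obtain z k0 where z: "z \<in> L" "\<And>k. k \<ge> k0 \<Longrightarrow> main m k z" using L(2) by (auto simp: H_part_def)
  have m: "m \<le> epoch (max k0 m)" by (rule epoch_le_of_le) simp
  obtain y where y: "y \<in> L" "orb param m (epoch (max k0 m)) y = 0"
    using component_contains_preimage_0[OF L(1) z(1) m] z(2) by auto
  then have "y \<in> Attracted m" using m by (auto simp: Attracted_def intro!: exI[of _ "max k0 m"])
  then show ?thesis using y(1) by blast
qed

section \<open>Fatou components, frontier continua and density of both parts\<close>

text \<open>The plane without one point is connected and is not contained in the bounded set
  \<open>U\<close>, so it must contain a frontier point of \<open>U\<close>.\<close>

lemma two_points_frontier:
  fixes U :: "complex set"
  assumes "U \<noteq> {}" "open U" "bounded U"
  shows "\<exists>x\<in>frontier U. \<exists>y\<in>frontier U. x \<noteq> y"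
proof -
  have "frontier U \<noteq> {}" using assms frontier_not_empty not_bounded_UNIV by metis
  then obtain x where x: "x \<in> frontier U" by blast
  have "- {x} \<inter> frontier U \<noteq> {}"
  proof (rule connected_Int_frontier)
    show "connected (- {x})" by (rule connected_complement_bounded_convex) auto
    show "- {x} \<inter> U \<noteq> {}" using assms(1,2) x by (auto simp: frontier_def interior_open)
    show "- {x} - U \<noteq> {}"
    proof
      assume "- {x} - U = {}"
      then have "UNIV = insert x U" by blast
      then show False using assms(3) not_bounded_UNIV by (metis bounded_insert)
    qed
  qed
  then show ?thesis using x by blast
qed

text \<open>\<open>U\<close> is the component of the attracted set around a point of
  \<open>L\<close>. Its frontier stays in the closed set \<open>L\<close> but leaves the open
  attracted set, hence consists of Julia points of \<open>L\<close>.\<close>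

lemma H_part_component_fatou:
  assumes L: "L \<in> components (Filled m)" "L \<inter> H_part m \<noteq> {}"
  obtains U where "U \<noteq> {}" "open U" "bounded U" "U \<subseteq> L" "frontier U \<subseteq> frontier L"
    "Pt ` U \<in> components (fatou poly_seq m)"
proof -
  obtain y where y: "y \<in> L" "y \<in> Attracted m" using H_part_component_meets_Attracted[OF L] by blast
  then obtain U where U: "U \<in> components (Attracted m)" "y \<in> U" using Union_components by blast
  have Up: "open U" "connected U" "U \<subseteq> Attracted m"
    using open_components[OF open_Attracted U(1)] in_components_connected[OF U(1)] in_components_subset[OF U(1)] .
  have UL: "U \<subseteq> L"
    using components_maximal[OF L(1) Up(2)] Up(3) Attracted_subset_Filled[of m] U(2) y(1) by blast
  have cL: "compact L" using component_Filled(1)[OF L(1)] .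
  have "frontier U \<subseteq> L"
    using closure_minimal[OF UL compact_imp_closed[OF cL]] by (auto simp: frontier_def)
  moreover have "frontier U \<inter> Attracted m = {}"
    using frontier_of_components_subset[OF U(1)] open_Attracted[of m] by (auto simp: frontier_def interior_open)
  ultimately have "frontier U \<subseteq> frontier L"
    using component_Filled(3,5)[OF L(1)] by (auto simp: julia_plane_def)
  moreover have "bounded U" using UL cL compact_imp_bounded bounded_subset by blast
  moreover have "Pt ` U \<in> components (fatou poly_seq m)"
    unfolding fatou_eq
  proof (rule Pt_image_component[OF open_Attracted U(1)])
    show "open (- Pt ` Filled m)" by (intro open_Compl compact_imp_closed compact_Pt_image compact_Filled)
    show "Pt ` Attracted m \<inter> - Pt ` Filled m = {}" using Attracted_subset_Filled by blast
  qed
  ultimately show ?thesis using that U(2) Up(1) UL by blast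
qed

lemma H_part_component_continuum:
  assumes L: "L \<in> components (Filled m)" "L \<inter> H_part m \<noteq> {}"
  shows "compact (frontier L) \<and> connected (frontier L) \<and> (\<exists>x\<in>frontier L. \<exists>y\<in>frontier L. x \<noteq> y)"
proof -
  obtain U where "U \<noteq> {}" "open U" "bounded U" "frontier U \<subseteq> frontier L"
    using H_part_component_fatou[OF L] by metis
  then have "\<exists>x\<in>frontier L. \<exists>y\<in>frontier L. x \<noteq> y" using two_points_frontier[of U] by blast
  then show ?thesis
    using component_Filled(1,4)[OF L(1)] by (simp add: compact_frontier)
qed

text \<open>A frontier point of the component of \<open>0\<close> follows the main pieces because
  \<open>0\<close> does; it is then pulled back from \<open>epoch m\<close> to
  \<open>m\<close>.\<close>

lemma main_point_exists: "\<exists>z. z \<in> julia_plane m \<and> (\<forall>k\<ge>m. main m k z)"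
proof -
  have "0 \<in> Filled (epoch m)"
    using Attracted_subset_Filled[of "epoch m"] by (force simp: Attracted_def)
  then obtain L where L: "L \<in> components (Filled (epoch m))" "0 \<in> L" using Union_components by blast
  have "frontier L \<noteq> {}"
    using L(2) compact_imp_bounded[OF component_Filled(1)[OF L(1)]] not_bounded_UNIV
    by (metis empty_iff frontier_eq_empty)
  then obtain x where x: "x \<in> L" "x \<in> julia_plane (epoch m)" using component_Filled(5)[OF L(1)] by blast
  have mx: "main (epoch m) k x" if "k \<ge> m" for k
  proof (rule main_const_Filled[OF component_Filled(2,3)[OF L(1)] _ L(2) x(1)])
    show "epoch m \<le> exit_time k" using epoch_mono[OF that] epoch_exit_time(1)[of k] by simp
    then show "main (epoch m) k 0"
      using orb_center[of "epoch m" "exit_time k"] offset_ge[of k] by (simp add: main_def center_epoch)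
  qed
  obtain z where z: "orb param m (epoch m) z = x" using surj_orb by blast
  have "z \<in> julia_plane m" using julia_plane_invariant[OF epoch_ge_self[of m], of z] x(2) z by simp
  moreover have "main m k z" if "k \<ge> m" for k
    using main_orb[OF epoch_ge_self[of m], of k z] mx[OF that] z epoch_mono[OF that] epoch_exit_time(1)[of k] by simp
  ultimately show ?thesis by blast
qed

lemma H_part_nonempty: "H_part m \<noteq> {}"
  using main_point_exists[of m] unfolding H_part_def by blast

lemma julia_plane_nonempty: "julia_plane m \<noteq> {}"
  using H_part_nonempty H_part_subset(1) by blast

lemma julia_plane_ring: "\<zeta> \<in> julia_plane (epoch j) \<Longrightarrow> 1/4 \<le> cmod \<zeta> \<and> cmod \<zeta> \<le> 4"
  unfolding julia_plane_iff by (force dest: spec[of _ j])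

lemma closure_H_part: "closure (H_part m) = julia_plane m"
proof
  show "closure (H_part m) \<subseteq> julia_plane m"
    by (intro closure_minimal H_part_subset compact_imp_closed compact_julia_plane)
  show "julia_plane m \<subseteq> closure (H_part m)"
  proof (rule julia_plane_subset_closure_preimages[of 0])
    fix j assume j: "m \<le> epoch j"
    obtain \<zeta> where \<zeta>: "\<zeta> \<in> H_part (epoch j)" using H_part_nonempty by blast
    then have "orb param m (epoch j) -` {\<zeta>} \<subseteq> H_part m" using H_part_invariant[OF j] by auto
    then show "\<exists>\<zeta>. 1/4 \<le> cmod \<zeta> \<and> cmod \<zeta> \<le> 4 \<and> orb param m (epoch j) -` {\<zeta>} \<subseteq> H_part m"
      using julia_plane_ring[of \<zeta> j] \<zeta> H_part_subset(1) by blast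
  qed
qed

lemma exit_point_exists: "\<exists>\<zeta>\<in>julia_plane (epoch j). \<not> main (epoch j) j \<zeta>"
proof -
  obtain y where y: "y \<in> julia_plane (epoch (Suc j))" using julia_plane_nonempty by blast
  \<comment> \<open>The root of \<open>x * (x - 4t^2) = y\<close> given by the principal square
    root: its real part is at least \<open>2t^2\<close>, so a \<open>w\<close> with
    \<open>w^2 = x\<close> has modulus larger than \<open>t\<close>.\<close>
  define x where "x = of_real (2 * (offset j)\<^sup>2) + csqrt (of_real (4 * offset j ^ 4) + y)"
  have "x * (x - of_real (4 * (offset j)\<^sup>2)) = (x - of_real (2 * (offset j)\<^sup>2))\<^sup>2 - of_real (4 * offset j ^ 4)"
    by (simp add: power2_eq_square power4_eq_xxxx algebra_simps)
  also have "\<dots> = y" by (simp add: x_def)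
  finally have x: "x * (x - of_real (4 * (offset j)\<^sup>2)) = y" .
  have "Re x \<ge> 2 * (offset j)\<^sup>2" using csqrt_principal[of "of_real (4 * offset j ^ 4) + y"] by (auto simp: x_def)
  then have cx: "cmod x \<ge> 2 * (offset j)\<^sup>2" using complex_Re_le_cmod order_trans by blast
  obtain \<zeta> where \<zeta>: "orb param (epoch j) (exit_time j) \<zeta> = csqrt x" using surj_orb by blast
  have "orb param (epoch j) (epoch (Suc j)) \<zeta> = y"
    using orb_special(2)[OF epoch_exit_time(1), of j \<zeta>] \<zeta> x by simp
  then have "\<zeta> \<in> julia_plane (epoch j)" using julia_plane_invariant[of "epoch j" "epoch (Suc j)" \<zeta>] y epoch_mono[of j "Suc j"] by simp
  moreover have "\<not> main (epoch j) j \<zeta>"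
  proof
    assume "main (epoch j) j \<zeta>"
    then have "(cmod (csqrt x))\<^sup>2 \<le> (offset j)\<^sup>2" unfolding main_def \<zeta> by (intro power_mono) auto
    moreover have "(cmod (csqrt x))\<^sup>2 = cmod x" by (metis norm_power power2_csqrt)
    moreover have "(offset j)\<^sup>2 > 0" using offset_ge[of j] by simp
    ultimately show False using cx by linarith
  qed
  ultimately show ?thesis by blast
qed

text \<open>Baire's theorem: \<open>G_part\<close> is the intersection of the relatively open sets
  \<open>X k0\<close>, each of which is dense because it contains all preimages of a point about to
  leave the main piece.\<close>

lemma closure_G_part: "julia_plane m \<subseteq> closure (G_part m)"
proof -
  define X where "X = (\<lambda>k0. {z \<in> julia_plane m. \<exists>k\<ge>k0. \<not> main m k z})"
  have "julia_plane m \<subseteq> closure (\<Inter>(range X))"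
  proof (rule Baire)
    show "closed (julia_plane m)" by (rule compact_imp_closed[OF compact_julia_plane])
    fix S assume "S \<in> range X"
    then obtain k0 where S: "S = X k0" by blast
    have "X k0 = julia_plane m \<inter> (\<Union>k\<in>{k0..}. {z. offset k < cmod (orb param m (exit_time k) z)})"
      by (auto simp: X_def main_def not_le)
    moreover have "open (\<Union>k\<in>{k0..}. {z. offset k < cmod (orb param m (exit_time k) z)})"
      by (intro open_UN ballI open_Collect_less continuous_intros continuous_on_orb)
    ultimately have "openin (top_of_set (julia_plane m)) S" unfolding S by (metis openin_open_Int)
    moreover have "julia_plane m \<subseteq> closure S"
      unfolding S
    proof (rule julia_plane_subset_closure_preimages[of k0])
      fix j assume j: "k0 \<le> j" "m \<le> epoch j"
      obtain \<zeta> where \<zeta>: "\<zeta> \<in> julia_plane (epoch j)" "\<not> main (epoch j) j \<zeta>" using exit_point_exists by blast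
      have "orb param m (epoch j) -` {\<zeta>} \<subseteq> X k0"
      proof
        fix z assume z: "z \<in> orb param m (epoch j) -` {\<zeta>}"
        then have "z \<in> julia_plane m" using julia_plane_invariant[OF j(2)] \<zeta>(1) by auto
        moreover have "\<not> main m j z" using main_orb[OF j(2) epoch_exit_time(1), of z] \<zeta>(2) z by simp
        ultimately show "z \<in> X k0" using j(1) by (auto simp: X_def)
      qed
      then show "\<exists>\<zeta>. 1/4 \<le> cmod \<zeta> \<and> cmod \<zeta> \<le> 4 \<and> orb param m (epoch j) -` {\<zeta>} \<subseteq> X k0"
        using julia_plane_ring[OF \<zeta>(1)] by blast
    qed
    ultimately show "openin (top_of_set (julia_plane m)) S \<and> julia_plane m \<subseteq> closure S" by blast
  qed auto
  moreover have "\<Inter>(range X) = G_part m" by (auto simp: X_def G_part_def)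
  ultimately show ?thesis by simp
qed

lemma G_part_nonempty: "G_part m \<noteq> {}"
  using closure_G_part[of m] julia_plane_nonempty[of m] by force

section \<open>Thinness on \<open>G_part\<close> and its failure on \<open>H_part\<close>\<close>

text \<open>At \<open>exit_time k\<close> the Julia set misses the ring between radii
  \<open>1/t^3\<close> and 1 around \<open>s\<close>, which is \<open>2t\<close> or
  \<open>-2t\<close>. The disc of radius \<open>2t\<close> around \<open>s\<close> just avoids
  \<open>0\<close>, and escaping critical values are far beyond it, so the iterate has a univalent
  inverse there. That inverse is bounded by \<open>R\<close>, and the unit disc occupies only the
  fraction \<open>1/(2t)\<close> of the radius; hence the small diameter.\<close>

lemma separating_annulus:
  assumes z: "z \<in> julia_plane m" and k: "m \<le> k" "\<not> main m k z"
    and R: "R > 0" "\<forall>k x. m \<le> k \<longrightarrow> cmod (orb param m (epoch k) x) \<le> 2 \<longrightarrow> cmod x \<le> R"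
  obtains A where "conformal_annulus A" "has_modulus A (ln (offset k ^ 3))" "separates_set A (julia_plane m)"
    "\<exists>B\<in>components (- A). bounded B \<and> z \<in> B" "bounded A" "diameter A \<le> 3 * R / offset k"
proof -
  have m_le: "m \<le> epoch k" and mtau: "m \<le> exit_time k" using epoch_le_of_le[OF k(1)] exit_time_ge[OF k(1)] .
  have tk: "offset k \<ge> 16" by (rule offset_ge)
  have t3: "offset k ^ 3 \<ge> 16" using tk offset_powers(1,2)[of k] by linarith
  then have r: "0 < 1 / offset k ^ 3" "1 / offset k ^ 3 < 1" using tk by (auto simp: divide_less_eq)
  define w where "w = orb param m (exit_time k) z"
  have gap: "cmod (orb param m (exit_time k) x - of_real (2 * offset k)) \<le> 1 / offset k ^ 3 \<or>
      cmod (orb param m (exit_time k) x + of_real (2 * offset k)) \<le> 1 / offset k ^ 3"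
    if "x \<in> julia_plane m" "\<not> main m k x" for x
    using that mtau epoch_exit_time(3)[of k] by (intro main_gap(2)) (auto simp: julia_plane_iff)
  obtain \<sigma> :: real where \<sigma>: "\<sigma> = 1 \<or> \<sigma> = -1" "cmod (w - of_real (2 * \<sigma> * offset k)) \<le> 1 / offset k ^ 3"
    using gap[OF z k(2)] that[of 1] that[of "-1"] unfolding w_def by fastforce
  define s :: complex where "s = of_real (2 * \<sigma> * offset k)"
  have s: "cmod s = 2 * offset k" using \<sigma>(1) tk by (auto simp: s_def norm_mult)
  have ws: "cmod (w - s) \<le> 1 / offset k ^ 3" using \<sigma>(2) by (simp add: s_def)
  have gap': "cmod (orb param m (exit_time k) x - s) \<le> 1 / offset k ^ 3 \<or> cmod (orb param m (exit_time k) x + s) \<le> 1 / offset k ^ 3"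
    if "x \<in> julia_plane m" "\<not> main m k x" for x
    using gap[OF that] \<sigma>(1) by (auto simp: s_def)
  have large: "cmod u < 4 * offset k" if "u \<in> ball s (2 * offset k)" for u
    using that s norm_triangle_ineq2[of u s] by (auto simp: dist_norm norm_minus_commute)
  have big: "8 * offset k ^ 4 \<ge> 4 * offset k" using offset_powers[of k] tk by linarith
  have avoid: "orb param i (exit_time k) (param i) \<notin> id ` ball s (2 * offset k)" if i: "m < i" "i \<le> exit_time k" for i
  proof (cases "i \<in> range epoch")
    case False
    then have "orb param i (exit_time k) (param i) = 0" using orb_center[OF i(2)] by (simp add: param_center center_epoch)
    then show ?thesis using s by (simp add: dist_norm)
  next
    case True
    then obtain l where l: "i = epoch l" by blast
    then have "l \<le> k" using i(2) epoch_exit_time(2)[of k] epoch_less_iff[of l "Suc k"] by simp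
    have "cmod (param (epoch l)) = 4 * real (epoch l) ^ 4" by (simp add: param_def norm_mult norm_power)
    moreover have "real (epoch l) ^ 4 \<ge> 1" using epoch_ge(1)[of l] by (intro one_le_power) simp
    ultimately have "cmod (orb param i (epoch l) (param i)) > 2" using l by simp
    then have "cmod (orb param i (epoch k) (param i)) > 2"
      using escape_persists(2)[of i l "param i" k] l \<open>l \<le> k\<close> by simp
    then have "cmod (orb param (epoch k) (exit_time k) (orb param i (epoch k) (param i))) \<ge> 8 * offset k ^ 4" by (rule escape_step(1))
    then have "cmod (orb param i (exit_time k) (param i)) \<ge> 8 * offset k ^ 4"
      using epoch_mono[OF \<open>l \<le> k\<close>] l epoch_exit_time(1)[of k] by (simp add: orb_trans)
    then show ?thesis using large big by force
  qed
  have w_in: "w \<in> ball s (2 * offset k)" "w \<in> cball s (1 / offset k ^ 3)" 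
  proof -
    have "cmod (w - s) < 2 * offset k" using ws r(2) tk by linarith
    then show "w \<in> ball s (2 * offset k)" "w \<in> cball s (1 / offset k ^ 3)"
      using ws by (auto simp: dist_norm norm_minus_commute)
  qed
  obtain G where G: "G holomorphic_on ball s (2 * offset k)" "G w = z"
    "\<And>u. u \<in> ball s (2 * offset k) \<Longrightarrow> orb param m (exit_time k) (G u) = u"
    using orb_lift[OF mtau convex_imp_contractible[OF convex_ball] holomorphic_on_id w_in(1), of param z] avoid
    by (auto simp: w_def)
  have inj: "inj_on G (ball s (2 * offset k))" using G(3) by (metis inj_onI)
  have GR: "cmod (G u) \<le> R" if "u \<in> ball s (2 * offset k)" for u
  proof (rule R(2)[rule_format, OF k(1)], rule ccontr)
    assume "\<not> cmod (orb param m (epoch k) (G u)) \<le> 2"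
    then have "cmod (orb param (epoch k) (exit_time k) (orb param m (epoch k) (G u))) \<ge> 8 * offset k ^ 4"
      by (intro escape_step(1)) simp
    then have "cmod u \<ge> 8 * offset k ^ 4" using G(3)[OF that] m_le epoch_exit_time(1)[of k] by (simp add: orb_trans)
    then show False using large[OF that] big by linarith
  qed
  define A where "A = G ` ann s (1 / offset k ^ 3) 1"
  have "1 < 2 * offset k" using tk by simp
  note univ = conformal_annulus_univalent_image[OF G(1) inj r this, folded A_def]
  have sub1: "u \<in> ball s (2 * offset k)" if "u \<in> ball s 1" for u using that tk by auto
  have comps: "components (- A) = {G ` cball s (1 / offset k ^ 3), - G ` ball s 1}" by (rule univ(4))
  have zB: "z \<in> G ` cball s (1 / offset k ^ 3)" using G(2) w_in(2) by blast
  have "G ` cball s (1 / offset k ^ 3) \<subseteq> G ` ball s 1" using r(2) by (intro image_mono) (meson le_less_trans mem_ball mem_cball subsetI)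
  then have bB: "bounded (G ` cball s (1 / offset k ^ 3))" using univ(3) bounded_subset by blast
  have "A \<subseteq> G ` ball s 1"
    unfolding A_def by (intro image_mono) (auto simp: dist_norm norm_minus_commute)
  then have bA: "bounded A" using univ(3) bounded_subset by blast
  have far: "cmod (u + s) > 1" if "cmod (u - s) < 1" for u
  proof -
    have "cmod (2 * s) \<le> cmod (u + s) + cmod (u - s)"
      using norm_triangle_ineq4[of "u + s" "u - s"] by simp
    then show ?thesis using that s tk by (simp add: norm_mult)
  qed
  have disj: "julia_plane m \<inter> A = {}"
  proof -
    have False if x: "x \<in> julia_plane m" "x \<in> A" for x
    proof -
      obtain u where u: "x = G u" "1 / offset k ^ 3 < cmod (u - s)" "cmod (u - s) < 1"
        using x(2) by (auto simp: A_def)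
      have ou: "orb param m (exit_time k) x = u"
        using G(3)[OF sub1] u by (simp add: dist_norm norm_minus_commute)
      have "cmod u \<ge> 2 * offset k - 1" using u(3) s norm_triangle_ineq2[of s "s - u"] by (simp add: norm_minus_commute)
      then have "\<not> main m k x" using ou tk by (simp add: main_def)
      then show False using gap'[OF x(1)] ou u far[OF u(3)] r by auto
    qed
    then show ?thesis by blast
  qed
  have "\<exists>y\<in>julia_plane m. y \<notin> G ` ball s 1"
  proof -
    \<comment> \<open>The double step is even, so \<open>-w\<close> has the same future as
      \<open>w\<close>; its preimage is a Julia point on the outer side of the annulus.\<close>
    obtain y where y: "orb param m (exit_time k) y = - w" using surj_orb by blast
    have "orb param m (epoch (Suc k)) y = orb param m (epoch (Suc k)) z"
      using orb_special(2)[OF mtau] y by (simp add: w_def)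
    moreover have "m \<le> epoch (Suc k)" using mtau epoch_exit_time(3)[of k] by simp
    ultimately have "y \<in> julia_plane m" using z julia_plane_invariant by metis
    moreover have "y \<notin> G ` ball s 1"
    proof
      assume "y \<in> G ` ball s 1"
      then obtain u where u: "u \<in> ball s 1" "y = G u" by blast
      then have "u = - w" using G(3)[OF sub1[OF u(1)]] y by simp
      then have "cmod (- w - s) < 1" using u(1) by (simp add: dist_norm norm_minus_commute)
      moreover have "cmod (w + s) > 1" using far[of w] ws r by linarith
      moreover have "cmod (- w - s) = cmod (w + s)" by (metis add_uminus_conv_diff minus_add_distrib norm_minus_cancel)
      ultimately show False by linarith
    qed
    ultimately show ?thesis by blast
  qed
  then have "separates_set A (julia_plane m)"
    unfolding separates_set_def comps using disj z zB by blast
  moreover have "diameter A \<le> 3 * R / offset k"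
  proof (rule diameter_le)
    have near: "cmod (G u - G s) \<le> 3 * R / (2 * offset k)" if "u \<in> ball s 1" for u
    proof -
      have "cmod (G u - G s) \<le> 3 * R * cmod (u - s) / (2 * offset k)"
        using GR R(1) tk sub1[OF that] G(1) by (intro holomorphic_oscillation) auto
      also have "\<dots> \<le> 3 * R * 1 / (2 * offset k)"
        using that R(1) tk by (intro divide_right_mono mult_left_mono) (auto simp: dist_norm norm_minus_commute)
      finally show ?thesis by simp
    qed
    fix x y assume "x \<in> A" "y \<in> A"
    then obtain u v where uv: "u \<in> ball s 1" "x = G u" "v \<in> ball s 1" "y = G v"
      using \<open>A \<subseteq> G ` ball s 1\<close> by blast
    have "cmod (x - y) \<le> cmod (G u - G s) + cmod (G v - G s)"
      using norm_triangle_ineq4[of "G u - G s" "G v - G s"] uv by simp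
    also have "\<dots> \<le> 3 * R / (2 * offset k) + 3 * R / (2 * offset k)" using near uv by (intro add_mono) auto
    also have "\<dots> = 3 * R / offset k" using tk by (simp add: field_simps)
    finally show "cmod (x - y) \<le> 3 * R / offset k" .
  qed (use R(1) tk in auto)
  moreover have "has_modulus A (ln (offset k ^ 3))" using univ(2) by simp
  moreover have "\<exists>B\<in>components (- A). bounded B \<and> z \<in> B" using comps zB bB by blast
  ultimately show ?thesis using that univ(1) bA by blast
qed

lemma thin_at_G_part:
  assumes z: "z \<in> G_part m"
  shows "pointwise_thin_at (julia_plane m) z"
proof -
  obtain R where R: "R > 0" "\<forall>k x. m \<le> k \<longrightarrow> cmod (orb param m (epoch k) x) \<le> 2 \<longrightarrow> cmod x \<le> R"
    using small_orbit_bound by metis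
  have zJ: "z \<in> julia_plane m" using z by (simp add: G_part_def)
  have "\<exists>k. max n m \<le> k \<and> \<not> main m k z" for n
    using z unfolding G_part_def by blast
  then obtain k where k: "\<And>n. max n m \<le> k n" "\<And>n. \<not> main m (k n) z" by metis
  have "\<exists>A. conformal_annulus A \<and> has_modulus A (ln (offset (k n) ^ 3)) \<and> separates_set A (julia_plane m) \<and>
     (\<exists>B\<in>components (- A). bounded B \<and> z \<in> B) \<and> bounded A \<and> diameter A \<le> 3 * R / offset (k n)" for n
  proof -
    have "m \<le> k n" using k(1)[of n] by simp
    from separating_annulus[OF zJ this k(2) R] show ?thesis by blast
  qed
  then obtain A where A: "\<And>n. conformal_annulus (A n) \<and> has_modulus (A n) (ln (offset (k n) ^ 3)) \<and> separates_set (A n) (julia_plane m) \<and>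
     (\<exists>B\<in>components (- A n). bounded B \<and> z \<in> B) \<and> bounded (A n) \<and> diameter (A n) \<le> 3 * R / offset (k n)"
    by metis
  have tn: "offset (k n) \<ge> real n + 1" for n
  proof -
    have "n < epoch (Suc (k n))" using epoch_ge(2)[of "Suc (k n)"] k(1)[of n] by simp
    then show ?thesis by (simp add: offset_def)
  qed
  show ?thesis
    unfolding pointwise_thin_at_def
  proof (intro conjI exI allI)
    show "filterlim (\<lambda>n. ln (offset (k n) ^ 3)) at_top sequentially"
    proof (rule filterlim_at_top_mono)
      show "filterlim (\<lambda>n. ln (real n + 1)) at_top sequentially" by real_asymp
      show "\<forall>\<^sub>F n in sequentially. ln (real n + 1) \<le> ln (offset (k n) ^ 3)"
      proof (intro always_eventually allI)
        fix n
        have "offset (k n) ^ 1 \<le> offset (k n) ^ 3" using offset_ge[of "k n"] by (intro power_increasing) auto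
        then have "real n + 1 \<le> offset (k n) ^ 3" using tn[of n] by simp
        then show "ln (real n + 1) \<le> ln (offset (k n) ^ 3)" 
          using offset_ge[of "k n"] by (subst ln_le_cancel_iff) auto
      qed
    qed
    show "(\<lambda>n. diameter (A n)) \<longlonglongrightarrow> 0"
    proof (rule tendsto_sandwich)
      show "\<forall>\<^sub>F n in sequentially. 0 \<le> diameter (A n)"
        using A by (intro always_eventually allI diameter_ge_0) blast
      show "\<forall>\<^sub>F n in sequentially. diameter (A n) \<le> 3 * R / (real n + 1)"
      proof (intro always_eventually allI)
        fix n
        have "diameter (A n) \<le> 3 * R / offset (k n)" using A by blast
        also have "\<dots> \<le> 3 * R / (real n + 1)" using R(1) tn[of n] by (intro divide_left_mono) auto
        finally show "diameter (A n) \<le> 3 * R / (real n + 1)" .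
      qed
      show "(\<lambda>n. 3 * R / (real n + 1)) \<longlonglongrightarrow> 0" by real_asymp
    qed auto
  qed (use A zJ in auto)
qed

text \<open>\<open>K\<close> cannot cross a separating annulus, so it lies in the same bounded
  complementary component as \<open>z\<close>, and the diameter of the annulus is at least
  \<open>dist a b\<close>.\<close>

lemma not_thin_at_continuum:
  assumes K: "connected K" "K \<subseteq> E" "a \<in> K" "b \<in> K" "a \<noteq> b" "z \<in> K"
  shows "\<not> pointwise_thin_at E z"
proof
  assume "pointwise_thin_at E z"
  then obtain A :: "nat \<Rightarrow> complex set" where A: "\<And>n. separates_set (A n) E"
    "\<And>n. \<exists>B\<in>components (- A n). bounded B \<and> z \<in> B" "\<And>n. bounded (A n)"
    "(\<lambda>n. diameter (A n)) \<longlonglongrightarrow> 0"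
    unfolding pointwise_thin_at_def by auto
  have "dist a b \<le> diameter (A n)" for n
  proof -
    obtain B where B: "B \<in> components (- A n)" "bounded B" "z \<in> B" using A(2) by blast
    have "K \<subseteq> - A n" using A(1)[of n] K(2) by (auto simp: separates_set_def)
    then have "K \<subseteq> B" using components_maximal[OF B(1) K(1)] B(3) K(6) by blast
    then show ?thesis using dist_le_diameter_bounded_component[OF A(3) B(1,2)] K(3,4) by blast
  qed
  then have "dist a b \<le> 0" using A(4) by (intro LIMSEQ_le_const) auto
  then show False using K(5) by simp
qed

lemma H_part_component_through:
  assumes "z \<in> H_part m"
  obtains L where "L \<in> components (Filled m)" "z \<in> frontier L" "L \<inter> H_part m \<noteq> {}"
proof -
  have "z \<in> Filled m" using assms H_part_subset by blast
  then obtain L where L: "L \<in> components (Filled m)" "z \<in> L" using Union_components by blast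
  then show ?thesis using that component_Filled(5)[OF L(1)] assms H_part_subset(1) by blast
qed

lemma thin_part_julia_plane: "thin_part (julia_plane m) = G_part m"
proof -
  have "\<not> pointwise_thin_at (julia_plane m) z" if zH: "z \<in> H_part m" for z
  proof -
    obtain L where L: "L \<in> components (Filled m)" "z \<in> frontier L" "L \<inter> H_part m \<noteq> {}"
      using H_part_component_through[OF zH] by blast
    then obtain a b where "a \<in> frontier L" "b \<in> frontier L" "a \<noteq> b"
      using H_part_component_continuum by blast
    then show ?thesis
      using component_Filled(4,5)[OF L(1)] L(2) by (intro not_thin_at_continuum[of "frontier L" _ a b]) auto
  qed
  then show ?thesis using thin_at_G_part G_part_Un_H_part unfolding thin_part_def by blast
qed

text \<open>Both complementary components are closed. If \<open>F\<close> missed one of them, it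
  would lie in the other, and so would \<open>E\<close> by density.\<close>

lemma separates_dense_subset:
  assumes A: "separates_set A E" "conformal_annulus A" and F: "F \<subseteq> E" "E \<subseteq> closure F"
  shows "separates_set A F"
  unfolding separates_set_def
proof (intro conjI ballI)
  show "F \<inter> A = {}" using A(1) F(1) by (auto simp: separates_set_def)
  fix B assume B: "B \<in> components (- A)"
  have clA: "closed (- A)" and card: "card (components (- A)) = 2"
    using A(2) by (auto simp: conformal_annulus_def)
  obtain B1 B2 where B12: "components (- A) = {B1, B2}" "B1 \<noteq> B2" using card by (auto simp: card_2_iff)
  have "\<exists>B'. components (- A) = {B, B'} \<and> B \<noteq> B'"
  proof (cases "B = B1")
    case True
    then show ?thesis using B12 by blast
  next
    case False
    then have "B = B2" using B B12 by blast
    then show ?thesis using B12 by (intro exI[of _ B1]) auto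
  qed
  then obtain B' where B': "components (- A) = {B, B'}" "B \<noteq> B'" by blast
  have "B' \<in> components (- A)" using B' by blast
  then have "closed B'" using closed_components[OF clA] by blast
  obtain x where x: "x \<in> E" "x \<in> B" using A(1) B unfolding separates_set_def by blast
  have "B \<inter> B' = {}" using components_nonoverlap[OF B \<open>B' \<in> components (- A)\<close>] B'(2) by blast
  then have "x \<in> - B'" using x by blast
  then have "F \<inter> - B' \<noteq> {}"
    using F(2) x(1) \<open>closed B'\<close> by (metis closure_iff_nhds_not_empty open_Compl order_refl subsetD)
  moreover have "F \<subseteq> B \<union> B'"
  proof -
    have "- A = B \<union> B'" using Union_components[of "- A"] B'(1) by auto
    then show ?thesis using \<open>F \<inter> A = {}\<close> by blast
  qed
  ultimately show "F \<inter> B \<noteq> {}" by blast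
qed

lemma pointwise_thin_dense_subset:
  assumes "pointwise_thin_at E z" "z \<in> F" "F \<subseteq> E" "E \<subseteq> closure F"
  shows "pointwise_thin_at F z"
  using assms separates_dense_subset[OF _ _ assms(3,4)] unfolding pointwise_thin_at_def by meson

lemma not_uniformly_perfect_if_thin:
  assumes "pointwise_thin_at E z"
  shows "\<not> uniformly_perfect E"
proof
  assume "uniformly_perfect E"
  then obtain M where M: "\<And>A \<mu>. conformal_annulus A \<and> separates_set A E \<and> has_modulus A \<mu> \<Longrightarrow> \<mu> \<le> M"
    unfolding uniformly_perfect_def by blast
  obtain A \<mu> where A: "\<And>n::nat. conformal_annulus (A n) \<and> has_modulus (A n) (\<mu> n) \<and> separates_set (A n) E"
    "filterlim \<mu> at_top sequentially"
    using assms unfolding pointwise_thin_at_def by blast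
  have "\<forall>\<^sub>F n in sequentially. M + 1 \<le> \<mu> n" using A(2) by (simp add: filterlim_at_top)
  then obtain n where "M + 1 \<le> \<mu> n" using eventually_sequentially by auto
  then show False using M[of "A n" "\<mu> n"] A(1)[of n] by auto
qed

section \<open>The uniformly perfect pieces of \<open>H_part\<close> and the number of its
  components\<close>

text \<open>Each component of the non-escaping set that meets \<open>E\<close> contains a zero of
  the iterate from \<open>m\<close> to \<open>epoch (m + n)\<close>, so there are finitely many, and
  \<open>E\<close> is the union of their frontiers. Starting at \<open>m + n\<close> guarantees
  \<open>m \<le> exit_time k\<close>.\<close>

lemma main_from_stage:
  fixes m n :: nat
  defines "E \<equiv> {z \<in> julia_plane m. \<forall>k\<ge>m + n. main m k z}"
  shows "closed E" "uniformly_perfect E"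
proof -
  have "E = julia_plane m \<inter> (\<Inter>k\<in>{m + n..}. {z. main m k z})" by (auto simp: E_def)
  moreover have "closed (\<Inter>k\<in>{m + n..}. {z. main m k z})"
    unfolding main_def by (auto intro!: closed_INT closed_Collect_le continuous_intros continuous_on_orb)
  ultimately show "closed E" using compact_imp_closed[OF compact_julia_plane] by (simp add: closed_Int)
  define \<L> where "\<L> = {L \<in> components (Filled m). L \<inter> E \<noteq> {}}"
  have EH: "E \<subseteq> H_part m" by (auto simp: E_def H_part_def)
  have m_le: "m \<le> epoch (m + n)" by (rule epoch_le_of_le) simp
  have "\<exists>y\<in>L. y \<in> orb param m (epoch (m + n)) -` {0}" if "L \<in> \<L>" for L
    using component_contains_preimage_0[of L m _ "m + n"] that m_le by (force simp: \<L>_def E_def)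
  moreover have "L = connected_component_set (Filled m) y" if "L \<in> \<L>" "y \<in> L" for L y
  proof -
    obtain x where "L = connected_component_set (Filled m) x"
      using \<open>L \<in> \<L>\<close> unfolding \<L>_def components_def by blast
    then show ?thesis using connected_component_eq[of y "Filled m" x] \<open>y \<in> L\<close> by simp
  qed
  ultimately have "\<L> \<subseteq> (\<lambda>y. connected_component_set (Filled m) y) ` (orb param m (epoch (m + n)) -` {0})"
    by blast
  then have fin: "finite \<L>" by (rule finite_subset) (intro finite_imageI finite_orb_vimage)
  have LH: "L \<in> components (Filled m)" "L \<inter> H_part m \<noteq> {}" if "L \<in> \<L>" for L
    using that EH by (auto simp: \<L>_def)
  have "E = \<Union>(frontier ` \<L>)"
  proof (intro equalityI subsetI)
    fix z assume z: "z \<in> E"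
    then obtain L where L: "L \<in> components (Filled m)" "z \<in> frontier L"
      using H_part_component_through[of z m] EH by blast
    moreover have "z \<in> L" using component_Filled(5)[OF L(1)] L(2) by blast
    ultimately show "z \<in> \<Union>(frontier ` \<L>)" using z by (auto simp: \<L>_def)
  next
    fix z assume "z \<in> \<Union>(frontier ` \<L>)"
    then obtain L where L: "L \<in> \<L>" "z \<in> frontier L" by blast
    then have zL: "z \<in> L" "z \<in> julia_plane m" using component_Filled(5)[OF LH(1)[OF L(1)]] by auto
    obtain x where x: "x \<in> L" "x \<in> E" using L(1) by (auto simp: \<L>_def)
    have "main m k z" if "k \<ge> m + n" for k
      using main_const_Filled[OF component_Filled(2,3)[OF LH(1)[OF L(1)]] exit_time_ge[of m k] x(1) zL(1)] x(2) that
      by (simp add: E_def)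
    then show "z \<in> E" using zL(2) by (simp add: E_def)
  qed
  moreover have "E \<noteq> {}" using main_point_exists[of m] by (auto simp: E_def)
  then have "\<L> \<noteq> {}" using calculation by blast
  moreover have "uniformly_perfect (\<Union>(frontier ` \<L>))"
  proof (rule uniformly_perfect_finite_Union_continua)
    fix C assume "C \<in> frontier ` \<L>"
    then obtain L where L: "L \<in> \<L>" "C = frontier L" by blast
    show "compact C \<and> connected C \<and> (\<exists>x\<in>C. \<exists>y\<in>C. x \<noteq> y)"
      unfolding L(2) by (rule H_part_component_continuum[OF LH[OF L(1)]])
  qed (use fin \<open>\<L> \<noteq> {}\<close> in auto)
  ultimately show "uniformly_perfect E" by simp
qed

lemma H_part_eq_UN: "H_part m = (\<Union>n. {z \<in> julia_plane m. \<forall>k\<ge>m + n. main m k z})"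
proof (intro equalityI subsetI)
  fix z assume "z \<in> H_part m"
  then obtain k0 where "z \<in> julia_plane m" "\<forall>k\<ge>k0. main m k z" by (auto simp: H_part_def)
  then have "z \<in> {z \<in> julia_plane m. \<forall>k\<ge>m + k0. main m k z}" by auto
  then show "z \<in> (\<Union>n. {z \<in> julia_plane m. \<forall>k\<ge>m + n. main m k z})" by blast
qed (auto simp: H_part_def)

lemma fsigma_H_part: "fsigma_in (top_of_set (julia_plane m)) (H_part m)"
  unfolding fsigma_in_ascending
proof (intro exI conjI allI)
  let ?E = "\<lambda>n. {z \<in> julia_plane m. \<forall>k\<ge>m + n. main m k z}"
  show "closedin (top_of_set (julia_plane m)) (?E n)" for n
    by (rule closed_subset) (use main_from_stage(1) in auto)
  show "?E n \<subseteq> ?E (Suc n)" for n by auto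
  show "\<Union>(range ?E) = H_part m" by (simp add: H_part_eq_UN)
qed

lemma gdelta_G_part: "gdelta_in (top_of_set (julia_plane m)) (G_part m)"
  unfolding gdelta_in_fsigma_in
proof
  have "julia_plane m - G_part m = H_part m" using G_part_Un_H_part by blast
  then show "fsigma_in (top_of_set (julia_plane m)) (topspace (top_of_set (julia_plane m)) - G_part m)"
    using fsigma_H_part by simp
qed (use G_part_Un_H_part in simp)

text \<open>The components of the non-escaping set involved have disjoint, non-empty interiors, each
  containing a Fatou component.\<close>

lemma countable_components_H_part: "countable (components (H_part m))"
proof -
  define \<L> where "\<L> = {L \<in> components (Filled m). L \<inter> H_part m \<noteq> {}}"
  have int: "interior L \<noteq> {}" if "L \<in> \<L>" for L
  proof -
    have L: "L \<in> components (Filled m)" "L \<inter> H_part m \<noteq> {}" using \<open>L \<in> \<L>\<close> by (auto simp: \<L>_def)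
    obtain U where "U \<noteq> {}" "open U" "U \<subseteq> L" by (rule H_part_component_fatou[OF L])
    then show ?thesis using interior_maximal[of U L] by blast
  qed
  have disj: "L = L'" if "L \<in> \<L>" "L' \<in> \<L>" "interior L \<inter> interior L' \<noteq> {}" for L L'
  proof -
    have "L \<inter> L' \<noteq> {}" using that(3) interior_subset by blast
    then show ?thesis using components_nonoverlap[of L "Filled m" L'] that(1,2) by (auto simp: \<L>_def)
  qed
  have "countable (interior ` \<L>)"
    by (rule countable_disjoint_open_subsets) (use disj in \<open>auto simp: pairwise_def disjnt_def\<close>)
  moreover have "inj_on interior \<L>" using disj int by (metis inf.idem inj_onI)
  ultimately have "countable \<L>" by (rule countable_image_inj_on)
  then show ?thesis unfolding components_H_part \<L>_def by (rule countable_image)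
qed

text \<open>Finitely many compact components would make \<open>H_part\<close> closed, hence by
  density all of the Julia set, leaving \<open>G_part\<close> empty.\<close>

lemma infinite_components_H_part: "infinite (components (H_part m))"
proof
  assume fin: "finite (components (H_part m))"
  have "compact K" if "K \<in> components (H_part m)" for K
    using that H_part_component_continuum unfolding components_H_part by blast
  then have "compact (\<Union>(components (H_part m)))" using fin by (intro compact_Union) auto
  then have "closed (H_part m)" by (simp add: compact_imp_closed)
  then have "H_part m = julia_plane m" using closure_H_part[of m] by (simp add: closure_closed)
  then show False using G_part_nonempty[of m] G_part_eq[of m] by blast
qed

section \<open>Invariance, unboundedness and the conclusion\<close>

lemma poly_poly_seq: "poly (poly_seq (Suc m)) z = orb param m (Suc m) z"
  by (simp add: orb_Suc power2_eq_square)

lemma completely_invariant_if_orb_invariant: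
  assumes "\<And>m z. orb param m (Suc m) z \<in> X (Suc m) \<longleftrightarrow> z \<in> X m"
  shows "completely_invariant poly_seq X"
  unfolding completely_invariant_def forward_invariant_def backward_invariant_def
proof (intro conjI allI equalityI subsetI)
  fix m w assume w: "w \<in> X (Suc m)"
  obtain z where "orb param m (Suc m) z = w" using surj_orb by blast
  then show "w \<in> poly (poly_seq (Suc m)) ` X m" using w assms poly_poly_seq by (metis image_eqI)
next
  fix m w assume "w \<in> poly (poly_seq (Suc m)) ` X m"
  then obtain z where "w = poly (poly_seq (Suc m)) z" "z \<in> X m" by blast
  then show "w \<in> X (Suc m)" using assms poly_poly_seq by metis
next
  fix m z assume "z \<in> poly (poly_seq (Suc m)) -` X (Suc m)"
  then have "poly (poly_seq (Suc m)) z \<in> X (Suc m)" by (rule vimageD)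
  then show "z \<in> X m" using assms poly_poly_seq by metis
next
  fix m z assume "z \<in> X m"
  then have "poly (poly_seq (Suc m)) z \<in> X (Suc m)" using assms poly_poly_seq by metis
  then show "z \<in> poly (poly_seq (Suc m)) -` X (Suc m)" by (rule vimageI2)
qed

lemma unbounded_poly_seq: "\<not> bounded_poly_seq poly_seq"
proof
  assume "bounded_poly_seq poly_seq"
  then obtain M where M: "\<And>m. m \<ge> 1 \<Longrightarrow> \<forall>k<degree (poly_seq m). cmod (coeff (poly_seq m) k) \<le> M"
    unfolding bounded_poly_seq_def by metis
  have c: "cmod (param m) \<le> M" if "m \<ge> 1" for m
    using M[OF that] by auto
  obtain n :: nat where n: "real n > M" using reals_Archimedean2 by blast
  have "cmod (param (epoch n)) = 4 * real (epoch n) ^ 4" by (simp add: param_def norm_mult norm_power)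
  moreover have "real (epoch n) ^ 4 \<ge> real (epoch n) ^ 1" using epoch_ge(1)[of n] by (intro power_increasing) auto
  moreover have "real (epoch n) > M" using n epoch_ge(2)[of n] by linarith
  ultimately have "cmod (param (epoch n)) > M" unfolding power_one_right by linarith
  then show False using c[of "epoch n"] epoch_ge(1)[of n] by simp
qed

theorem theorem1p7:
  "\<exists>(c :: nat \<Rightarrow> complex) (G :: nat \<Rightarrow> complex set) (H :: nat \<Rightarrow> complex set).
     let P = (\<lambda>m. [:c m, 0, 1:]);
         J = (\<lambda>m. {z. Pt z \<in> julia P m})
     in \<not> bounded_poly_seq P \<and>
        (\<forall>m. Infty \<notin> julia P m \<and> compact (J m) \<and>
             \<not> uniformly_perfect (J m) \<and> \<not> hnup (J m) \<and>
             J m = G m \<union> H m) \<and>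
        \<comment> \<open>1\<close>
        (\<forall>m. G m \<inter> H m = {} \<and> G m \<noteq> {} \<and> H m \<noteq> {}) \<and>
        completely_invariant P G \<and> completely_invariant P H \<and>
        \<comment> \<open>2\<close>
        (\<forall>m. J m \<subseteq> closure (G m) \<and> gdelta_in (top_of_set (J m)) (G m) \<and>
             thin_part (J m) = G m \<and> pointwise_thin (G m)) \<and>
        \<comment> \<open>3\<close>
        (\<forall>m. J m \<subseteq> closure (H m) \<and> fsigma_in (top_of_set (J m)) (H m) \<and>
             (\<exists>E :: nat \<Rightarrow> complex set. incseq E \<and>
                (\<forall>n. closed (E n) \<and> uniformly_perfect (E n)) \<and> H m = (\<Union>n. E n))) \<and>
        \<comment> \<open>4\<close>
        (\<forall>m. closure (H m) = J m \<and> \<not> uniformly_perfect (closure (H m))) \<and>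
        \<comment> \<open>5\<close>
        (\<forall>m. countable (components (H m)) \<and> infinite (components (H m)) \<and>
             (\<forall>K \<in> components (H m).
                (\<exists>U. Pt ` U \<in> components (fatou P m) \<and> bounded U \<and> frontier U \<subseteq> K) \<and>
                uniformly_perfect K))"
proof -
  have J: "{z. Pt z \<in> julia poly_seq m} = julia_plane m" for m by (auto simp: julia_eq)
  have inf: "Infty \<notin> julia poly_seq m" for m by (auto simp: julia_eq)
  have nup: "\<not> uniformly_perfect (julia_plane m)" for m
    using G_part_nonempty[of m] thin_at_G_part not_uniformly_perfect_if_thin by blast
  have E: "\<exists>E :: nat \<Rightarrow> complex set. incseq E \<and> (\<forall>n. closed (E n) \<and> uniformly_perfect (E n)) \<and> H_part m = (\<Union>n. E n)" for m
    by (intro exI[of _ "\<lambda>n. {z \<in> julia_plane m. \<forall>k\<ge>m + n. main m k z}"] conjI allI main_from_stage H_part_eq_UN)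
       (auto simp: incseq_def)
  have nhnup: "\<not> hnup (julia_plane m)" for m
  proof -
    obtain E :: "nat \<Rightarrow> complex set" where "uniformly_perfect (E 0)" "H_part m = (\<Union>n. E n)" using E by blast
    then show ?thesis using H_part_subset(1)[of m] unfolding hnup_def by blast
  qed
  \<comment> \<open>\<open>thin_at_G_part\<close> speaks of annuli separating the whole Julia set;
    here they have to separate \<open>G_part\<close> itself, which density provides.\<close>
  have thinG: "pointwise_thin (G_part m)" for m
    unfolding pointwise_thin_def
    using pointwise_thin_dense_subset[OF thin_at_G_part _ _ closure_G_part] G_part_Un_H_part by blast
  have comps: "(\<exists>U. Pt ` U \<in> components (fatou poly_seq m) \<and> bounded U \<and> frontier U \<subseteq> K) \<and> uniformly_perfect K"
    if K: "K \<in> components (H_part m)" for m K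
  proof -
    obtain L where L: "L \<in> components (Filled m)" "L \<inter> H_part m \<noteq> {}" "K = frontier L"
      using K unfolding components_H_part by blast
    have "uniformly_perfect (\<Union>{K})"
      using H_part_component_continuum[OF L(1,2)] L(3) by (intro uniformly_perfect_finite_Union_continua) auto
    then show ?thesis using H_part_component_fatou[OF L(1,2)] L(3) by (metis cSup_singleton)
  qed
  have invG: "completely_invariant poly_seq G_part" and invH: "completely_invariant poly_seq H_part"
    by (intro completely_invariant_if_orb_invariant; simp add: G_part_invariant H_part_invariant)+
  show ?thesis
    by (rule exI[of _ param], rule exI[of _ G_part], rule exI[of _ H_part])
       (simp only: Let_def J, intro conjI allI ballI unbounded_poly_seq inf compact_julia_plane nup nhnup G_part_Un_H_part G_part_nonempty
          H_part_nonempty invG invH closure_G_part gdelta_G_part thin_part_julia_plane thinG fsigma_H_part E closure_H_part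
          countable_components_H_part infinite_components_H_part comps, simp_all add: closure_H_part nup comps)
qed

end
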